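(* Let $T$ be a hyperbolic rational map of degree at least $2$ with Julia set $\mathcal{J}$, regarded as a map $T:\mathcal{J}\to\mathcal{J}$, and let $\mu$ be a non-atomic $T$-invariant Borel probability measure on $\mathcal{J}$. Suppose that the covariance of $(T,\mu)$ decays at a super-polynomial rate. Then for $\mu$-a.e. $z\in\mathcal{J}$, 1. $\underline{R}(z)\ge \underline{d}_{\mu}(z)$; 2. $\overline{R}(z)\ge \overline{d}_{\mu}(z)$.
   Context: The Julia set $\mathcal{J}\subset\overline{\mathbb{C}}$ of a rational map $T$ is the closure of the set of repelling periodic points of $T$; it is compact and $T^{-1}(\mathcal{J})=\mathcal{J}$. $T$ is hyperbolic if there exist $C>0$ and $\lambda>1$ with $|(T^n)'(z)|\ge C\lambda^n$ for all $z\in\mathcal{J}$, $n\ge1$. Distances on $\mathcal{J}$ are written $|z-w|$ (Euclidean distance when $\mathcal{J}\subset\mathbb{C}$; if $\infty\in\mathcal{J}$, use the chordal distance and the corresponding derivative). $N_r(z)=\{w\in\mathcal{J}:|z-w|<r\}$ is the open ball in $\mathcal{J}$ of radius $r>0$ about $z$. $\mathbb{Z}_+$ is the set of positive integers. Super-polynomial decay of covariance: for $f:\mathcal{J}\to\mathbb{R}$ Lipschitz put $\|f\|=\sup_{z_1\ne z_2}\frac{|f(z_1)-f(z_2)|}{|z_1-z_2|}$. The covariance decays at a super-polynomial rate if there is a sequence $\theta_n\ge0$ with $n^p\theta_n\to0$ as $n\to\infty$ for every $p>0$, such that for all Lipschitz $f,g:\mathcal{J}\to\mathbb{R}$ and all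 $n\in\mathbb{Z}_+$, $$\left|\int (f\circ T^n)\,g\,d\mu-\int f\,d\mu\int g\,d\mu\right|\le\|f\|\,\|g\|\,\theta_n.$$ Recurrence time: $\tau_r(z)=\inf\{n\in\mathbb{Z}_+: T^n(z)\in N_r(z)\}$ ($=\infty$ if there is no such $n$). Lower and upper recurrence rates: $$\underline{R}(z)=\liminf_{r\to0}\frac{\log\tau_r(z)}{-\log r},\qquad \overline{R}(z)=\limsup_{r\to0}\frac{\log\tau_r(z)}{-\log r}.$$ Lower and upper local dimensions: $$\underline{d}_\mu(z)=\liminf_{r\to0}\frac{\log\mu(N_r(z))}{\log r},\qquad \overline{d}_\mu(z)=\limsup_{r\to0}\frac{\log\mu(N_r(z))}{\log r}.$$ *)

theory Defs
  imports "HOL-Probability.Probability" "HOL-Computational_Algebra.Polynomial_Factorial"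
begin

section \<open>The Riemann sphere with the chordal metric\<close>

datatype rsphere = Fin complex | Infty

primrec to_complex :: "rsphere \<Rightarrow> complex" where
  "to_complex (Fin z) = z"
| "to_complex Infty = 0"

fun chordal :: "rsphere \<Rightarrow> rsphere \<Rightarrow> real" where
  "chordal (Fin z) (Fin w) = 2 * cmod (z - w) / (sqrt (1 + (cmod z)\<^sup>2) * sqrt (1 + (cmod w)\<^sup>2))"
| "chordal (Fin z) Infty = 2 / sqrt (1 + (cmod z)\<^sup>2)"
| "chordal Infty (Fin w) = 2 / sqrt (1 + (cmod w)\<^sup>2)"
| "chordal Infty Infty = 0"

text \<open>Inverse stereographic projection onto the unit sphere of \<open>\<complex> \<times> \<real>\<close>; it shows that the
  chordal distance satisfies the triangle inequality.\<close>

fun stereo :: "rsphere \<Rightarrow> complex \<times> real" where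
  "stereo (Fin z) =
     ((2 / (1 + (cmod z)\<^sup>2)) *\<^sub>R z, ((cmod z)\<^sup>2 - 1) / (1 + (cmod z)\<^sup>2))"
| "stereo Infty = (0, 1)"

lemma stereo_identity:
  fixes x y u v a b :: real
  assumes "a = 1 + (x\<^sup>2 + y\<^sup>2)" "b = 1 + (u\<^sup>2 + v\<^sup>2)"
  shows "(2 / a * x - 2 / b * u)\<^sup>2 + (2 / a * y - 2 / b * v)\<^sup>2 + ((a - 2) / a - (b - 2) / b)\<^sup>2
       = 4 * ((x - u)\<^sup>2 + (y - v)\<^sup>2) / (a * b)"
proof -
  have pos: "a > 0" "b > 0"
    using assms by (auto intro!: add_pos_nonneg)
  have "(2 / a * x - 2 / b * u)\<^sup>2 + (2 / a * y - 2 / b * v)\<^sup>2 + ((a - 2) / a - (b - 2) / b)\<^sup>2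
      = ((2 * x * b - 2 * u * a)\<^sup>2 + (2 * y * b - 2 * v * a)\<^sup>2 + (2 * a - 2 * b)\<^sup>2) / (a * b)\<^sup>2"
    using pos by (simp add: field_simps power2_eq_square)
  also have "(2 * x * b - 2 * u * a)\<^sup>2 + (2 * y * b - 2 * v * a)\<^sup>2 + (2 * a - 2 * b)\<^sup>2
      = 4 * ((x - u)\<^sup>2 + (y - v)\<^sup>2) * (a * b)"
    unfolding assms by algebra
  finally show ?thesis
    using pos by (simp add: power2_eq_square)
qed

lemma chordal_eq_dist_stereo: "chordal p q = dist (stereo p) (stereo q)"
proof -
  have inf: "chordal (Fin z) Infty = dist (stereo (Fin z)) (stereo Infty)" for z
  proof -
    define a where "a = 1 + (cmod z)\<^sup>2"
    have pos: "a > 0" by (auto simp: a_def intro!: add_pos_nonneg)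
    have "(dist (stereo (Fin z)) (stereo Infty))\<^sup>2 = (2 / a)\<^sup>2 * (cmod z)\<^sup>2 + ((a - 2) / a - 1)\<^sup>2"
      using pos
      by (simp add: dist_prod_def dist_norm power_mult_distrib power_divide power2_commute a_def)
    also have "\<dots> = (2 / a)\<^sup>2 * (a - 1) + (2 / a)\<^sup>2"
      using pos by (simp add: a_def field_simps power2_eq_square)
    also have "\<dots> = 4 / a"
      using pos by (simp add: field_simps power2_eq_square)
    also have "\<dots> = (chordal (Fin z) Infty)\<^sup>2"
      using pos by (simp add: a_def power_divide)
    finally show ?thesis
      by (metis chordal.simps(2) divide_nonneg_nonneg power2_eq_iff_nonneg real_sqrt_ge_zero
          zero_le_dist zero_le_numeral add_nonneg_nonneg zero_le_one zero_le_power2)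
  qed
  show ?thesis
  proof (cases p)
    case pF: (Fin z)
    show ?thesis
    proof (cases q)
      case qF: (Fin w)
      define a b where "a = 1 + (cmod z)\<^sup>2" and "b = 1 + (cmod w)\<^sup>2"
      have pos: "a > 0" "b > 0" by (auto simp: a_def b_def intro!: add_pos_nonneg)
      have "(dist (stereo p) (stereo q))\<^sup>2
          = (2 / a * Re z - 2 / b * Re w)\<^sup>2 + (2 / a * Im z - 2 / b * Im w)\<^sup>2
            + ((a - 2) / a - (b - 2) / b)\<^sup>2"
        by (simp add: pF qF dist_prod_def dist_norm cmod_power2 a_def b_def)
      also have "\<dots> = 4 * ((Re z - Re w)\<^sup>2 + (Im z - Im w)\<^sup>2) / (a * b)"
        by (rule stereo_identity) (simp_all add: a_def b_def cmod_power2)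
      also have "\<dots> = 4 * (cmod (z - w))\<^sup>2 / (a * b)"
        by (simp add: cmod_power2)
      also have "\<dots> = (2 * cmod (z - w) / (sqrt a * sqrt b))\<^sup>2"
        using pos by (simp add: power_divide power_mult_distrib)
      also have "\<dots> = (chordal p q)\<^sup>2"
        by (simp add: pF qF a_def b_def)
      finally have "(dist (stereo p) (stereo q))\<^sup>2 = (chordal p q)\<^sup>2" .
      moreover have "0 \<le> chordal p q" by (simp add: pF qF)
      ultimately show ?thesis by (simp add: power2_eq_iff_nonneg)
    next
      case Infty
      then show ?thesis using inf pF by simp
    qed
  next
    case pI: Infty
    then show ?thesis using inf by (cases q) (auto simp: dist_commute)
  qed
qed

instantiation rsphere :: metric_space
begin

definition dist_rsphere :: "rsphere \<Rightarrow> rsphere \<Rightarrow> real" where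
  "dist_rsphere = chordal"

definition uniformity_rsphere :: "(rsphere \<times> rsphere) filter" where
  "uniformity_rsphere = (INF e\<in>{0<..}. principal {(x, y). dist x y < e})"

definition open_rsphere :: "rsphere set \<Rightarrow> bool" where
  "open_rsphere U \<longleftrightarrow> (\<forall>x\<in>U. eventually (\<lambda>(x', y). x' = x \<longrightarrow> y \<in> U) uniformity)"

instance
proof
  fix p q r :: rsphere
  have ne: "1 + (cmod z)\<^sup>2 \<noteq> 0" for z
    by (metis add_pos_nonneg less_irrefl zero_le_power2 zero_less_one)
  show "dist p q = 0 \<longleftrightarrow> p = q"
    by (cases p; cases q) (auto simp: dist_rsphere_def ne)
  show "dist p q \<le> dist p r + dist q r"
    unfolding dist_rsphere_def chordal_eq_dist_stereo by (rule dist_triangle2)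
qed (simp_all add: uniformity_rsphere_def open_rsphere_def)

end

section \<open>Rational maps\<close>

definition rat_map :: "complex poly \<Rightarrow> complex poly \<Rightarrow> rsphere \<Rightarrow> rsphere" where
  "rat_map p q x = (case x of
     Fin z \<Rightarrow> (if poly q z = 0 then Infty else Fin (poly p z / poly q z))
   | Infty \<Rightarrow> (let n = max (degree p) (degree q) in
       if coeff q n = 0 then Infty else Fin (coeff p n / coeff q n)))"

definition rational_map :: "(rsphere \<Rightarrow> rsphere) \<Rightarrow> nat \<Rightarrow> bool" where
  "rational_map T d \<longleftrightarrow>
     (\<exists>p q. q \<noteq> 0 \<and> coprime p q \<and> max (degree p) (degree q) = d \<and> T = rat_map p q)"

text \<open>The chart \<open>z \<mapsto> 1/z\<close> about \<open>\<infinity>\<close>.\<close>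

definition sphere_inv :: "rsphere \<Rightarrow> rsphere" where
  "sphere_inv x = (case x of Fin z \<Rightarrow> if z = 0 then Infty else Fin (1 / z) | Infty \<Rightarrow> Fin 0)"

text \<open>Only meaningful at a finite point \<open>z\<close> whose image is finite.\<close>

definition affine_deriv :: "(rsphere \<Rightarrow> rsphere) \<Rightarrow> rsphere \<Rightarrow> complex" where
  "affine_deriv F z = deriv (\<lambda>w. to_complex (F (Fin w))) (to_complex z)"

text \<open>Derivative of \<open>F\<close> at a fixed point, in the chart \<open>1/z\<close> when the fixed point is \<open>\<infinity>\<close>.\<close>

definition multiplier :: "(rsphere \<Rightarrow> rsphere) \<Rightarrow> rsphere \<Rightarrow> complex" where
  "multiplier F z =
     (if z = Infty then affine_deriv (sphere_inv \<circ> F \<circ> sphere_inv) (Fin 0) else affine_deriv F z)"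

definition repelling_periodic :: "(rsphere \<Rightarrow> rsphere) \<Rightarrow> rsphere \<Rightarrow> bool" where
  "repelling_periodic T z \<longleftrightarrow> (\<exists>n\<ge>1. (T ^^ n) z = z \<and> cmod (multiplier (T ^^ n) z) > 1)"

definition julia :: "(rsphere \<Rightarrow> rsphere) \<Rightarrow> rsphere set" where
  "julia T = closure {z. repelling_periodic T z}"

section \<open>Metric and derivative on the Julia set\<close>

text \<open>Euclidean if the Julia set lies in \<open>\<complex>\<close>, chordal otherwise.\<close>

definition jdist :: "(rsphere \<Rightarrow> rsphere) \<Rightarrow> rsphere \<Rightarrow> rsphere \<Rightarrow> real" where
  "jdist T z w = (if Infty \<in> julia T then dist z w else cmod (to_complex z - to_complex w))"

definition jball :: "(rsphere \<Rightarrow> rsphere) \<Rightarrow> rsphere \<Rightarrow> real \<Rightarrow> rsphere set" where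
  "jball T z r = {w \<in> julia T. jdist T z w < r}"

definition chordal_deriv :: "(rsphere \<Rightarrow> rsphere) \<Rightarrow> rsphere \<Rightarrow> real" where
  "chordal_deriv F z = Lim (at z) (\<lambda>w. dist (F w) (F z) / dist w z)"

definition jderiv :: "(rsphere \<Rightarrow> rsphere) \<Rightarrow> nat \<Rightarrow> rsphere \<Rightarrow> real" where
  "jderiv T n z =
     (if Infty \<in> julia T then chordal_deriv (T ^^ n) z else cmod (affine_deriv (T ^^ n) z))"

definition hyperbolic :: "(rsphere \<Rightarrow> rsphere) \<Rightarrow> bool" where
  "hyperbolic T \<longleftrightarrow>
     (\<exists>C>0. \<exists>l>1. \<forall>z\<in>julia T. \<forall>n\<ge>1. jderiv T n z \<ge> C * l ^ n)"

section \<open>Measures on the Julia set\<close>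

definition invariant_measure :: "('a \<Rightarrow> 'a) \<Rightarrow> 'a measure \<Rightarrow> bool" where
  "invariant_measure T M \<longleftrightarrow> T \<in> measurable M M \<and> distr M M T = M"

definition non_atomic :: "'a measure \<Rightarrow> bool" where
  "non_atomic M \<longleftrightarrow>
     \<not> (\<exists>A\<in>sets M. emeasure M A > 0 \<and>
          (\<forall>B\<in>sets M. B \<subseteq> A \<longrightarrow> emeasure M B = 0 \<or> emeasure M B = emeasure M A))"

definition jlipschitz :: "(rsphere \<Rightarrow> rsphere) \<Rightarrow> (rsphere \<Rightarrow> real) \<Rightarrow> bool" where
  "jlipschitz T f \<longleftrightarrow>
     (\<exists>L. \<forall>z\<in>julia T. \<forall>w\<in>julia T. \<bar>f z - f w\<bar> \<le> L * jdist T z w)"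

definition lip_seminorm :: "(rsphere \<Rightarrow> rsphere) \<Rightarrow> (rsphere \<Rightarrow> real) \<Rightarrow> real" where
  "lip_seminorm T f =
     Sup {\<bar>f z - f w\<bar> / jdist T z w | z w. z \<in> julia T \<and> w \<in> julia T \<and> z \<noteq> w}"

definition superpoly_covariance_decay :: "(rsphere \<Rightarrow> rsphere) \<Rightarrow> rsphere measure \<Rightarrow> bool" where
  "superpoly_covariance_decay T M \<longleftrightarrow>
     (\<exists>\<theta> :: nat \<Rightarrow> real.
        (\<forall>n. \<theta> n \<ge> 0) \<and>
        (\<forall>p::real. p > 0 \<longrightarrow> (\<lambda>n. real n powr p * \<theta> n) \<longlonglongrightarrow> 0) \<and>
        (\<forall>f g. jlipschitz T f \<longrightarrow> jlipschitz T g \<longrightarrow>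
           (\<forall>n\<ge>1. \<bar>(LINT z|M. f ((T ^^ n) z) * g z) - (LINT z|M. f z) * (LINT z|M. g z)\<bar>
                   \<le> lip_seminorm T f * lip_seminorm T g * \<theta> n)))"

section \<open>Recurrence rates and local dimensions\<close>

text \<open>Logarithm on \<open>[0,\<infinity>]\<close>, with \<open>log 0 = -\<infinity>\<close> and \<open>log \<infinity> = \<infinity>\<close>.\<close>

definition ereal_log :: "ereal \<Rightarrow> ereal" where
  "ereal_log x = (if x = \<infinity> then \<infinity> else if x \<le> 0 then - \<infinity> else ereal (ln (real_of_ereal x)))"

text \<open>The infimum of the empty set in \<open>enat\<close> is \<open>\<infinity>\<close>.\<close>

definition recurrence_time :: "(rsphere \<Rightarrow> rsphere) \<Rightarrow> real \<Rightarrow> rsphere \<Rightarrow> enat" where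
  "recurrence_time T r z = Inf {enat n | n. n \<ge> 1 \<and> (T ^^ n) z \<in> jball T z r}"

definition lower_recurrence_rate :: "(rsphere \<Rightarrow> rsphere) \<Rightarrow> rsphere \<Rightarrow> ereal" where
  "lower_recurrence_rate T z =
     Liminf (at_right 0) (\<lambda>r. ereal_log (ereal_of_enat (recurrence_time T r z)) / ereal (- ln r))"

definition upper_recurrence_rate :: "(rsphere \<Rightarrow> rsphere) \<Rightarrow> rsphere \<Rightarrow> ereal" where
  "upper_recurrence_rate T z =
     Limsup (at_right 0) (\<lambda>r. ereal_log (ereal_of_enat (recurrence_time T r z)) / ereal (- ln r))"

definition lower_local_dim ::
    "(rsphere \<Rightarrow> rsphere) \<Rightarrow> rsphere measure \<Rightarrow> rsphere \<Rightarrow> ereal" where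
  "lower_local_dim T M z =
     Liminf (at_right 0) (\<lambda>r. ereal_log (ereal (measure M (jball T z r))) / ereal (ln r))"

definition upper_local_dim ::
    "(rsphere \<Rightarrow> rsphere) \<Rightarrow> rsphere measure \<Rightarrow> rsphere \<Rightarrow> ereal" where
  "upper_local_dim T M z =
     Limsup (at_right 0) (\<lambda>r. ereal_log (ereal (measure M (jball T z r))) / ereal (ln r))"

end

theory Submission
  imports Defs "HOL-Real_Asymp.Real_Asymp"
begin

text \<open>The lower inequality needs no expansion. By decay of covariance
  \<open>\<mu> (B \<inter> T\<^sup>-\<^sup>n 2B) \<le> \<mu> (3B)\<^sup>2 + \<theta>\<^sub>n / r\<^sup>2\<close> for balls \<open>B\<close> of radius \<open>r\<close>, so if \<open>\<mu> (N\<^sub>r z) \<le> r\<^sup>b\<close> for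
  small \<open>r\<close> and \<open>a < b\<close>, then Borel-Cantelli with \<open>r = n\<close> to the power \<open>-1/a\<close> gives
  \<open>|T\<^sup>n z - z| \<ge> r\<close> for all large \<open>n\<close>, hence a lower recurrence rate at least \<open>a\<close>.

  The same argument along the radii \<open>2\<^sup>-\<^sup>k\<close> yields the upper inequality, provided that returns before
  time \<open>r\<close> to the power \<open>-a\<close> are excluded for some \<open>a > 0\<close>; by the first part this holds where the
  lower local dimension is positive. The set where it vanishes is forward invariant, hence null or of full
  measure. If it has full measure, an Ornstein-Weiss covering argument for the expanding iterate
  of \<open>T\<close> shows that the upper local dimension vanishes too: most of a typical orbit is covered by
  blocks that start in balls of large measure, so few Bowen balls carry most of the mass.\<close>

section \<open>Separated sets\<close>

text \<open>Decay of covariance is useless at times that stay below every positive power of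
  \<open>1/r\<close>: its bound carries the factor \<open>r\<close> to the power
  \<open>-(DIM('b) + 2)\<close>, and \<open>\<theta> n\<close> is not yet small. In the lower
  inequality the radius is tied to the time and the problem disappears. The upper inequality fixes a
  radius and looks at all times up to a power of \<open>1/r\<close>, so early returns have to be
  excluded by other means; a positive lower local dimension does this. Where it vanishes, expansion
  takes over: heavy balls at infinitely many scales make orbits cheap to encode, as for zero
  entropy, and this yields heavy balls at all scales. The upper inequality is then trivial, since
  recurrence rates are nonnegative.

  Null or full measure is a form of mixing: the indicator of a forward invariant set has
  self-correlation equal to its measure at every time, and approximation in the mean by Lipschitz
  functions makes the decay applicable to it.

  Exponents depend on the point. Almost-everywhere statements are therefore collected over rational
  exponents, and the comparison of rates is made inside a gap that contains rationals.\<close>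

lemma separated_card_bound:
  fixes \<phi> :: "'a \<Rightarrow> 'b::euclidean_space"
  assumes s: "0 < s" and R: "0 \<le> R" and sub: "\<phi> ` S \<subseteq> cball y R"
    and sep: "\<And>u v. u \<in> S \<Longrightarrow> v \<in> S \<Longrightarrow> u \<noteq> v \<Longrightarrow> s \<le> dist (\<phi> u) (\<phi> v)"
  shows "finite S" "real (card S) \<le> (2 * R / s + 1) ^ DIM('b)"
proof -
  have bound: "real (card F) \<le> (2 * R / s + 1) ^ DIM('b)" if F: "finite F" "F \<subseteq> S" for F
  proof -
    define V where "V = unit_ball_vol (real DIM('b))"
    have V: "V > 0" by (simp add: V_def)
    \<comment> \<open>Volume packing: the balls of radius \<open>s/2\<close> are disjoint and lie in
      a ball of radius \<open>R + s/2\<close>. The quotient of the two radii is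
      \<open>2 * R / s + 1\<close>.\<close>
    have disj: "disjoint_family_on (\<lambda>u. ball (\<phi> u) (s/2)) F"
    proof (unfold disjoint_family_on_def, intro ballI impI)
      fix u v assume uv: "u \<in> F" "v \<in> F" "u \<noteq> v"
      have "False" if x: "dist (\<phi> u) x < s/2" "dist (\<phi> v) x < s/2" for x
        using sep[of u v] uv F x dist_triangle2[of "\<phi> u" "\<phi> v" x] by fastforce
      then show "ball (\<phi> u) (s/2) \<inter> ball (\<phi> v) (s/2) = {}" by auto
    qed
    have sub2: "(\<Union>u\<in>F. ball (\<phi> u) (s/2)) \<subseteq> cball y (R + s/2)"
    proof safe
      fix u x assume u: "u \<in> F" "x \<in> ball (\<phi> u) (s/2)"
      then have "dist y (\<phi> u) \<le> R" using sub F(2) by (auto simp: image_subset_iff)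
      with u show "x \<in> cball y (R + s/2)" using dist_triangle[of y x "\<phi> u"] s by (auto simp: dist_commute)
    qed
    have "real (card F) * (V * (s/2) ^ DIM('b)) = (\<Sum>u\<in>F. measure lborel (ball (\<phi> u) (s/2)))"
      using s by (simp add: content_ball V_def)
    also have "\<dots> = measure lborel (\<Union>u\<in>F. ball (\<phi> u) (s/2))"
      by (rule measure_finite_Union[symmetric]) (use F disj s in \<open>auto simp: emeasure_ball emeasure_lborel_ball_finite less_top[symmetric]\<close>)
    also have "\<dots> \<le> measure lborel (cball y (R + s/2))"
      by (rule measure_mono_fmeasurable[OF sub2]) (use F(1) emeasure_lborel_cball_finite[of y "R + s/2"] in \<open>auto simp: fmeasurable_def less_top intro!: borel_open\<close>)
    also have "\<dots> = V * (R + s/2) ^ DIM('b)"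
      using s R by (simp add: content_cball V_def)
    finally have "real (card F) * (s/2) ^ DIM('b) \<le> (R + s/2) ^ DIM('b)"
      using V by (simp add: field_simps)
    then have "real (card F) \<le> (R + s/2) ^ DIM('b) / (s/2) ^ DIM('b)"
      using s by (subst pos_le_divide_eq) auto
    also have "\<dots> = (2 * R / s + 1) ^ DIM('b)"
      using s by (simp add: power_divide[symmetric] add_divide_distrib mult.commute)
    finally show ?thesis .
  qed
  show fin: "finite S"
  proof (rule ccontr)
    assume "infinite S"
    then obtain F where F: "F \<subseteq> S" "finite F" "card F = Suc (nat \<lceil>(2 * R / s + 1) ^ DIM('b)\<rceil>)"
      using infinite_arbitrarily_large by blast
    have "real (card F) > (2 * R / s + 1) ^ DIM('b)"
      unfolding F(3) by linarith
    with bound[of F] F show False by simp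
  qed
  show "real (card S) \<le> (2 * R / s + 1) ^ DIM('b)" by (rule bound[OF fin order_refl])
qed

text \<open>The packing bound limits the size of separated sets, so one of largest cardinality
  exists. It cannot be enlarged, hence every point is within \<open>s\<close> of it.\<close>

lemma maximal_separated_subset:
  fixes \<phi> :: "'a \<Rightarrow> 'b::euclidean_space"
  assumes s: "0 < s" and bd: "bounded (\<phi> ` Z)"
  obtains S where "finite S" "S \<subseteq> Z"
    "\<And>u v. u \<in> S \<Longrightarrow> v \<in> S \<Longrightarrow> u \<noteq> v \<Longrightarrow> s \<le> dist (\<phi> u) (\<phi> v)"
    "\<And>z. z \<in> Z \<Longrightarrow> \<exists>x\<in>S. dist (\<phi> x) (\<phi> z) < s"
proof -
  obtain y R where R: "\<phi> ` Z \<subseteq> cball y R" "0 \<le> R"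
    by (metis bd bounded_subset_cball)
  define sepd where "sepd S \<longleftrightarrow> S \<subseteq> Z \<and> (\<forall>u\<in>S. \<forall>v\<in>S. u \<noteq> v \<longrightarrow> s \<le> dist (\<phi> u) (\<phi> v))" for S
  have sb: "finite S \<and> real (card S) \<le> (2 * R / s + 1) ^ DIM('b)" if "sepd S" for S
  proof -
    have "\<phi> ` S \<subseteq> cball y R" "\<And>u v. u \<in> S \<Longrightarrow> v \<in> S \<Longrightarrow> u \<noteq> v \<Longrightarrow> s \<le> dist (\<phi> u) (\<phi> v)"
      using that R(1) unfolding sepd_def by auto
    from separated_card_bound[OF s R(2) this] show ?thesis by simp
  qed
  have "card S < Suc (nat \<lceil>(2 * R / s + 1) ^ DIM('b)\<rceil>)" if "sepd S" for S
    using sb[OF that] by linarith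
  moreover have "sepd {}" by (simp add: sepd_def)
  ultimately have "\<exists>S. sepd S \<and> (\<forall>S'. sepd S' \<longrightarrow> card S' \<le> card S)"
    by (intro ex_has_greatest_nat) auto
  then obtain S where S: "sepd S" "\<And>S'. sepd S' \<Longrightarrow> card S' \<le> card S" by blast
  have "\<exists>x\<in>S. dist (\<phi> x) (\<phi> z) < s" if z: "z \<in> Z" for z
  proof (rule ccontr)
    assume neg: "\<not> ?thesis"
    then have "z \<notin> S" using s by force
    moreover have "sepd (insert z S)"
      using S(1) neg z unfolding sepd_def by (auto simp: not_less dist_commute)
    ultimately show False using S(2)[of "insert z S"] sb[OF S(1)] by simp
  qed
  moreover have "finite S" "S \<subseteq> Z" "\<forall>u\<in>S. \<forall>v\<in>S. u \<noteq> v \<longrightarrow> s \<le> dist (\<phi> u) (\<phi> v)"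
    using S(1) sb[OF S(1)] unfolding sepd_def by auto
  ultimately show ?thesis by (intro that[of S]) auto
qed

section \<open>Rapidly mixing systems\<close>

text \<open>Distances are pulled back along \<open>\<phi>\<close>, so that the Euclidean and the chordal metric on the
  Julia set are covered at once.\<close>

locale mixing_system = prob_space M for M :: "'a measure" +
  fixes T :: "'a \<Rightarrow> 'a" and \<phi> :: "'a \<Rightarrow> 'b::euclidean_space" and \<theta> :: "nat \<Rightarrow> real"
  assumes phi_meas [measurable]: "\<phi> \<in> borel_measurable M"
    and phi_inj: "inj_on \<phi> (space M)"
    and phi_bounded: "bounded (\<phi> ` space M)"
    and T_meas [measurable]: "T \<in> measurable M M"
    and T_inv: "distr M M T = M"
    and theta_nonneg: "\<theta> n \<ge> 0"
    and decay: "\<lbrakk>0 \<le> K; 0 \<le> K'; n \<ge> 1;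
      \<And>x y. x \<in> space M \<Longrightarrow> y \<in> space M \<Longrightarrow> \<bar>f x - f y\<bar> \<le> K * dist (\<phi> x) (\<phi> y);
      \<And>x y. x \<in> space M \<Longrightarrow> y \<in> space M \<Longrightarrow> \<bar>g x - g y\<bar> \<le> K' * dist (\<phi> x) (\<phi> y)\<rbrakk>
      \<Longrightarrow> \<bar>(\<integral>x. f ((T ^^ n) x) * g x \<partial>M) - (\<integral>x. f x \<partial>M) * (\<integral>x. g x \<partial>M)\<bar> \<le> K * K' * \<theta> n"
begin

section \<open>Balls, invariance and measurability\<close>

definition nball :: "'a \<Rightarrow> real \<Rightarrow> 'a set" where
  "nball z r = {w \<in> space M. dist (\<phi> z) (\<phi> w) < r}"

lemma Tn_meas [measurable]: "(T ^^ n) \<in> measurable M M"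
  by (rule measurable_compose_n) measurable

lemma Tn_space: "z \<in> space M \<Longrightarrow> (T ^^ n) z \<in> space M"
  using measurable_space[OF Tn_meas] .

lemma Tn_inv: "distr M M (T ^^ n) = M"
proof (induction n)
  case 0
  show ?case using distr_id[of M] by (simp add: id_def)
next
  case (Suc n)
  have "distr M M (T ^^ Suc n) = distr (distr M M (T ^^ n)) M T"
    unfolding funpow.simps by (rule distr_distr[OF T_meas Tn_meas, symmetric])
  then show ?case unfolding Suc T_inv .
qed

lemma integral_Tn:
  fixes f :: "'a \<Rightarrow> real"
  assumes "f \<in> borel_measurable M"
  shows "(\<integral>x. f ((T ^^ n) x) \<partial>M) = (\<integral>x. f x \<partial>M)"
  using integral_distr[OF Tn_meas[of n] assms] by (simp add: Tn_inv)

lemma nball_meas [measurable]: "nball z r \<in> sets M"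
  unfolding nball_def by measurable

lemma measure_nball_meas [measurable]: "(\<lambda>z. measure M (nball z r)) \<in> borel_measurable M"
proof -
  have "{p \<in> space (M \<Otimes>\<^sub>M M). dist (\<phi> (fst p)) (\<phi> (snd p)) < r} \<in> sets (M \<Otimes>\<^sub>M M)"
    by measurable
  from measurable_emeasure_Pair[OF this]
  have "(\<lambda>z. enn2real (emeasure M (Pair z -` {p \<in> space (M \<Otimes>\<^sub>M M). dist (\<phi> (fst p)) (\<phi> (snd p)) < r}))) \<in> borel_measurable M"
    by measurable
  then show ?thesis
    by (rule measurable_cong[THEN iffD1, rotated])
      (auto simp: nball_def measure_def space_pair_measure intro!: arg_cong[where f="\<lambda>A. enn2real (emeasure M A)"])
qed

lemma nball_mono: "r \<le> r' \<Longrightarrow> nball z r \<subseteq> nball z r'"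
  by (auto simp: nball_def)

text \<open>The estimate makes \<open>f\<close> constant on fibres of \<open>\<phi>\<close>, so
  \<open>f\<close> is a Lipschitz, hence continuous, function of \<open>\<phi>\<close>.
  Measurability of test functions thus never has to be assumed.\<close>

lemma Lipschitz_borel_measurable:
  fixes f :: "'a \<Rightarrow> real"
  assumes K: "\<And>x y. x \<in> space M \<Longrightarrow> y \<in> space M \<Longrightarrow> \<bar>f x - f y\<bar> \<le> K * dist (\<phi> x) (\<phi> y)"
  shows "f \<in> borel_measurable M"
proof -
  have "\<exists>h. \<forall>x\<in>space M. f x = h (\<phi> x)"
  proof -
    have "f x = f (SOME x'. x' \<in> space M \<and> \<phi> x' = \<phi> x)" if x: "x \<in> space M" for x
    proof -
      have "\<exists>x'. x' \<in> space M \<and> \<phi> x' = \<phi> x" using x by blast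
      from someI_ex[OF this] K[OF x, of "SOME x'. x' \<in> space M \<and> \<phi> x' = \<phi> x"] show ?thesis by simp
    qed
    then show ?thesis by (intro exI[of _ "\<lambda>b. f (SOME x'. x' \<in> space M \<and> \<phi> x' = b)"]) simp
  qed
  then obtain h where h: "\<And>x. x \<in> space M \<Longrightarrow> f x = h (\<phi> x)" by blast
  have "(\<bar>K\<bar>)-lipschitz_on (\<phi> ` space M) h"
  proof (rule lipschitz_onI)
    fix a b assume "a \<in> \<phi> ` space M" "b \<in> \<phi> ` space M"
    then obtain x y where xy: "x \<in> space M" "y \<in> space M" "a = \<phi> x" "b = \<phi> y" by auto
    have "K * dist (\<phi> x) (\<phi> y) \<le> \<bar>K\<bar> * dist (\<phi> x) (\<phi> y)" by (simp add: mult_right_mono)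
    then show "dist (h a) (h b) \<le> \<bar>K\<bar> * dist a b"
      using K[OF xy(1,2)] h xy by (simp add: dist_real_def)
  qed simp
  then have "continuous_on (\<phi> ` space M) h" by (rule lipschitz_on_continuous_on)
  then have "h \<in> borel_measurable (restrict_space borel (\<phi> ` space M))"
    by (rule borel_measurable_continuous_on_restrict)
  moreover have "\<phi> \<in> measurable M (restrict_space borel (\<phi> ` space M))"
    by (rule measurable_restrict_space2) auto
  ultimately have "(\<lambda>x. h (\<phi> x)) \<in> borel_measurable M"
    using measurable_compose by blast
  then show ?thesis using measurable_cong[of M f "\<lambda>x. h (\<phi> x)"] h by blast
qed

lemma integrable_unit_bounded:
  fixes f :: "'a \<Rightarrow> real"
  assumes "f \<in> borel_measurable M" "\<And>x. x \<in> space M \<Longrightarrow> 0 \<le> f x" "\<And>x. x \<in> space M \<Longrightarrow> f x \<le> 1"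
  shows "integrable M f"
  by (rule integrable_const_bound[where B=1]) (use assms in \<open>auto intro!: AE_I2\<close>)

lemma return_correlation:
  assumes r: "0 < r" and n: "n \<ge> 1"
  shows "measure M {w \<in> space M. w \<in> nball x r \<and> (T ^^ n) w \<in> nball x (2 * r)}
    \<le> (measure M (nball x (3 * r)))\<^sup>2 + \<theta> n / r\<^sup>2"
proof -
  \<comment> \<open>A cutoff equal to 1 on the ball of radius \<open>2 * r\<close> and 0 off the
    ball of radius \<open>3 * r\<close>. Its Lipschitz constant \<open>1/r\<close> enters twice and
    produces the factor \<open>1 / r\<^sup>2\<close>.\<close>
  define f where "f w = max 0 (min 1 (3 - dist (\<phi> x) (\<phi> w) / r))" for w
  have f01: "0 \<le> f w" "f w \<le> 1" for w by (auto simp: f_def)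
  have [measurable]: "f \<in> borel_measurable M" unfolding f_def by measurable
  have lip: "\<bar>f u - f v\<bar> \<le> (1/r) * dist (\<phi> u) (\<phi> v)" for u v
  proof -
    have "\<bar>dist (\<phi> x) (\<phi> u) / r - dist (\<phi> x) (\<phi> v) / r\<bar> = \<bar>dist (\<phi> x) (\<phi> u) - dist (\<phi> x) (\<phi> v)\<bar> / r"
      using r by (simp add: diff_divide_distrib[symmetric])
    also have "\<dots> \<le> dist (\<phi> u) (\<phi> v) / r"
      using r abs_dist_diff_le[of "\<phi> u" "\<phi> x" "\<phi> v"] by (intro divide_right_mono) (auto simp: dist_commute)
    finally show ?thesis unfolding f_def by (auto simp: abs_if max_def min_def split: if_splits)
  qed
  have le: "indicat_real {w \<in> space M. w \<in> nball x r \<and> (T ^^ n) w \<in> nball x (2 * r)} w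
      \<le> f ((T ^^ n) w) * f w" for w
  proof (cases "w \<in> nball x r \<and> (T ^^ n) w \<in> nball x (2 * r)")
    case True
    then have "dist (\<phi> x) (\<phi> w) / r \<le> 2" "dist (\<phi> x) (\<phi> ((T ^^ n) w)) / r \<le> 2"
      using r by (auto simp: nball_def field_simps)
    then show ?thesis by (auto simp: f_def)
  qed (use f01 in auto)
  have "measure M {w \<in> space M. w \<in> nball x r \<and> (T ^^ n) w \<in> nball x (2 * r)}
      = (\<integral>w. indicat_real {w \<in> space M. w \<in> nball x r \<and> (T ^^ n) w \<in> nball x (2 * r)} w \<partial>M)"
    by simp
  also have "\<dots> \<le> (\<integral>w. f ((T ^^ n) w) * f w \<partial>M)"
    by (intro integral_mono integrable_unit_bounded le) (auto intro!: mult_le_one mult_nonneg_nonneg f01 split: split_indicator)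
  also have "\<dots> \<le> (\<integral>w. f w \<partial>M) * (\<integral>w. f w \<partial>M) + (1/r) * (1/r) * \<theta> n"
    using decay[of "1/r" "1/r" n f f] lip r n by auto
  also have "(\<integral>w. f w \<partial>M) * (\<integral>w. f w \<partial>M) \<le> measure M (nball x (3*r)) * measure M (nball x (3*r))"
  proof -
    have le': "f w \<le> indicat_real (nball x (3*r)) w" if "w \<in> space M" for w
      using r that by (auto simp: f_def nball_def indicator_def field_simps)
    have "(\<integral>w. f w \<partial>M) \<le> (\<integral>w. indicat_real (nball x (3*r)) w \<partial>M)"
      by (rule integral_mono[OF integrable_unit_bounded integrable_unit_bounded le']) (auto intro!: f01 split: split_indicator)
    also have "\<dots> = measure M (nball x (3*r))" by simp
    finally show ?thesis by (intro mult_mono) (auto intro!: Bochner_Integration.integral_nonneg f01)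
  qed
  finally show ?thesis by (simp add: power2_eq_square)
qed

text \<open>Radius \<open>3 * r\<close> is the one in the correlation bound. The cap
  \<open>c\<close> turns the square there into \<open>c\<close> times a measure, which can be summed
  over a cover of bounded overlap.\<close>

definition return_set :: "nat \<Rightarrow> real \<Rightarrow> real \<Rightarrow> 'a set" where
  "return_set n r c = {z \<in> space M. dist (\<phi> ((T ^^ n) z)) (\<phi> z) < r \<and> measure M (nball z (3 * r)) \<le> c}"

lemma return_set_meas [measurable]: "return_set n r c \<in> sets M"
  unfolding return_set_def by measurable

text \<open>Cover the set by balls of radius \<open>r\<close> about an \<open>r\<close>-separated set; the concentric balls of
  radius \<open>3 r\<close> overlap boundedly.\<close>

lemma measure_return_set:
  obtains C where "0 \<le> C"
    "\<And>n r c. \<lbrakk>1 \<le> n; 0 < r; r \<le> 1; 0 \<le> c\<rbrakk> \<Longrightarrow>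
       measure M (return_set n r c) \<le> C * (c + \<theta> n / r ^ (DIM('b) + 2))"
proof -
  obtain y R where R: "\<phi> ` space M \<subseteq> cball y R" "0 \<le> R"
    by (metis phi_bounded bounded_subset_cball)
  define C where "C = max (7 ^ DIM('b)) ((2 * R + 1) ^ DIM('b))"
  have "measure M (return_set n r c) \<le> C * (c + \<theta> n / r ^ (DIM('b) + 2))"
    if n: "1 \<le> n" and r: "0 < r" "r \<le> 1" and c: "0 \<le> c" for n r c
  proof -
    let ?E = "return_set n r c"
    have "bounded (\<phi> ` ?E)"
      by (rule bounded_subset[OF phi_bounded]) (auto simp: return_set_def)
    then obtain S where S: "finite S" "S \<subseteq> ?E"
      and sep: "\<And>u v. u \<in> S \<Longrightarrow> v \<in> S \<Longrightarrow> u \<noteq> v \<Longrightarrow> r \<le> dist (\<phi> u) (\<phi> v)"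
      and cov: "\<And>z. z \<in> ?E \<Longrightarrow> \<exists>x\<in>S. dist (\<phi> x) (\<phi> z) < r"
      using maximal_separated_subset[OF r(1)] by metis
    define Q where "Q x = {w \<in> space M. w \<in> nball x r \<and> (T ^^ n) w \<in> nball x (2 * r)}" for x
    have [measurable]: "Q x \<in> sets M" for x unfolding Q_def by measurable
    have "?E \<subseteq> (\<Union>x\<in>S. Q x)"
    proof
      fix z assume z: "z \<in> ?E"
      then obtain x where x: "x \<in> S" "dist (\<phi> x) (\<phi> z) < r" using cov by blast
      have "dist (\<phi> x) (\<phi> ((T ^^ n) z)) < 2 * r"
        using x z dist_triangle2[of "\<phi> x" "\<phi> ((T ^^ n) z)" "\<phi> z"] by (auto simp: return_set_def)
      then show "z \<in> (\<Union>x\<in>S. Q x)"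
        using x z Tn_space by (auto simp: Q_def nball_def return_set_def)
    qed
    then have "measure M ?E \<le> measure M (\<Union>x\<in>S. Q x)"
      using S(1) by (intro finite_measure_mono) auto
    also have "\<dots> \<le> (\<Sum>x\<in>S. measure M (Q x))"
      using S(1) by (intro finite_measure_subadditive_finite) auto
    also have "\<dots> \<le> (\<Sum>x\<in>S. c * measure M (nball x (3*r)) + \<theta> n / r\<^sup>2)"
    proof (rule sum_mono)
      fix x assume "x \<in> S"
      then have "measure M (nball x (3*r)) \<le> c" using S(2) by (auto simp: return_set_def)
      then have "(measure M (nball x (3 * r)))\<^sup>2 \<le> c * measure M (nball x (3*r))"
        by (simp add: power2_eq_square mult_right_mono)
      then show "measure M (Q x) \<le> c * measure M (nball x (3*r)) + \<theta> n / r\<^sup>2"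
        using return_correlation[OF r(1) n, of x] unfolding Q_def by linarith
    qed
    also have "\<dots> = c * (\<Sum>x\<in>S. measure M (nball x (3*r))) + real (card S) * (\<theta> n / r\<^sup>2)"
      by (simp add: sum.distrib sum_distrib_left)
    \<comment> \<open>The centres of the balls that contain a given \<open>w\<close> are
      \<open>r\<close>-separated and within \<open>3 * r\<close> of \<open>w\<close>, so there are
      at most \<open>7 ^ DIM('b)\<close> of them, with 7 = 2 * 3 + 1.\<close>
    also have "(\<Sum>x\<in>S. measure M (nball x (3*r))) \<le> 7 ^ DIM('b)"
    proof -
      have "(\<Sum>x\<in>S. measure M (nball x (3*r))) = (\<integral>w. (\<Sum>x\<in>S. indicat_real (nball x (3*r)) w) \<partial>M)"
        by (subst Bochner_Integration.integral_sum) (auto intro!: integrable_real_indicator simp: less_top[symmetric])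
      also have "\<dots> \<le> (\<integral>w. 7 ^ DIM('b) \<partial>M)"
      proof (rule integral_mono)
        fix w
        let ?S = "{x \<in> S. w \<in> nball x (3*r)}"
        have "(\<Sum>x\<in>S. indicat_real (nball x (3*r)) w) = real (card ?S)"
          using S(1) by (simp add: indicator_def sum.If_cases Int_def)
        also have "\<dots> \<le> (2 * (3*r) / r + 1) ^ DIM('b)"
          by (rule separated_card_bound(2)[of r "3*r" \<phi> _ "\<phi> w"])
            (use r sep in \<open>auto simp: nball_def dist_commute\<close>)
        also have "\<dots> = 7 ^ DIM('b)" using r by simp
        finally show "(\<Sum>x\<in>S. indicat_real (nball x (3*r)) w) \<le> 7 ^ DIM('b)" .
      qed (auto intro!: Bochner_Integration.integrable_sum integrable_real_indicator simp: less_top[symmetric])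
      also have "\<dots> = 7 ^ DIM('b)" by (simp add: prob_space)
      finally show ?thesis .
    qed
    \<comment> \<open>The number of centres contributes \<open>r\<close> to the power
      \<open>-DIM('b)\<close>, the two Lipschitz constants the other \<open>-2\<close>. The
      assumption \<open>r \<le> 1\<close> absorbs the summand 1 of the packing bound.\<close>
    also have "real (card S) \<le> ((2 * R + 1) / r) ^ DIM('b)"
    proof -
      have "real (card S) \<le> (2 * R / r + 1) ^ DIM('b)"
        by (rule separated_card_bound(2)[of r R \<phi> _ y])
          (use r R sep S in \<open>auto simp: return_set_def subset_iff\<close>)
      also have "\<dots> \<le> ((2 * R + 1) / r) ^ DIM('b)"
        using r R by (intro power_mono) (auto simp: field_simps)
      finally show ?thesis .
    qed
    finally have "measure M ?E \<le> c * 7 ^ DIM('b) + ((2 * R + 1) / r) ^ DIM('b) * (\<theta> n / r\<^sup>2)"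
      using c theta_nonneg[of n] by (simp add: mult_left_mono mult_right_mono del: times_divide_eq_right)
    also have "((2 * R + 1) / r) ^ DIM('b) * (\<theta> n / r\<^sup>2) = (2 * R + 1) ^ DIM('b) * (\<theta> n / r ^ (DIM('b) + 2))"
      by (simp add: power_divide power_add power2_eq_square)
    also have "c * 7 ^ DIM('b) \<le> C * c" using c by (simp add: C_def mult.commute mult_left_mono)
    also have "(2 * R + 1) ^ DIM('b) * (\<theta> n / r ^ (DIM('b) + 2)) \<le> C * (\<theta> n / r ^ (DIM('b) + 2))"
      using r theta_nonneg[of n] by (intro mult_right_mono) (auto simp: C_def)
    finally show ?thesis by (simp add: distrib_left)
  qed
  moreover have "0 \<le> C" by (simp add: C_def le_max_iff_disj)
  ultimately show ?thesis using that by blast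
qed

end

section \<open>Recurrence and scaling of balls\<close>

lemma (in prob_space) AE_eventually_notin:
  assumes [measurable]: "\<And>n. E n \<in> sets M" and "summable (\<lambda>n. measure M (E n))"
  shows "AE x in M. eventually (\<lambda>n. x \<notin> E n) sequentially"
proof -
  have "AE x in M. eventually (\<lambda>n. x \<in> space M - E n) sequentially"
    by (rule borel_cantelli_AE1) (use assms in \<open>auto simp: less_top[symmetric]\<close>)
  then show ?thesis by (auto elim!: eventually_mono)
qed

text \<open>Passage from an arbitrary radius to a geometric sequence at the cost of one factor
  \<open>q\<close>: take the least \<open>k\<close> with \<open>c / q ^ k \<le> r\<close>.\<close>

lemma geometric_scale:
  fixes c q r :: real
  assumes "0 < r" "r \<le> c" "1 < q"
  obtains k where "c / q ^ k \<le> r" "r < c * q / q ^ k"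
proof -
  define P where "P k \<longleftrightarrow> c / q ^ k \<le> r" for k
  have q: "q ^ k > 0" for k using assms by simp
  obtain k0 where "c / r < q ^ k0" using real_arch_pow[OF assms(3)] by blast
  then have "P k0" using assms q by (simp add: P_def field_simps less_imp_le)
  then have k: "P (Least P)" "\<And>j. j < Least P \<Longrightarrow> \<not> P j"
    by (auto intro: LeastI dest: not_less_Least)
  have "r < c * q / q ^ Least P"
  proof (cases "Least P")
    case 0
    have "r \<le> c" "c < c * q" using assms by auto
    then show ?thesis using 0 by simp
  next
    case (Suc j)
    then have "\<not> P j" using k(2)[of j] by simp
    then show ?thesis using Suc q assms by (simp add: P_def field_simps)
  qed
  then show ?thesis using k(1) that unfolding P_def by blast
qed

locale superpoly_mixing_system = mixing_system +
  assumes theta_superpoly: "p > 0 \<Longrightarrow> (\<lambda>n. real n powr p * \<theta> n) \<longlonglongrightarrow> 0"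
begin

lemma theta_bound:
  assumes "p > 0"
  obtains C where "0 \<le> C" "\<And>n. n \<ge> 1 \<Longrightarrow> \<theta> n \<le> C * real n powr (- p)"
proof -
  have "Bseq (\<lambda>n. real n powr p * \<theta> n)"
    by (rule convergent_imp_Bseq) (use theta_superpoly[OF assms] in \<open>auto simp: convergent_def\<close>)
  then obtain C where C: "C > 0" "\<And>n. norm (real n powr p * \<theta> n) \<le> C"
    by (auto simp: Bseq_def)
  have "\<theta> n \<le> C * real n powr (- p)" if "n \<ge> 1" for n
    using C(2)[of n] that theta_nonneg[of n] by (simp add: powr_minus field_simps abs_mult)
  with C(1) that show ?thesis by (metis less_imp_le)
qed

definition small_balls :: "real \<Rightarrow> 'a \<Rightarrow> real \<Rightarrow> bool" where
  "small_balls b z r \<longleftrightarrow> measure M (nball z r) \<le> r powr b"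

text \<open>The return time to the \<open>r\<close>-ball exceeds \<open>r powr (- a)\<close>,
  phrased by distances so that infima and logarithms enter only at the end.\<close>

definition slow_return :: "real \<Rightarrow> 'a \<Rightarrow> real \<Rightarrow> bool" where
  "slow_return a z r \<longleftrightarrow> (\<forall>n\<ge>1. real n \<le> r powr (- a) \<longrightarrow> r \<le> dist (\<phi> ((T ^^ n) z)) (\<phi> z))"

text \<open>The condition on small balls stands inside the almost-everywhere statement. The
  exceptional sets carry the cap on the ball measure themselves, so points that violate the cap fall
  outside them and no measurability of the condition is required.\<close>

lemma AE_orbit_separation:
  assumes ab: "0 < a" "a < b"
  shows "AE z in M. eventually (small_balls b z) (at_right 0) \<longrightarrow>
    eventually (\<lambda>n. real n powr (- 1 / a) \<le> dist (\<phi> ((T ^^ n) z)) (\<phi> z)) sequentially"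
proof -
  define \<rho> where "\<rho> n = real n powr (- 1 / a)" for n
  let ?D = "real (DIM('b) + 2)"
  \<comment> \<open>The cap is a constant times \<open>real n powr (- b / a)\<close>, summable
    because \<open>a < b\<close>.\<close>
  define E where "E n = return_set n (\<rho> n) ((3 * \<rho> n) powr b)" for n
  obtain C where C: "0 \<le> C" "\<And>n r c. \<lbrakk>1 \<le> n; 0 < r; r \<le> 1; 0 \<le> c\<rbrakk> \<Longrightarrow>
       measure M (return_set n r c) \<le> C * (c + \<theta> n / r ^ (DIM('b) + 2))"
    using measure_return_set by metis
  \<comment> \<open>The cost of the radius is \<open>real n powr (?D / a)\<close>; the additional 2
    in the exponent leaves the summable \<open>real n powr (- 2)\<close>.\<close>
  obtain C' where C': "0 \<le> C'" "\<And>n. n \<ge> 1 \<Longrightarrow> \<theta> n \<le> C' * real n powr (- (?D / a + 2))"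
  proof -
    have "?D / a + 2 > 0" using ab by (intro add_pos_pos divide_pos_pos) auto
    from theta_bound[OF this] that show ?thesis by metis
  qed
  have rho: "0 < \<rho> n" "\<rho> n \<le> 1" if "n \<ge> 1" for n
    using that ab powr_mono2'[of "- (1 / a)" 1 "real n"] by (auto simp: \<rho>_def)
  have bound: "measure M (E n) \<le> C * (3 powr b * real n powr (- b / a) + C' * real n powr (- 2))"
    if n: "n \<ge> 1" for n
  proof -
    have "measure M (E n) \<le> C * ((3 * \<rho> n) powr b + \<theta> n / \<rho> n ^ (DIM('b) + 2))"
      unfolding E_def by (rule C(2)) (use n rho[OF n] in auto)
    also have "(3 * \<rho> n) powr b = 3 powr b * real n powr (- b / a)"
      using n by (simp add: \<rho>_def powr_mult powr_powr)
    also have "\<theta> n / \<rho> n ^ (DIM('b) + 2) = \<theta> n * real n powr (?D / a)"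
    proof -
      have "\<rho> n ^ (DIM('b) + 2) = \<rho> n powr ?D"
        using rho(1)[OF n] by (subst powr_realpow) auto
      also have "\<dots> = real n powr (- (?D / a))" by (simp add: \<rho>_def powr_powr)
      finally show ?thesis by (simp add: powr_minus_divide)
    qed
    also have "\<theta> n * real n powr (?D / a) \<le> C' * real n powr (- (?D / a + 2)) * real n powr (?D / a)"
      by (intro mult_right_mono C'(2) n) auto
    also have "\<dots> = C' * real n powr (- 2)"
      by (simp add: mult.assoc powr_add[symmetric])
    finally show ?thesis using C(1) by (simp add: mult_left_mono)
  qed
  have sum: "summable (\<lambda>n. C * (3 powr b * real n powr (- b / a) + C' * real n powr (- 2)))"
    using ab by (intro summable_mult summable_add) (auto simp: summable_real_powr_iff)
  have "summable (\<lambda>n. measure M (E n))"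
    by (rule summable_comparison_test'[OF sum, of 1]) (use bound in auto)
  then have "AE z in M. eventually (\<lambda>n. z \<notin> E n) sequentially"
    by (intro AE_eventually_notin) (auto simp: E_def)
  with AE_space show ?thesis
  proof eventually_elim
    case (elim z)
    show ?case
    proof
      assume ev: "eventually (small_balls b z) (at_right 0)"
      have "filterlim (\<lambda>n. 3 * \<rho> n) (at_right 0) sequentially"
        using ab unfolding \<rho>_def by real_asymp
      with ev have "eventually (\<lambda>n. small_balls b z (3 * \<rho> n)) sequentially"
        by (rule eventually_compose_filterlim)
      with elim(2) show "eventually (\<lambda>n. real n powr (- 1 / a) \<le> dist (\<phi> ((T ^^ n) z)) (\<phi> z)) sequentially"
        by eventually_elim (use elim(1) in \<open>auto simp: E_def return_set_def small_balls_def \<rho>_def\<close>)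
    qed
  qed
qed

text \<open>A periodic orbit would contradict the eventual separation, so the finitely many remaining
  return distances are positive.\<close>

lemma AE_slow_return:
  assumes ab: "0 < a" "a < b"
  shows "AE z in M. eventually (small_balls b z) (at_right 0) \<longrightarrow>
    eventually (slow_return a z) (at_right 0)"
  using AE_orbit_separation[OF ab] AE_space
proof eventually_elim
  case (elim z)
  show ?case
  proof
    assume "eventually (small_balls b z) (at_right 0)"
    with elim obtain N where N: "\<And>n. n \<ge> N \<Longrightarrow> real n powr (- 1 / a) \<le> dist (\<phi> ((T ^^ n) z)) (\<phi> z)"
      by (auto simp: eventually_sequentially)
    have pos: "0 < dist (\<phi> ((T ^^ n) z)) (\<phi> z)" if n: "n \<ge> 1" for n
    proof (rule ccontr)
      assume "\<not> ?thesis"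
      then have "(T ^^ n) z = z"
        using elim(2) Tn_space[of z n] phi_inj by (auto dest: inj_onD)
      then have "((T ^^ n) ^^ Suc N) z = z" by (induction N) auto
      then have "(T ^^ (n * Suc N)) z = z" by (simp only: funpow_mult)
      moreover have "N \<le> n * Suc N" using n by (cases n) auto
      ultimately have "real (n * Suc N) powr (- 1 / a) \<le> 0" using N[of "n * Suc N"] by simp
      with n show False by (simp del: of_nat_Suc of_nat_mult)
    qed
    have "eventually (\<lambda>r. \<forall>n\<in>{1..N}. r \<le> dist (\<phi> ((T ^^ n) z)) (\<phi> z)) (at_right 0)"
    proof (rule eventually_ball_finite)
      show "\<forall>n\<in>{1..N}. eventually (\<lambda>r. r \<le> dist (\<phi> ((T ^^ n) z)) (\<phi> z)) (at_right 0)"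
      proof
        fix n assume "n \<in> {1..N}"
        then have "0 < dist (\<phi> ((T ^^ n) z)) (\<phi> z)" using pos by simp
        then show "eventually (\<lambda>r. r \<le> dist (\<phi> ((T ^^ n) z)) (\<phi> z)) (at_right 0)"
          unfolding eventually_at_right_field using less_imp_le by blast
      qed
    qed simp
    moreover have "eventually (\<lambda>r::real. 0 < r) (at_right 0)"
      by (simp add: eventually_at_right_less)
    ultimately show "eventually (slow_return a z) (at_right 0)"
    proof eventually_elim
      case (elim r)
      show ?case unfolding slow_return_def
      proof (intro allI impI)
        fix n :: nat assume n: "1 \<le> n" "real n \<le> r powr (- a)"
        show "r \<le> dist (\<phi> ((T ^^ n) z)) (\<phi> z)"
        proof (cases "n \<le> N")
          case False
          have "r = (r powr (- a)) powr (- 1 / a)" using elim(2) ab by (simp add: powr_powr)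
          also have "\<dots> \<le> real n powr (- 1 / a)"
            by (rule powr_mono2') (use n ab in auto)
          also have "\<dots> \<le> dist (\<phi> ((T ^^ n) z)) (\<phi> z)" using N False by simp
          finally show ?thesis .
        qed (use elim n in auto)
      qed
    qed
  qed
qed

text \<open>For one radius, times up to \<open>r powr (- a)\<close> are excluded by hypothesis.
  Among the at most \<open>r powr (- b')\<close> later times each bad set has measure of order
  \<open>r powr b\<close>: the lower cut-off on \<open>n\<close> turns decay in \<open>n\<close>
  into decay in \<open>r\<close>. The total \<open>r powr (b - b')\<close> is geometric along dyadic
  radii.\<close>

lemma AE_frequently_slow_return:
  assumes a: "0 < a" and b: "0 < b'" "b' < b"
  shows "AE z in M. eventually (slow_return a z) (at_right 0) \<longrightarrow>
    frequently (small_balls b z) (at_right 0) \<longrightarrow> frequently (slow_return b' z) (at_right 0)"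
proof -
  define \<rho> :: "nat \<Rightarrow> real" where "\<rho> k = 2 powr (- real k)" for k
  let ?D = "real (DIM('b) + 2)"
  define I where "I k = {n. 1 \<le> n \<and> \<rho> k powr (- a) \<le> real n \<and> real n \<le> \<rho> k powr (- b')}" for k
  \<comment> \<open>The constant 6 comes from rounding: if
    \<open>3 * \<rho> k \<le> r < 6 * \<rho> k\<close> and the \<open>r\<close>-ball is small, then
    the ball of radius \<open>3 * \<rho> k\<close> has measure at most
    \<open>(6 * \<rho> k) powr b\<close>.\<close>
  define E where "E k = (\<Union>n\<in>I k. return_set n (\<rho> k) ((6 * \<rho> k) powr b))" for k
  have rho: "0 < \<rho> k" "\<rho> k \<le> 1" for k by (auto simp: \<rho>_def powr_minus field_simps ge_one_powr_ge_zero)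
  have I: "finite (I k)" "real (card (I k)) \<le> \<rho> k powr (- b')" for k
  proof -
    have sub: "I k \<subseteq> {1..nat \<lfloor>\<rho> k powr (- b')\<rfloor>}" by (auto simp: I_def le_nat_floor)
    then show "finite (I k)" by (rule finite_subset) simp
    have "card (I k) \<le> nat \<lfloor>\<rho> k powr (- b')\<rfloor>" using card_mono[OF _ sub] by simp
    then show "real (card (I k)) \<le> \<rho> k powr (- b')"
      by (smt (verit) of_nat_le_iff of_nat_floor powr_ge_zero)
  qed
  obtain C where C: "0 \<le> C" "\<And>n r c. \<lbrakk>1 \<le> n; 0 < r; r \<le> 1; 0 \<le> c\<rbrakk> \<Longrightarrow>
       measure M (return_set n r c) \<le> C * (c + \<theta> n / r ^ (DIM('b) + 2))"
    using measure_return_set by metis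
  \<comment> \<open>For \<open>n \<ge> \<rho> k powr (- a)\<close> this exponent gives
    \<open>real n powr (- p) \<le> \<rho> k powr (?D + b)\<close>; the part \<open>?D\<close>
    cancels the cost of the radius.\<close>
  define p where "p = (?D + b) / a"
  have p: "p > 0" using a b by (auto simp: p_def intro!: divide_pos_pos add_pos_pos)
  obtain C' where C': "0 \<le> C'" "\<And>n. n \<ge> 1 \<Longrightarrow> \<theta> n \<le> C' * real n powr (- p)"
    using theta_bound[OF p] by auto
  have bound: "measure M (E k) \<le> C * (6 powr b + C') * (2 powr (b' - b)) ^ k" for k
  proof -
    have single: "measure M (return_set n (\<rho> k) ((6 * \<rho> k) powr b)) \<le> C * (6 powr b + C') * \<rho> k powr b"
      if n: "n \<in> I k" for n
    proof -
      have n1: "1 \<le> n" "\<rho> k powr (- a) \<le> real n" using n by (auto simp: I_def)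
      have "measure M (return_set n (\<rho> k) ((6 * \<rho> k) powr b))
          \<le> C * ((6 * \<rho> k) powr b + \<theta> n / \<rho> k ^ (DIM('b) + 2))"
        by (rule C(2)) (use n1 rho in auto)
      also have "\<theta> n / \<rho> k ^ (DIM('b) + 2) \<le> C' * \<rho> k powr b"
      proof -
        have "\<theta> n \<le> C' * real n powr (- p)" by (rule C'(2)) (rule n1)
        also have "real n powr (- p) \<le> (\<rho> k powr (- a)) powr (- p)"
          by (rule powr_mono2') (use n1 p rho[of k] in auto)
        also have "\<dots> = \<rho> k powr ?D * \<rho> k powr b"
        proof -
          have "- a * (- p) = ?D + b" using a by (simp add: p_def)
          then show ?thesis by (simp only: powr_powr powr_add)
        qed
        also have "\<rho> k powr ?D = \<rho> k ^ (DIM('b) + 2)"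
          using rho(1)[of k] by (rule powr_realpow)
        finally have "\<theta> n \<le> C' * (\<rho> k ^ (DIM('b) + 2) * \<rho> k powr b)"
          using C'(1) by (simp add: mult_left_mono)
        then show ?thesis using rho(1)[of k] by (simp add: field_simps)
      qed
      finally have "measure M (return_set n (\<rho> k) ((6 * \<rho> k) powr b))
          \<le> C * ((6 * \<rho> k) powr b + C' * \<rho> k powr b)"
        using C(1) by (simp add: mult_left_mono)
      moreover have "(6 * \<rho> k) powr b = 6 powr b * \<rho> k powr b"
        using rho[of k] by (simp add: powr_mult)
      ultimately show ?thesis by (simp only: distrib_right mult.assoc)
    qed
    have "measure M (E k) \<le> (\<Sum>n\<in>I k. measure M (return_set n (\<rho> k) ((6 * \<rho> k) powr b)))"
      unfolding E_def by (rule finite_measure_subadditive_finite) (use I in auto)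
    also have "\<dots> \<le> real (card (I k)) * (C * (6 powr b + C') * \<rho> k powr b)"
      using single by (intro sum_bounded_above)
    also have "\<dots> \<le> \<rho> k powr (- b') * (C * (6 powr b + C') * \<rho> k powr b)"
      using I(2) C(1) C'(1) by (intro mult_right_mono) auto
    also have "\<dots> = C * (6 powr b + C') * (\<rho> k powr (b - b'))"
      by (simp add: powr_diff powr_minus_divide)
    also have "\<rho> k powr (b - b') = (2 powr (b' - b)) ^ k"
      by (simp add: \<rho>_def powr_powr powr_realpow[symmetric] algebra_simps)
    finally show ?thesis .
  qed
  have "summable (\<lambda>k. C * (6 powr b + C') * (2 powr (b' - b)) ^ k)"
    using b by (intro summable_mult summable_geometric) (auto simp: powr_less_one)
  then have "summable (\<lambda>k. measure M (E k))"
    by (rule summable_comparison_test'[of _ 0]) (use bound in auto)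
  then have "AE z in M. eventually (\<lambda>k. z \<notin> E k) sequentially"
    by (intro AE_eventually_notin) (use I in \<open>auto simp: E_def\<close>)
  with AE_space show ?thesis
  proof eventually_elim
    case (elim z)
    have lim: "filterlim \<rho> (at_right 0) sequentially"
      unfolding \<rho>_def by real_asymp
    show ?case
    proof (intro impI)
      assume slow: "eventually (slow_return a z) (at_right 0)"
        and fr: "frequently (small_balls b z) (at_right 0)"
      have freq: "frequently (\<lambda>k. measure M (nball z (3 * \<rho> k)) \<le> (6 * \<rho> k) powr b) sequentially"
      proof (rule ccontr)
        assume "\<not> ?thesis"
        then obtain K where K: "\<And>k. k \<ge> K \<Longrightarrow> (6 * \<rho> k) powr b < measure M (nball z (3 * \<rho> k))"
          unfolding frequently_def eventually_sequentially not_not not_le by blast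
        have "\<not> small_balls b z r" if r: "0 < r" "r < 3 * \<rho> K" for r
        proof -
          have "r \<le> 3" using r rho(2)[of K] by linarith
          from geometric_scale[OF r(1) this, of 2]
          obtain k where k: "3 / 2 ^ k \<le> r" "r < 3 * 2 / 2 ^ k" by auto
          have eq: "\<rho> j = 1 / 2 ^ j" for j by (simp add: \<rho>_def powr_minus_divide powr_realpow)
          have "(3::real) / 2 ^ k < 3 / 2 ^ K" using k r by (simp add: eq)
          then have "(2::real) ^ K < 2 ^ k" by (simp add: field_simps)
          then have "K \<le> k" by simp
          have "r powr b \<le> (6 * \<rho> k) powr b"
            using k r b by (intro powr_mono2) (auto simp: eq)
          also have "\<dots> < measure M (nball z (3 * \<rho> k))" using K \<open>K \<le> k\<close> by simp
          also have "\<dots> \<le> measure M (nball z r)"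
            using k by (intro finite_measure_mono nball_mono) (auto simp: eq)
          finally show ?thesis by (simp add: small_balls_def)
        qed
        then have "eventually (\<lambda>r. \<not> small_balls b z r) (at_right 0)"
          using rho(1)[of K] by (auto simp: eventually_at_right_field intro!: exI[of _ "3 * \<rho> K"])
        with fr show False by (simp add: frequently_def)
      qed
      have "eventually (\<lambda>k. slow_return a z (\<rho> k)) sequentially"
        using slow lim by (rule eventually_compose_filterlim)
      with elim(2) have "eventually (\<lambda>k. z \<notin> E k \<and> slow_return a z (\<rho> k)) sequentially"
        by (rule eventually_conj)
      with freq have "frequently (\<lambda>k. slow_return b' z (\<rho> k)) sequentially"
      proof (rule frequently_rev_mp[OF frequently_eventually_frequently])
        show "eventually (\<lambda>k. measure M (nball z (3 * \<rho> k)) \<le> (6 * \<rho> k) powr b \<and> z \<notin> E k \<and> slow_return a z (\<rho> k)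
          \<longrightarrow> slow_return b' z (\<rho> k)) sequentially"
        proof (intro always_eventually allI impI)
          fix k assume k: "measure M (nball z (3 * \<rho> k)) \<le> (6 * \<rho> k) powr b \<and> z \<notin> E k \<and> slow_return a z (\<rho> k)"
          show "slow_return b' z (\<rho> k)" unfolding slow_return_def
          proof (intro allI impI)
            fix n :: nat assume n: "1 \<le> n" "real n \<le> \<rho> k powr (- b')"
            show "\<rho> k \<le> dist (\<phi> ((T ^^ n) z)) (\<phi> z)"
            proof (cases "real n \<le> \<rho> k powr (- a)")
              case True
              then show ?thesis using k n by (auto simp: slow_return_def)
            next
              case False
              then have "n \<in> I k" using n by (auto simp: I_def)
              then have "z \<notin> return_set n (\<rho> k) ((6 * \<rho> k) powr b)" using k by (auto simp: E_def)
              then show ?thesis using k elim(1) by (auto simp: return_set_def)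
            qed
          qed
        qed
      qed
      then show "frequently (slow_return b' z) (at_right 0)"
        using eventually_compose_filterlim[OF _ lim, of "\<lambda>r. \<not> slow_return b' z r"]
        unfolding frequently_def by blast
    qed
  qed
qed

end

section \<open>Expanding systems\<close>

text \<open>Regularity of the image measure on Euclidean space encloses \<open>A\<close> between a
  compact and an open set that differ by measure at most \<open>e\<close>. The compact set has
  positive distance to the complement of the open one, so a truncated distance function separates
  them with a Lipschitz bound.\<close>

lemma (in prob_space) Lipschitz_approximation:
  fixes \<phi> :: "'a \<Rightarrow> 'b::euclidean_space"
  assumes [measurable]: "\<phi> \<in> borel_measurable M" "A \<in> sets borel" and e: "0 < e"
  obtains f :: "'b \<Rightarrow> real" and K where "0 \<le> K" "\<And>y. 0 \<le> f y" "\<And>y. f y \<le> 1"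
    "\<And>x y. \<bar>f x - f y\<bar> \<le> K * dist x y" "(\<integral>x. \<bar>f (\<phi> x) - indicator A (\<phi> x)\<bar> \<partial>M) \<le> e"
proof -
  define N where "N = distr M borel \<phi>"
  interpret N: prob_space N unfolding N_def by (rule prob_space_distr) simp
  have sN: "sets N = sets borel" by (simp add: N_def)
  have fin: "emeasure N (space N) \<noteq> \<infinity>" using N.emeasure_space_1 by simp
  have "\<exists>K. K \<subseteq> A \<and> compact K \<and> measure N A < measure N K + e / 2"
  proof (rule ccontr)
    assume neg: "\<not> ?thesis"
    have "emeasure N A = (SUP K\<in>{K. K \<subseteq> A \<and> compact K}. emeasure N K)"
      by (rule inner_regular) (use sN fin in auto)
    also have "\<dots> \<le> ennreal (measure N A - e / 2)"
      using neg by (intro SUP_least) (auto simp: N.emeasure_eq_measure not_less intro!: ennreal_leI)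
    finally have "measure N A \<le> measure N A - e / 2 \<or> measure N A \<le> 0"
      by (auto simp: N.emeasure_eq_measure ennreal_le_iff2)
    moreover have "e / 2 \<le> measure N A"
      using neg[unfolded not_ex, THEN spec[of _ "{}"]] by simp
    ultimately show False using e by linarith
  qed
  then obtain K where K: "K \<subseteq> A" "compact K" "measure N A < measure N K + e / 2" by blast
  have "\<exists>U. A \<subseteq> U \<and> open U \<and> measure N U < measure N A + e / 2"
  proof (rule ccontr)
    assume neg: "\<not> ?thesis"
    have "ennreal (measure N A + e / 2) \<le> (INF U\<in>{U. A \<subseteq> U \<and> open U}. emeasure N U)"
      using neg by (intro INF_greatest) (auto simp: N.emeasure_eq_measure not_less intro!: ennreal_leI)
    also have "\<dots> = emeasure N A"
      by (rule outer_regular[symmetric]) (use sN fin in auto)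
    finally show False using e by (simp add: N.emeasure_eq_measure ennreal_le_iff2)
  qed
  then obtain U where U: "A \<subseteq> U" "open U" "measure N U < measure N A + e / 2" by blast
  have KU: "measure N (U - K) \<le> e"
    using K U sN by (subst N.finite_measure_Diff) (auto simp: compact_imp_closed)
  have [measurable]: "U \<in> sets borel" "K \<in> sets borel" using K U by (auto simp: compact_imp_closed)
  obtain f :: "'b \<Rightarrow> real" and C where f: "0 \<le> C" "\<And>y. 0 \<le> f y" "\<And>y. f y \<le> 1"
    "\<And>x y. \<bar>f x - f y\<bar> \<le> C * dist x y" "\<And>y. y \<in> K \<Longrightarrow> f y = 1" "\<And>y. y \<notin> U \<Longrightarrow> f y = 0"
  proof (cases "K = {}")
    case True
    show ?thesis by (rule that[of 0 "\<lambda>_. 0"]) (use True in auto)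
  next
    case False
    obtain d where d: "d > 0" "\<And>x y. x \<in> K \<Longrightarrow> y \<in> - U \<Longrightarrow> d \<le> dist x y"
      using separate_compact_closed[of K "- U"] K U by blast
    show ?thesis
    proof (rule that[of "1/d" "\<lambda>y. max 0 (1 - infdist y K / d)"])
      fix x y
      have "\<bar>infdist x K / d - infdist y K / d\<bar> \<le> dist x y / d"
        using d(1) infdist_triangle_abs[of x K y] by (simp add: diff_divide_distrib[symmetric] divide_right_mono)
      then show "\<bar>max 0 (1 - infdist x K / d) - max 0 (1 - infdist y K / d)\<bar> \<le> 1 / d * dist x y"
        by (auto simp: max_def abs_if split: if_splits)
    next
      fix y assume "y \<notin> U"
      then have "d \<le> infdist y K"
        using d(2) False by (subst infdist_def) (auto intro!: cINF_greatest simp: dist_commute)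
      then show "max 0 (1 - infdist y K / d) = 0" using d(1) by (simp add: field_simps)
    qed (use d(1) infdist_nonneg[of _ K] in \<open>auto intro!: divide_nonneg_pos\<close>)
  qed
  have "f \<in> borel_measurable borel"
  proof (rule borel_measurable_continuous_onI)
    have "C-lipschitz_on UNIV f" using f by (intro lipschitz_onI) (auto simp: dist_real_def)
    then show "continuous_on UNIV f" by (rule lipschitz_on_continuous_on)
  qed
  note [measurable] = this
  have "(\<integral>x. \<bar>f (\<phi> x) - indicator A (\<phi> x)\<bar> \<partial>M) \<le> (\<integral>x. indicator (U - K) (\<phi> x) \<partial>M)"
  proof (rule integral_mono)
    fix x
    show "\<bar>f (\<phi> x) - indicator A (\<phi> x)\<bar> \<le> (indicator (U - K) (\<phi> x) :: real)"
      using f(2,3)[of "\<phi> x"] f(5,6)[of "\<phi> x"] K U by (auto simp: indicator_def)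
  next
    have "\<bar>f y - indicator A y\<bar> \<le> 1" for y
      using f(2,3)[of y] by (auto simp: indicator_def)
    then show "integrable M (\<lambda>x. \<bar>f (\<phi> x) - indicator A (\<phi> x)\<bar>)"
      by (intro integrable_const_bound[where B=1]) auto
  qed (auto intro!: integrable_const_bound[where B=1])
  also have "\<dots> = (\<integral>y. indicator (U - K) y \<partial>N)"
    unfolding N_def by (subst integral_distr) auto
  also have "\<dots> = measure N (U - K)" using sN by (subst Bochner_Integration.integral_indicator) auto
  finally show ?thesis using KU that f(1-4) by (meson order_trans)
qed

lemma sum_inj_le_suminf:
  fixes f :: "nat \<Rightarrow> real"
  assumes "summable f" "\<And>n. 0 \<le> f n" "finite F" "inj_on h F"
  shows "(\<Sum>j\<in>F. f (h j)) \<le> suminf f"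
proof -
  have "(\<Sum>j\<in>F. f (h j)) = sum f (h ` F)" using assms(4) by (simp add: sum.reindex)
  also have "\<dots> \<le> suminf f" using assms by (intro sum_le_suminf) auto
  finally show ?thesis .
qed

lemma card_funpow_shift_le:
  assumes "k \<le> N"
  shows "card {i. i < N - k \<and> (T ^^ i) ((T ^^ k) z) \<notin> G} \<le> card {i. i < N \<and> (T ^^ i) z \<notin> G}"
proof (rule card_inj_on_le[of "\<lambda>i. i + k"])
  show "(\<lambda>i. i + k) ` {i. i < N - k \<and> (T ^^ i) ((T ^^ k) z) \<notin> G} \<subseteq> {i. i < N \<and> (T ^^ i) z \<notin> G}"
    by (auto simp: funpow_add)
qed auto

text \<open>A metric form of hyperbolicity, to be applied to an iterate. Summability of
  \<open>\<theta>\<close> is what a linear variance bound for orbit averages needs.\<close>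

locale expanding_mixing_system = mixing_system +
  fixes L \<delta> :: real
  assumes L_gt1: "1 < L" and delta_pos: "0 < \<delta>"
    and T_Lipschitz: "\<And>x y. x \<in> space M \<Longrightarrow> y \<in> space M \<Longrightarrow>
      dist (\<phi> (T x)) (\<phi> (T y)) \<le> L * dist (\<phi> x) (\<phi> y)"
    and T_expanding: "\<And>x y. x \<in> space M \<Longrightarrow> y \<in> space M \<Longrightarrow> dist (\<phi> x) (\<phi> y) < \<delta> \<Longrightarrow>
      2 * dist (\<phi> x) (\<phi> y) \<le> dist (\<phi> (T x)) (\<phi> (T y))"
    and theta_summable: "summable \<theta>"
begin

text \<open>For forward invariant \<open>A\<close> the correlation of the indicator with its
  \<open>n\<close>-th iterate is \<open>a\<close>, so mixing forces \<open>a = a * a\<close>. The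
  Lipschitz substitute costs \<open>2 * e\<close> in the correlation and \<open>2 * e\<close> in the
  product of the means; then \<open>n\<close> tends to infinity. Test functions see only
  \<open>\<phi>\<close>, hence \<open>A\<close> has to be a preimage under
  \<open>\<phi>\<close>.\<close>

lemma zero_one_law:
  assumes A' [measurable]: "A' \<in> sets borel" and A: "A = \<phi> -` A' \<inter> space M"
    and inv: "\<And>z. z \<in> A \<Longrightarrow> T z \<in> A"
  shows "measure M A = 0 \<or> measure M A = 1"
proof -
  have [measurable]: "A \<in> sets M" unfolding A by measurable
  define a where "a = measure M A"
  have a01: "0 \<le> a" "a \<le> 1" by (auto simp: a_def)
  have "\<bar>a - a * a\<bar> \<le> 4 * e" if e: "e > 0" for e
  proof -
    obtain f :: "'b \<Rightarrow> real" and K where f: "0 \<le> K" "\<And>y. 0 \<le> f y" "\<And>y. f y \<le> 1"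
      "\<And>x y. \<bar>f x - f y\<bar> \<le> K * dist x y" "(\<integral>x. \<bar>f (\<phi> x) - indicator A' (\<phi> x)\<bar> \<partial>M) \<le> e"
      by (rule Lipschitz_approximation[OF phi_meas A' e]) (rule that; assumption)
    define g where "g x = f (\<phi> x)" for x
    have g01: "0 \<le> g x" "g x \<le> 1" for x using f by (auto simp: g_def)
    have lip: "\<bar>g x - g y\<bar> \<le> K * dist (\<phi> x) (\<phi> y)" for x y using f by (simp add: g_def)
    then have [measurable]: "g \<in> borel_measurable M" by (rule Lipschitz_borel_measurable)
    define I where "I = indicat_real A"
    have [measurable]: "I \<in> borel_measurable M" by (simp add: I_def)
    have I01: "0 \<le> I x" "I x \<le> 1" for x by (auto simp: I_def)
    have intI: "integrable M g" "integrable M I"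
      using g01 I01 by (auto intro!: integrable_unit_bounded)
    have err: "(\<integral>x. \<bar>g x - I x\<bar> \<partial>M) \<le> e"
    proof -
      have "(\<integral>x. \<bar>g x - I x\<bar> \<partial>M) = (\<integral>x. \<bar>f (\<phi> x) - indicator A' (\<phi> x)\<bar> \<partial>M)"
        by (rule Bochner_Integration.integral_cong) (auto simp: g_def I_def A indicator_def)
      then show ?thesis using f(5) by simp
    qed
    have Ia: "(\<integral>x. I x \<partial>M) = a" by (simp add: I_def a_def)
    have m: "\<bar>(\<integral>x. g x \<partial>M) - a\<bar> \<le> e"
    proof -
      have "\<bar>(\<integral>x. g x \<partial>M) - a\<bar> = \<bar>\<integral>x. g x - I x \<partial>M\<bar>"
        using intI by (simp add: Ia)
      also have "\<dots> \<le> (\<integral>x. \<bar>g x - I x\<bar> \<partial>M)" by (rule integral_abs_bound)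
      finally show ?thesis using err by simp
    qed
    have gm: "0 \<le> (\<integral>x. g x \<partial>M)" "(\<integral>x. g x \<partial>M) \<le> 1"
      using g01 intI by (auto intro!: Bochner_Integration.integral_nonneg integral_le_const)
    have "\<bar>a - a * a\<bar> \<le> 4 * e + K * K * \<theta> n" if n: "n \<ge> 1" for n
    proof -
      have inv_n: "(T ^^ n) z \<in> A" if "z \<in> A" for z
        by (induction n) (use that inv in auto)
      have cor: "\<bar>(\<integral>x. g ((T ^^ n) x) * g x \<partial>M) - a\<bar> \<le> 2 * e"
      proof -
        have "(\<integral>x. I x \<partial>M) = (\<integral>x. I ((T ^^ n) x) * I x \<partial>M)"
          by (rule Bochner_Integration.integral_cong) (use inv_n in \<open>auto simp: I_def indicator_def\<close>)
        then have "\<bar>(\<integral>x. g ((T ^^ n) x) * g x \<partial>M) - a\<bar>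
            = \<bar>\<integral>x. g ((T ^^ n) x) * g x - I ((T ^^ n) x) * I x \<partial>M\<bar>"
          unfolding Ia using g01 I01
          by (subst Bochner_Integration.integral_diff)
            (auto intro!: integrable_unit_bounded mult_le_one mult_nonneg_nonneg)
        also have "\<dots> \<le> (\<integral>x. \<bar>g ((T ^^ n) x) * g x - I ((T ^^ n) x) * I x\<bar> \<partial>M)"
          by (rule integral_abs_bound)
        also have "\<dots> \<le> (\<integral>x. \<bar>g ((T ^^ n) x) - I ((T ^^ n) x)\<bar> + \<bar>g x - I x\<bar> \<partial>M)"
        proof (rule integral_mono)
          fix x
          have "g ((T ^^ n) x) * g x - I ((T ^^ n) x) * I x
            = (g ((T ^^ n) x) - I ((T ^^ n) x)) * g x + I ((T ^^ n) x) * (g x - I x)"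
            by (simp add: algebra_simps)
          also have "\<bar>\<dots>\<bar> \<le> \<bar>g ((T ^^ n) x) - I ((T ^^ n) x)\<bar> * 1 + 1 * \<bar>g x - I x\<bar>"
            using g01 I01
            by (intro order_trans[OF abs_triangle_ineq] add_mono) (auto simp: abs_mult intro!: mult_left_le mult_left_le_one_le)
          finally show "\<bar>g ((T ^^ n) x) * g x - I ((T ^^ n) x) * I x\<bar>
            \<le> \<bar>g ((T ^^ n) x) - I ((T ^^ n) x)\<bar> + \<bar>g x - I x\<bar>" by simp
        qed (use g01 I01 in \<open>auto intro!: Bochner_Integration.integrable_add Bochner_Integration.integrable_diff
            Bochner_Integration.integrable_abs integrable_unit_bounded mult_le_one mult_nonneg_nonneg\<close>)
        also have "\<dots> = (\<integral>x. \<bar>g ((T ^^ n) x) - I ((T ^^ n) x)\<bar> \<partial>M) + (\<integral>x. \<bar>g x - I x\<bar> \<partial>M)"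
          using g01 I01 by (intro Bochner_Integration.integral_add)
            (auto intro!: Bochner_Integration.integrable_diff Bochner_Integration.integrable_abs integrable_unit_bounded)
        also have "(\<integral>x. \<bar>g ((T ^^ n) x) - I ((T ^^ n) x)\<bar> \<partial>M) = (\<integral>x. \<bar>g x - I x\<bar> \<partial>M)"
          by (rule integral_Tn[of "\<lambda>x. \<bar>g x - I x\<bar>"]) measurable
        finally show ?thesis using err by linarith
      qed
      have "\<bar>(\<integral>x. g x \<partial>M) * (\<integral>x. g x \<partial>M) - a * a\<bar> \<le> 2 * e"
      proof -
        have "(\<integral>x. g x \<partial>M) * (\<integral>x. g x \<partial>M) - a * a = ((\<integral>x. g x \<partial>M) - a) * ((\<integral>x. g x \<partial>M) + a)"
          by (simp add: algebra_simps)
        also have "\<bar>\<dots>\<bar> \<le> e * 2"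
          unfolding abs_mult using m gm a01 by (intro mult_mono) auto
        finally show ?thesis by simp
      qed
      moreover have "\<bar>(\<integral>x. g ((T ^^ n) x) * g x \<partial>M) - (\<integral>x. g x \<partial>M) * (\<integral>x. g x \<partial>M)\<bar> \<le> K * K * \<theta> n"
        by (rule decay) (use f(1) n lip in auto)
      ultimately show ?thesis using cor by linarith
    qed
    moreover have "(\<lambda>n. 4 * e + K * K * \<theta> n) \<longlonglongrightarrow> 4 * e + K * K * 0"
      by (intro tendsto_intros summable_LIMSEQ_zero theta_summable)
    ultimately show ?thesis
      by (intro LIMSEQ_le_const[of "\<lambda>n. 4 * e + K * K * \<theta> n"]) auto
  qed
  \<comment> \<open>With this \<open>e\<close> the quantity is bounded by half of itself, so it
    vanishes.\<close>
  from this[of "\<bar>a - a * a\<bar> / 8"] have "a - a * a = 0" by (cases "a - a * a = 0") auto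
  then have "a * (1 - a) = 0" by (simp add: algebra_simps)
  then show ?thesis by (auto simp: a_def)
qed

text \<open>A law of large numbers drawn from the covariances. Since \<open>G\<close> is open, the
  indicator of its complement is a decreasing limit of Lipschitz functions, one of which still has
  mean below \<open>e / 2\<close>; summable covariances make the variance of its orbit sums linear
  in the length.\<close>

lemma AE_visit_frequency:
  assumes [measurable]: "G \<in> sets M"
    and open_G: "\<And>z. z \<in> G \<Longrightarrow> \<exists>e>0. nball z e \<subseteq> G"
    and e: "measure M (space M - G) < e / 2"
  shows "AE z in M. eventually (\<lambda>k. real (card {i. i < 2 ^ k \<and> (T ^^ i) z \<notin> G}) \<le> e * 2 ^ k) sequentially"
\<comment> \<open>Split off because \<open>infdist\<close> to the empty set is 0 by convention,
  which would make the cutoff below equal to 1 instead of 0.\<close>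
proof (cases "G = space M")
  case True
  have e0: "0 < e" using e measure_nonneg[of M "space M - G"] by linarith
  show ?thesis
  proof (rule AE_I2, rule always_eventually, rule allI)
    fix z k assume "z \<in> space M"
    then have "{i. i < 2 ^ k \<and> (T ^^ i) z \<notin> G} = {}" using True Tn_space by auto
    then have c: "card {i. i < 2 ^ k \<and> (T ^^ i) z \<notin> G} = 0" by (simp only: card.empty)
    show "real (card {i. i < 2 ^ k \<and> (T ^^ i) z \<notin> G}) \<le> e * 2 ^ k"
      unfolding c using e0 by simp
  qed
next
  case False
  have e0: "0 < e" using e measure_nonneg[of M "space M - G"] by linarith
  define F where "F = \<phi> ` (space M - G)"
  have F: "F \<noteq> {}" using False sets.sets_into_space[OF assms(1)] by (auto simp: F_def)
  \<comment> \<open>Equal to 1 off \<open>G\<close> for every \<open>q\<close>. On \<open>G\<close>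
    the distance to \<open>F\<close> is positive by openness, so the values vanish for large
    \<open>q\<close>.\<close>
  define h where "h q z = max 0 (1 - real q * infdist (\<phi> z) F)" for q :: nat and z
  have h01: "0 \<le> h q z" "h q z \<le> 1" for q z using infdist_nonneg[of "\<phi> z" F] by (auto simp: h_def)
  have h_bad: "h q z = 1" if "z \<in> space M" "z \<notin> G" for q z
    using that by (simp add: h_def F_def)
  have lip: "\<bar>h q x - h q y\<bar> \<le> real q * dist (\<phi> x) (\<phi> y)" for q x y
  proof -
    have "\<bar>real q * infdist (\<phi> x) F - real q * infdist (\<phi> y) F\<bar> \<le> real q * dist (\<phi> x) (\<phi> y)"
      unfolding right_diff_distrib[symmetric] abs_mult using infdist_triangle_abs[of "\<phi> x" F "\<phi> y"]
      by (simp add: mult_left_mono)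
    then show ?thesis by (auto simp: h_def max_def abs_if split: if_splits)
  qed
  have [measurable]: "h q \<in> borel_measurable M" for q using lip by (rule Lipschitz_borel_measurable)
  have "(\<lambda>q. \<integral>z. h q z \<partial>M) \<longlonglongrightarrow> (\<integral>z. indicat_real (space M - G) z \<partial>M)"
  proof (rule integral_dominated_convergence[where w="\<lambda>_. 1"])
    show "AE z in M. (\<lambda>q. h q z) \<longlonglongrightarrow> indicat_real (space M - G) z"
    proof (rule AE_I2)
      fix z assume z: "z \<in> space M"
      show "(\<lambda>q. h q z) \<longlonglongrightarrow> indicat_real (space M - G) z"
      proof (cases "z \<in> G")
        case True
        then obtain d where d: "d > 0" "nball z d \<subseteq> G" using open_G by blast
        have "d \<le> dist (\<phi> z) y" if "y \<in> F" for y
          using that d by (force simp: F_def nball_def not_less[symmetric])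
        then have "d \<le> infdist (\<phi> z) F" using F by (subst infdist_def) (auto intro!: cINF_greatest)
        then have pos: "infdist (\<phi> z) F > 0" using d by linarith
        have "eventually (\<lambda>q. h q z = 0) sequentially"
        proof -
          obtain q0 :: nat where q0: "1 / infdist (\<phi> z) F < real q0" using reals_Archimedean2 by blast
          have "h q z = 0" if "q \<ge> q0" for q
          proof -
            have "1 < real q0 * infdist (\<phi> z) F" using q0 pos by (simp add: field_simps)
            also have "\<dots> \<le> real q * infdist (\<phi> z) F" using that pos by (intro mult_right_mono) auto
            finally show ?thesis by (simp add: h_def)
          qed
          then show ?thesis by (auto simp: eventually_sequentially)
        qed
        then show ?thesis using True by (auto intro: tendsto_eventually)
      qed (use z h_bad in auto)
    qed
  qed (use h01 in \<open>auto intro!: AE_I2\<close>)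
  then have "(\<lambda>q. \<integral>z. h q z \<partial>M) \<longlonglongrightarrow> measure M (space M - G)" by simp
  then have "eventually (\<lambda>q. (\<integral>z. h q z \<partial>M) < e / 2) sequentially" using e by (rule order_tendstoD)
  then obtain q where q: "(\<integral>z. h q z \<partial>M) < e / 2" by (auto simp: eventually_sequentially)
  define f where "f = h q"
  have [measurable]: "f \<in> borel_measurable M" by (simp add: f_def)
  have f01: "0 \<le> f z" "f z \<le> 1" for z by (auto simp: f_def h01)
  define m where "m = (\<integral>z. f z \<partial>M)"
  have m: "m < e / 2" "0 \<le> m" "m \<le> 1" using q f01
    by (auto simp: m_def f_def intro!: Bochner_Integration.integral_nonneg integral_le_const integrable_unit_bounded h01)
  \<comment> \<open>A summable bound for the covariance at lag \<open>n\<close>. Decay is available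
    from lag 1 on; the variance at lag 0 is at most 1.\<close>
  define \<kappa> where "\<kappa> n = (if n = 0 then 1 else (real q)\<^sup>2 * \<theta> n)" for n
  have kap0: "0 \<le> \<kappa> n" for n using theta_nonneg by (simp add: \<kappa>_def)
  have kap_sum: "summable \<kappa>"
  proof -
    have "summable (\<lambda>n. \<kappa> (Suc n))"
      using theta_summable summable_Suc_iff[of \<theta>] by (auto simp: \<kappa>_def intro!: summable_mult)
    then show ?thesis by (simp only: summable_Suc_iff)
  qed
  have int: "integrable M (\<lambda>z. f ((T ^^ i) z))" for i using f01 by (intro integrable_unit_bounded) auto
  have int2: "integrable M (\<lambda>z. f ((T ^^ i) z) * f ((T ^^ j) z))" for i j
    using f01 by (intro integrable_unit_bounded) (auto intro!: mult_le_one mult_nonneg_nonneg)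
  have Ef: "(\<integral>z. f ((T ^^ i) z) \<partial>M) = m" for i unfolding m_def by (rule integral_Tn) measurable
  have cov_le: "(\<integral>z. (f ((T ^^ i) z) - m) * (f ((T ^^ j) z) - m) \<partial>M) \<le> \<kappa> (j - i)" if "i \<le> j" for i j
  proof -
    have "(\<integral>z. (f ((T ^^ i) z) - m) * (f ((T ^^ j) z) - m) \<partial>M)
        = (\<integral>z. f ((T ^^ i) z) * f ((T ^^ j) z) - m * f ((T ^^ i) z) - m * f ((T ^^ j) z) + m * m \<partial>M)"
      by (rule Bochner_Integration.integral_cong) (auto simp: algebra_simps)
    also have "\<dots> = (\<integral>z. f ((T ^^ i) z) * f ((T ^^ j) z) \<partial>M) - m * m"
      using int int2 by (simp add: Ef prob_space)
    also have "(\<integral>z. f ((T ^^ i) z) * f ((T ^^ j) z) \<partial>M) = (\<integral>z. f z * f ((T ^^ (j - i)) z) \<partial>M)"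
    proof -
      have "(\<lambda>z. f ((T ^^ i) z) * f ((T ^^ j) z)) = (\<lambda>z. (\<lambda>w. f w * f ((T ^^ (j - i)) w)) ((T ^^ i) z))"
        using that by (auto simp: funpow_add[symmetric, THEN fun_cong, unfolded comp_def])
      then show ?thesis by (simp only:) (rule integral_Tn, measurable)
    qed
    also have "\<dots> - m * m \<le> \<kappa> (j - i)"
    proof (cases "j - i = 0")
      case True
      have "(\<integral>z. f z * f z \<partial>M) \<le> 1"
        using f01 by (intro integral_le_const integrable_unit_bounded) (auto intro!: mult_le_one AE_I2 mult_nonneg_nonneg)
      moreover have "0 \<le> m * m" by simp
      ultimately have "(\<integral>z. f z * f z \<partial>M) - m * m \<le> 1" by linarith
      then show ?thesis using True by (simp add: \<kappa>_def)
    next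
      case False
      then have "\<bar>(\<integral>z. f ((T ^^ (j - i)) z) * f z \<partial>M) - m * m\<bar> \<le> real q * real q * \<theta> (j - i)"
        unfolding m_def using lip[of q] by (intro decay) (auto simp: f_def)
      then show ?thesis
        using False by (simp add: \<kappa>_def power2_eq_square mult.commute)
    qed
    finally show ?thesis .
  qed
  define S where "S N z = (\<Sum>i<N. f ((T ^^ i) z))" for N z
  have [measurable]: "S N \<in> borel_measurable M" for N unfolding S_def by measurable
  have var: "(\<integral>z. (S N z - real N * m)\<^sup>2 \<partial>M) \<le> real N * (2 * suminf \<kappa>)" for N
  proof -
    have eq: "(S N z - real N * m)\<^sup>2 = (\<Sum>i<N. \<Sum>j<N. (f ((T ^^ i) z) - m) * (f ((T ^^ j) z) - m))" for z
    proof -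
      have "S N z - real N * m = (\<Sum>i<N. f ((T ^^ i) z) - m)" by (simp add: S_def sum_subtractf)
      then show ?thesis by (simp add: power2_eq_square sum_product)
    qed
    have int3: "integrable M (\<lambda>z. (f ((T ^^ i) z) - m) * (f ((T ^^ j) z) - m))" for i j
    proof -
      have "integrable M (\<lambda>z. f ((T ^^ i) z) * f ((T ^^ j) z) - m * f ((T ^^ i) z) - m * f ((T ^^ j) z) + m * m)"
        using int int2 by auto
      then show ?thesis by (simp add: algebra_simps)
    qed
    have "(\<integral>z. (S N z - real N * m)\<^sup>2 \<partial>M)
        = (\<Sum>i<N. \<Sum>j<N. (\<integral>z. (f ((T ^^ i) z) - m) * (f ((T ^^ j) z) - m) \<partial>M))"
      unfolding eq using int3 by (simp add: Bochner_Integration.integral_sum Bochner_Integration.integrable_sum)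
    \<comment> \<open>For fixed \<open>i\<close> the lags to earlier and to later indices are each
      pairwise distinct, so each half of the row is bounded by the whole series.\<close>
    also have "\<dots> \<le> (\<Sum>i<N. 2 * suminf \<kappa>)"
    proof (rule sum_mono)
      fix i assume "i \<in> {..<N}"
      then have split: "{..<N} = {..<i} \<union> {i..<N}" by auto
      have "(\<Sum>j<N. (\<integral>z. (f ((T ^^ i) z) - m) * (f ((T ^^ j) z) - m) \<partial>M))
          = (\<Sum>j<i. (\<integral>z. (f ((T ^^ j) z) - m) * (f ((T ^^ i) z) - m) \<partial>M))
            + (\<Sum>j=i..<N. (\<integral>z. (f ((T ^^ i) z) - m) * (f ((T ^^ j) z) - m) \<partial>M))"
        unfolding split by (subst sum.union_disjoint) (auto simp: mult.commute)
      also have "\<dots> \<le> (\<Sum>j<i. \<kappa> (i - j)) + (\<Sum>j=i..<N. \<kappa> (j - i))"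
        by (intro add_mono sum_mono cov_le) auto
      also have "\<dots> \<le> suminf \<kappa> + suminf \<kappa>"
        by (intro add_mono sum_inj_le_suminf kap_sum kap0) (auto simp: inj_on_def)
      finally show "(\<Sum>j<N. (\<integral>z. (f ((T ^^ i) z) - m) * (f ((T ^^ j) z) - m) \<partial>M)) \<le> 2 * suminf \<kappa>" by simp
    qed
    finally show ?thesis by simp
  qed
  have int4: "integrable M (\<lambda>z. (S N z - real N * m)\<^sup>2)" for N
  proof (rule integrable_const_bound[where B="(real N)\<^sup>2"])
    have "\<bar>S N z - real N * m\<bar> \<le> real N" for z
    proof -
      have "0 \<le> S N z" "S N z \<le> real N"
        unfolding S_def using f01 sum_bounded_above[of "{..<N}" "\<lambda>i. f ((T ^^ i) z)" 1] by (auto intro!: sum_nonneg)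
      moreover have "0 \<le> real N * m" "real N * m \<le> real N * 1" using m by (auto simp: mult_left_le)
      ultimately show ?thesis by auto
    qed
    then show "AE z in M. norm ((S N z - real N * m)\<^sup>2) \<le> (real N)\<^sup>2"
      by (auto intro!: AE_I2 simp: abs_le_square_iff[symmetric])
  qed measurable
  define E where "E k = {z \<in> space M. e * 2 ^ k < S (2 ^ k) z}" for k :: nat
  have [measurable]: "E k \<in> sets M" for k unfolding E_def by measurable
  \<comment> \<open>Chebyshev: the mean accounts for at most half of the threshold, so
    \<open>E k\<close> requires a deviation of \<open>e / 2 * 2 ^ k\<close>. Variance of order
    \<open>2 ^ k\<close> leaves a geometric series, which is why only dyadic lengths are
    tested.\<close>
  have bound: "measure M (E k) \<le> 8 * suminf \<kappa> / e\<^sup>2 * (1 / 2) ^ k" for k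
  proof -
    let ?N = "(2::nat) ^ k"
    let ?c = "(e / 2 * 2 ^ k)\<^sup>2"
    have c: "?c > 0" using e0 by simp
    have "measure M (E k) = (\<integral>z. indicat_real (E k) z \<partial>M)" by simp
    also have "\<dots> \<le> (\<integral>z. (S ?N z - real ?N * m)\<^sup>2 / ?c \<partial>M)"
    proof (rule integral_mono)
      fix z
      show "indicat_real (E k) z \<le> (S ?N z - real ?N * m)\<^sup>2 / ?c"
      proof (cases "z \<in> E k")
        case True
        have "real ?N * m \<le> real ?N * (e / 2)" using m by (intro mult_left_mono) auto
        moreover have "real ?N * (e / 2) = e / 2 * 2 ^ k" by simp
        moreover have "e / 2 * 2 ^ k + e / 2 * 2 ^ k < S ?N z" using True by (simp add: E_def)
        ultimately have "e / 2 * 2 ^ k \<le> S ?N z - real ?N * m" by linarith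
        then have "?c \<le> (S ?N z - real ?N * m)\<^sup>2" using e0 by (intro power_mono) auto
        then show ?thesis using True c by (simp add: field_simps)
      qed (use c in auto)
    qed (auto intro!: int4 integrable_real_indicator simp: less_top[symmetric] simp del: of_nat_power)
    also have "\<dots> \<le> real ?N * (2 * suminf \<kappa>) / ?c"
      using var[of ?N] c by (simp add: divide_right_mono del: of_nat_power)
    also have "\<dots> = 8 * suminf \<kappa> / e\<^sup>2 * (1 / 2) ^ k"
      using e0 by (simp add: power_mult_distrib power_divide power2_eq_square field_simps)
    finally show ?thesis .
  qed
  have "summable (\<lambda>k. 8 * suminf \<kappa> / e\<^sup>2 * (1 / 2) ^ k)" by (intro summable_mult summable_geometric) auto
  then have "summable (\<lambda>k. measure M (E k))"
    by (rule summable_comparison_test'[of _ 0]) (use bound in auto)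
  then have "AE z in M. eventually (\<lambda>k. z \<notin> E k) sequentially"
    by (intro AE_eventually_notin) auto
  with AE_space show ?thesis
  proof eventually_elim
    case (elim z)
    from elim(2) show ?case
    proof eventually_elim
      case (elim k)
      have "real (card {i. i < 2 ^ k \<and> (T ^^ i) z \<notin> G}) = (\<Sum>i\<in>{i. i < 2 ^ k \<and> (T ^^ i) z \<notin> G}. f ((T ^^ i) z))"
        using h_bad Tn_space[OF \<open>z \<in> space M\<close>] by (simp add: f_def)
      also have "\<dots> \<le> S (2 ^ k) z"
        unfolding S_def using f01 by (intro sum_mono2) auto
      also have "\<dots> \<le> e * 2 ^ k" using elim \<open>z \<in> space M\<close> by (simp add: E_def)
      finally show ?case .
    qed
  qed
qed

text \<open>Bowen sets have diameter exponentially small in \<open>N\<close>, by expansion.\<close>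

definition bowen :: "nat \<Rightarrow> 'a set \<Rightarrow> bool" where
  "bowen N U \<longleftrightarrow> U \<subseteq> space M \<and>
     (\<forall>z\<in>U. \<forall>w\<in>U. \<forall>i<N. dist (\<phi> ((T ^^ i) z)) (\<phi> ((T ^^ i) w)) < \<delta>)"

lemma Tn_Lipschitz:
  assumes "x \<in> space M" "y \<in> space M"
  shows "dist (\<phi> ((T ^^ n) x)) (\<phi> ((T ^^ n) y)) \<le> L ^ n * dist (\<phi> x) (\<phi> y)"
proof (induction n)
  case (Suc n)
  have "dist (\<phi> ((T ^^ Suc n) x)) (\<phi> ((T ^^ Suc n) y)) \<le> L * dist (\<phi> ((T ^^ n) x)) (\<phi> ((T ^^ n) y))"
    using T_Lipschitz Tn_space assms by simp
  also have "\<dots> \<le> L * (L ^ n * dist (\<phi> x) (\<phi> y))"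
    using Suc L_gt1 by (intro mult_left_mono) auto
  finally show ?case by (simp add: mult.assoc)
qed simp

lemma bowen_dist:
  assumes "bowen N U" "z \<in> U" "w \<in> U"
  shows "2 ^ N * dist (\<phi> z) (\<phi> w) \<le> dist (\<phi> ((T ^^ N) z)) (\<phi> ((T ^^ N) w))"
proof -
  have sp: "z \<in> space M" "w \<in> space M" using assms by (auto simp: bowen_def)
  have "2 ^ n * dist (\<phi> z) (\<phi> w) \<le> dist (\<phi> ((T ^^ n) z)) (\<phi> ((T ^^ n) w))" if "n \<le> N" for n
    using that
  proof (induction n)
    case (Suc n)
    then have "2 ^ Suc n * dist (\<phi> z) (\<phi> w) \<le> 2 * dist (\<phi> ((T ^^ n) z)) (\<phi> ((T ^^ n) w))" by simp
    also have "\<dots> \<le> dist (\<phi> (T ((T ^^ n) z))) (\<phi> (T ((T ^^ n) w)))"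
      by (rule T_expanding) (use assms Suc.prems Tn_space sp in \<open>auto simp: bowen_def\<close>)
    finally show ?case by simp
  qed simp
  then show ?thesis by simp
qed

section \<open>Covering numbers by Bowen sets\<close>

definition coverable :: "nat \<Rightarrow> 'a set \<Rightarrow> real \<Rightarrow> bool" where
  "coverable N Y c \<longleftrightarrow> (\<exists>\<U>. finite \<U> \<and> real (card \<U>) \<le> c \<and> (\<forall>U\<in>\<U>. bowen N U) \<and> Y \<subseteq> \<Union>\<U>)"

lemma coverable_mono: "coverable N Y c \<Longrightarrow> Y' \<subseteq> Y \<Longrightarrow> c \<le> c' \<Longrightarrow> coverable N Y' c'"
  unfolding coverable_def by (meson order_trans)

lemma coverable_UN:
  assumes "finite I" "\<And>i. i \<in> I \<Longrightarrow> coverable N (Y i) (c i)"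
  shows "coverable N (\<Union>i\<in>I. Y i) (\<Sum>i\<in>I. c i)"
proof -
  from assms(2) obtain \<U> where \<U>: "\<And>i. i \<in> I \<Longrightarrow> finite (\<U> i) \<and> real (card (\<U> i)) \<le> c i \<and>
      (\<forall>U\<in>\<U> i. bowen N U) \<and> Y i \<subseteq> \<Union>(\<U> i)"
    unfolding coverable_def by metis
  have "real (card (\<Union>i\<in>I. \<U> i)) \<le> (\<Sum>i\<in>I. real (card (\<U> i)))"
    using card_UN_le[OF assms(1), of \<U>] by (metis of_nat_le_iff of_nat_sum)
  also have "\<dots> \<le> (\<Sum>i\<in>I. c i)" using \<U> by (intro sum_mono) auto
  finally show ?thesis
    unfolding coverable_def using assms(1) \<U> by (intro exI[of _ "\<Union>i\<in>I. \<U> i"]) fastforce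
qed

lemma coverable_Un:
  assumes "coverable N Y c" "coverable N Y' c'"
  shows "coverable N (Y \<union> Y') (c + c')"
  using coverable_UN[of UNIV N "\<lambda>b. if b then Y else Y'" "\<lambda>b. if b then c else c'"] assms
  by (simp add: UNIV_bool Un_commute add.commute)

text \<open>Concatenation of orbit segments: points that stay close for \<open>k\<close> steps and
  whose \<open>k\<close>-th iterates stay close for \<open>N\<close> more steps stay close for
  \<open>N + k\<close> steps. The number of pieces does not grow.\<close>

lemma coverable_pullback:
  assumes X: "bowen k X" and Y: "coverable N Y c"
  shows "coverable (N + k) {z \<in> X. (T ^^ k) z \<in> Y} c"
proof -
  obtain \<U> where \<U>: "finite \<U>" "real (card \<U>) \<le> c" "\<And>U. U \<in> \<U> \<Longrightarrow> bowen N U" "Y \<subseteq> \<Union>\<U>"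
    using Y unfolding coverable_def by auto
  define h where "h U = {z \<in> X. (T ^^ k) z \<in> U}" for U
  have "bowen (N + k) (h U)" if "U \<in> \<U>" for U
    unfolding bowen_def
  proof (intro conjI ballI allI impI)
    show "h U \<subseteq> space M" using X by (auto simp: h_def bowen_def)
    fix z w i assume zw: "z \<in> h U" "w \<in> h U" and i: "i < N + k"
    show "dist (\<phi> ((T ^^ i) z)) (\<phi> ((T ^^ i) w)) < \<delta>"
    proof (cases "i < k")
      case True
      then show ?thesis using X zw by (auto simp: bowen_def h_def)
    next
      case False
      then have "i - k < N" using i by simp
      then have "dist (\<phi> ((T ^^ (i - k)) ((T ^^ k) z))) (\<phi> ((T ^^ (i - k)) ((T ^^ k) w))) < \<delta>"
        using \<U>(3)[OF that] zw unfolding bowen_def h_def by blast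
      moreover have "(T ^^ (i - k)) ((T ^^ k) x) = (T ^^ i) x" for x
        using False by (simp add: funpow_add[symmetric, THEN fun_cong, unfolded comp_def])
      ultimately show ?thesis by simp
    qed
  qed
  moreover have "real (card (h ` \<U>)) \<le> c"
    using card_image_le[OF \<U>(1), of h] \<U>(2) by linarith
  moreover have "{z \<in> X. (T ^^ k) z \<in> Y} \<subseteq> \<Union>(h ` \<U>)" using \<U>(4) by (auto simp: h_def)
  ultimately show ?thesis unfolding coverable_def using \<U>(1) by (intro exI[of _ "h ` \<U>"]) auto
qed

section \<open>Balls of large measure at dynamical scales\<close>

definition scale :: "nat \<Rightarrow> real" where "scale k = \<delta> / 4 / L ^ k"

lemma scale_pos: "0 < scale k"
  using delta_pos L_gt1 by (simp add: scale_def)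

text \<open>Points at distance below \<open>4 * scale k\<close> remain \<open>\<delta>\<close>-close
  up to time \<open>k\<close> by the Lipschitz bound. The 4 leaves room for balls of radius
  \<open>2 * scale k\<close>, and time 0 is counted, hence \<open>Suc k\<close>.\<close>

lemma bowen_nball:
  assumes "r \<le> 2 * scale k"
  shows "bowen (Suc k) (nball x r)"
  unfolding bowen_def
proof (intro conjI ballI allI impI)
  fix z w i assume zw: "z \<in> nball x r" "w \<in> nball x r" and i: "i < Suc k"
  have "dist (\<phi> ((T ^^ i) z)) (\<phi> ((T ^^ i) w)) \<le> L ^ i * dist (\<phi> z) (\<phi> w)"
    using zw by (intro Tn_Lipschitz) (auto simp: nball_def)
  also have "\<dots> \<le> L ^ k * dist (\<phi> z) (\<phi> w)"
    using i L_gt1 by (intro mult_right_mono power_increasing) auto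
  also have "dist (\<phi> z) (\<phi> w) < 4 * scale k"
    using zw assms dist_triangle3[of "\<phi> z" "\<phi> w" "\<phi> x"] by (auto simp: nball_def)
  then have "L ^ k * dist (\<phi> z) (\<phi> w) < L ^ k * (4 * scale k)"
    using L_gt1 by (intro mult_strict_left_mono) auto
  also have "\<dots> = \<delta>" using L_gt1 by (simp add: scale_def)
  finally show "dist (\<phi> ((T ^^ i) z)) (\<phi> ((T ^^ i) w)) < \<delta>" .
qed (auto simp: nball_def)

lemma bowen_antimono: "bowen N U \<Longrightarrow> N' \<le> N \<Longrightarrow> bowen N' U"
  unfolding bowen_def by fastforce

text \<open>At a heavy point the next \<open>k\<close> steps of the orbit can be encoded at rate at
  most \<open>e\<close> per step, because only few disjoint balls have so much mass.\<close>

definition heavy :: "real \<Rightarrow> nat \<Rightarrow> 'a set" where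
  "heavy e k = {z \<in> space M. exp (- e * real k) < measure M (nball z (scale k))}"

lemma heavy_meas [measurable]: "heavy e k \<in> sets M"
  unfolding heavy_def by measurable

text \<open>The measure of an open ball is the limit over smaller concentric balls, so the strict
  inequality survives a small shift of the centre. The visit frequency requires an open set.\<close>

lemma heavy_open:
  assumes "z \<in> heavy e k"
  shows "\<exists>d>0. nball z d \<subseteq> heavy e k"
proof -
  have "(\<lambda>n. measure M (nball z (scale k - 1 / Suc n))) \<longlonglongrightarrow> measure M (\<Union>n. nball z (scale k - 1 / Suc n))"
    by (rule finite_Lim_measure_incseq)
      (auto intro!: incseq_SucI nball_mono simp: field_simps)
  also have "(\<Union>n. nball z (scale k - 1 / Suc n)) = nball z (scale k)"
  proof safe
    fix w assume w: "w \<in> nball z (scale k)"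
    then obtain n where "inverse (Suc n) < scale k - dist (\<phi> z) (\<phi> w)"
      using reals_Archimedean[of "scale k - dist (\<phi> z) (\<phi> w)"] by (auto simp: nball_def)
    then show "w \<in> (\<Union>n. nball z (scale k - 1 / Suc n))"
      using w by (auto simp: nball_def inverse_eq_divide intro!: exI[of _ n])
  next
    fix w n assume "w \<in> nball z (scale k - 1 / Suc n)"
    moreover have "scale k - 1 / Suc n \<le> scale k" by simp
    ultimately show "w \<in> nball z (scale k)" using nball_mono by blast
  qed
  finally have "eventually (\<lambda>n. exp (- e * real k) < measure M (nball z (scale k - 1 / Suc n))) sequentially"
    using assms by (intro order_tendstoD) (auto simp: heavy_def)
  then obtain n where n: "exp (- e * real k) < measure M (nball z (scale k - 1 / Suc n))"
    by (auto simp: eventually_sequentially)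
  have "nball z (1 / Suc n) \<subseteq> heavy e k"
  proof
    fix w assume w: "w \<in> nball z (1 / Suc n)"
    have "nball z (scale k - 1 / Suc n) \<subseteq> nball w (scale k)"
    proof
      fix u assume u: "u \<in> nball z (scale k - 1 / Suc n)"
      have "dist (\<phi> w) (\<phi> u) \<le> dist (\<phi> z) (\<phi> w) + dist (\<phi> z) (\<phi> u)" by (rule dist_triangle3)
      then show "u \<in> nball w (scale k)" using u w by (auto simp: nball_def)
    qed
    then have "measure M (nball z (scale k - 1 / Suc n)) \<le> measure M (nball w (scale k))"
      by (intro finite_measure_mono) auto
    then show "w \<in> heavy e k" using n w by (auto simp: heavy_def nball_def)
  qed
  then show ?thesis by (intro exI[of _ "1 / Suc n"]) auto
qed

lemma space_net:
  assumes "0 < s"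
  obtains S where "finite S" "space M \<subseteq> (\<Union>x\<in>S. nball x s)"
proof -
  obtain S where S: "finite S" "S \<subseteq> space M" "\<And>z. z \<in> space M \<Longrightarrow> \<exists>x\<in>S. dist (\<phi> x) (\<phi> z) < s"
    using maximal_separated_subset[OF assms phi_bounded] by metis
  then show ?thesis by (intro that[of S]) (auto simp: nball_def)
qed

text \<open>Around a maximal \<open>2 * scale k\<close>-separated set of heavy points the balls of
  radius \<open>scale k\<close> are disjoint, each of mass above \<open>exp (- e * real k)\<close>.
  The total mass 1 bounds their number, and maximality lets the doubled balls cover.\<close>

lemma heavy_net:
  obtains S where "finite S" "real (card S) \<le> exp (e * real k)"
    "heavy e k \<subseteq> (\<Union>x\<in>S. nball x (2 * scale k))"
proof -
  have s2: "0 < 2 * scale k" using scale_pos[of k] by simp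
  have bd: "bounded (\<phi> ` heavy e k)"
    by (rule bounded_subset[OF phi_bounded]) (auto simp: heavy_def)
  obtain S where S: "finite S" "S \<subseteq> heavy e k"
    and sep: "\<And>u v. u \<in> S \<Longrightarrow> v \<in> S \<Longrightarrow> u \<noteq> v \<Longrightarrow> 2 * scale k \<le> dist (\<phi> u) (\<phi> v)"
    and cov: "\<And>z. z \<in> heavy e k \<Longrightarrow> \<exists>x\<in>S. dist (\<phi> x) (\<phi> z) < 2 * scale k"
    by (rule maximal_separated_subset[OF s2 bd]) (rule that; assumption)
  have disj: "disjoint_family_on (\<lambda>x. nball x (scale k)) S"
    unfolding disjoint_family_on_def
  proof (intro ballI impI)
    fix u v assume uv: "u \<in> S" "v \<in> S" "u \<noteq> v"
    have "False" if "dist (\<phi> u) (\<phi> x) < scale k" "dist (\<phi> v) (\<phi> x) < scale k" for x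
      using sep[OF uv] that dist_triangle2[of "\<phi> u" "\<phi> v" "\<phi> x"] by linarith
    then show "nball u (scale k) \<inter> nball v (scale k) = {}" by (auto simp: nball_def)
  qed
  have "real (card S) * exp (- e * real k) \<le> (\<Sum>x\<in>S. measure M (nball x (scale k)))"
    using S(2) by (intro sum_bounded_below) (auto simp: heavy_def less_imp_le)
  also have "\<dots> = measure M (\<Union>x\<in>S. nball x (scale k))"
    by (rule finite_measure_finite_Union[symmetric]) (use S disj in auto)
  also have "\<dots> \<le> 1" by simp
  finally have "real (card S) \<le> exp (e * real k)" by (simp add: exp_minus field_simps)
  moreover have "heavy e k \<subseteq> (\<Union>x\<in>S. nball x (2 * scale k))"
    using cov by (fastforce simp: nball_def heavy_def)
  ultimately show ?thesis using that S(1) by blast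
qed

text \<open>The number \<open>b\<close> is a budget for times spent outside \<open>G\<close>;
  typical orbits satisfy it with \<open>b\<close> a small fraction of \<open>N\<close>.\<close>

definition visits :: "'a set \<Rightarrow> nat \<Rightarrow> nat \<Rightarrow> 'a set" where
  "visits G N b = {z \<in> space M. card {i. i < N \<and> (T ^^ i) z \<notin> G} \<le> b}"

text \<open>Parse an orbit from left to right. At a point of \<open>heavy e k\<close> the next \<open>k\<close> steps cost a choice
  among \<open>exp (e k)\<close> balls; at a point outside \<open>G\<close> a single step costs a choice among \<open>P\<close> balls. Since a
  block of length \<open>k\<close> earns a factor \<open>exp (2 e k)\<close>, summing over the block lengths \<open>k \<ge> k0\<close> costs at
  most a factor 1/2.\<close>

lemma coverable_visits:
  assumes e: "0 < e" and k0: "1 \<le> k0"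
    and half: "(\<Sum>k\<in>{k0..k1}. exp (- e * real k)) \<le> 1 / 2"
    and S0: "finite S0" "space M \<subseteq> (\<Union>x\<in>S0. nball x (2 * scale 0))"
    and P: "P = real (card S0) + 1"
  obtains W :: real where "1 \<le> W"
    "\<And>N b. coverable N (visits (\<Union>k\<in>{k0..k1}. heavy e k) N b) (W * exp (2 * e * real N) * (2 * P) ^ b)"
proof -
  define G where "G = (\<Union>k\<in>{k0..k1}. heavy e k)"
  \<comment> \<open>For \<open>N \<le> k1\<close> a block could overrun the segment. This net, fine
    enough for more than \<open>k1\<close> steps, covers everything at a fixed cost
    \<open>W\<close>.\<close>
  obtain S1 where S1: "finite S1" "space M \<subseteq> (\<Union>x\<in>S1. nball x (2 * scale (k1 + 1)))"
    using space_net[of "2 * scale (k1 + 1)"] scale_pos[of "k1 + 1"] by auto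
  define W where "W = real (card S1) + 1"
  have P1: "1 \<le> P" and W: "1 \<le> W" by (auto simp: P W_def)
  have "\<forall>k. \<exists>S. finite S \<and> real (card S) \<le> exp (e * real k) \<and> heavy e k \<subseteq> (\<Union>x\<in>S. nball x (2 * scale k))"
    using heavy_net by metis
  then obtain S where S: "\<And>k. finite (S k)" "\<And>k. real (card (S k)) \<le> exp (e * real k)"
    "\<And>k. heavy e k \<subseteq> (\<Union>x\<in>S k. nball x (2 * scale k))" by metis
  \<comment> \<open>Chosen so that each of the two kinds of continuation costs at most half:
    \<open>exp (e * real k) * c (N - k) b = c N b * exp (- e * real k)\<close>, where the rate
    \<open>2 * e\<close> earns what \<open>e\<close> spends, and the base \<open>2 * P\<close> pays
    twice for the \<open>P\<close> choices of a single step.\<close>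
  define c where "c N b = W * exp (2 * e * real N) * (2 * P) ^ b" for N b :: nat
  have c0: "0 \<le> c N b" for N b using W P1 by (simp add: c_def)
  have "coverable N (visits G N b) (c N b)" for N b
  proof (induction N arbitrary: b rule: less_induct)
    case (less N)
    show ?case
    proof (cases "N \<le> k1")
      case True
      have "coverable N (\<Union>x\<in>S1. nball x (2 * scale (k1 + 1))) (\<Sum>x\<in>S1. 1)"
      proof (rule coverable_UN)
        fix x assume "x \<in> S1"
        have "bowen N (nball x (2 * scale (k1 + 1)))"
          by (rule bowen_antimono[OF bowen_nball[OF order_refl]]) (use True in auto)
        then show "coverable N (nball x (2 * scale (k1 + 1))) 1"
          unfolding coverable_def by (intro exI[of _ "{nball x (2 * scale (k1 + 1))}"]) auto
      qed (rule S1)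
      moreover have "real (card S1) \<le> c N b"
      proof -
        have "W * 1 * 1 \<le> c N b"
          unfolding c_def using W P1 e by (intro mult_mono one_le_power) auto
        then show ?thesis by (simp add: W_def)
      qed
      ultimately show ?thesis
        by (elim coverable_mono) (use S1(2) in \<open>auto simp: visits_def\<close>)
    next
      case False
      have blocks: "coverable N (\<Union>k\<in>{k0..k1}. \<Union>x\<in>S k. {z \<in> nball x (2 * scale k). (T ^^ k) z \<in> visits G (N - k) b})
          (\<Sum>k\<in>{k0..k1}. \<Sum>x\<in>S k. c (N - k) b)"
      proof (intro coverable_UN)
        fix k x assume k: "k \<in> {k0..k1}" and "x \<in> S k"
        have "coverable (N - k) (visits G (N - k) b) (c (N - k) b)"
          using less.IH[of "N - k"] k k0 False by auto
        moreover have "bowen k (nball x (2 * scale k))"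
          by (rule bowen_antimono[OF bowen_nball[OF order_refl]]) auto
        ultimately have "coverable (N - k + k) {z \<in> nball x (2 * scale k). (T ^^ k) z \<in> visits G (N - k) b} (c (N - k) b)"
          by (rule coverable_pullback[rotated])
        then show "coverable N {z \<in> nball x (2 * scale k). (T ^^ k) z \<in> visits G (N - k) b} (c (N - k) b)"
          using k False by simp
      qed (use S in auto)
      have bcost: "(\<Sum>k\<in>{k0..k1}. \<Sum>x\<in>S k. c (N - k) b) \<le> c N b * (1 / 2)"
      proof -
        have "(\<Sum>k\<in>{k0..k1}. \<Sum>x\<in>S k. c (N - k) b) \<le> (\<Sum>k\<in>{k0..k1}. c N b * exp (- e * real k))"
        proof (rule sum_mono)
          fix k assume k: "k \<in> {k0..k1}"
          have "(\<Sum>x\<in>S k. c (N - k) b) \<le> exp (e * real k) * c (N - k) b"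
            using S(2)[of k] c0 by (simp add: mult_right_mono)
          also have "\<dots> = c N b * exp (- e * real k)"
            using k False by (simp add: c_def of_nat_diff exp_add[symmetric] algebra_simps flip: exp_diff)
          finally show "(\<Sum>x\<in>S k. c (N - k) b) \<le> c N b * exp (- e * real k)" .
        qed
        also have "\<dots> \<le> c N b * (1 / 2)"
          unfolding sum_distrib_left[symmetric] by (rule mult_left_mono[OF half c0])
        finally show ?thesis .
      qed
      have good: "z \<in> (\<Union>k\<in>{k0..k1}. \<Union>x\<in>S k. {z \<in> nball x (2 * scale k). (T ^^ k) z \<in> visits G (N - k) b})"
        if z: "z \<in> visits G N b" "z \<in> G" for z
      proof -
        obtain k where k: "k \<in> {k0..k1}" "z \<in> heavy e k" using z by (auto simp: G_def)
        then obtain x where "x \<in> S k" "z \<in> nball x (2 * scale k)" using S(3) by blast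
        moreover have "(T ^^ k) z \<in> visits G (N - k) b"
          using z k False card_funpow_shift_le[of k N T z G] Tn_space by (auto simp: visits_def)
        ultimately show ?thesis using k by blast
      qed
      show ?thesis
      proof (cases b)
        case 0
        \<comment> \<open>Without budget the orbit may not even start outside \<open>G\<close>,
          since time 0 is counted.\<close>
        have "visits G N b \<subseteq> G"
        proof
          fix z assume "z \<in> visits G N b"
          then have "{i. i < N \<and> (T ^^ i) z \<notin> G} = {}" using 0 by (simp add: visits_def)
          then show "z \<in> G" using False by (force dest: spec[of _ 0])
        qed
        then show ?thesis
          by (intro coverable_mono[OF blocks]) (use good bcost c0[of N b] in auto)
      next
        case (Suc b')
        have steps: "coverable N (\<Union>x\<in>S0. {z \<in> nball x (2 * scale 0). (T ^^ 1) z \<in> visits G (N - 1) b'})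
            (\<Sum>x\<in>S0. c (N - 1) b')"
        proof (rule coverable_UN)
          fix x assume "x \<in> S0"
          have "coverable (N - 1 + 1) {z \<in> nball x (2 * scale 0). (T ^^ 1) z \<in> visits G (N - 1) b'} (c (N - 1) b')"
            using False bowen_nball[of "2 * scale 0" 0 x] by (intro coverable_pullback less.IH) auto
          then show "coverable N {z \<in> nball x (2 * scale 0). (T ^^ 1) z \<in> visits G (N - 1) b'} (c (N - 1) b')"
            using False by simp
        qed (rule S0)
        have scost: "(\<Sum>x\<in>S0. c (N - 1) b') \<le> c N b * (1 / 2)"
        proof -
          have "(\<Sum>x\<in>S0. c (N - 1) b') \<le> P * c (N - 1) b'"
            using c0[of "N - 1" b'] by (simp add: P distrib_right)
          also have "\<dots> = W * exp (2 * e * real (N - 1)) * (P * (2 * P) ^ b')" by (simp add: c_def)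
          also have "\<dots> \<le> W * exp (2 * e * real N) * (P * (2 * P) ^ b')"
            using W P1 e by (intro mult_right_mono mult_left_mono) auto
          also have "\<dots> = c N b * (1 / 2)" by (simp add: c_def Suc)
          finally show ?thesis .
        qed
        have bad: "z \<in> (\<Union>x\<in>S0. {z \<in> nball x (2 * scale 0). (T ^^ 1) z \<in> visits G (N - 1) b'})"
          if z: "z \<in> visits G N b" "z \<notin> G" for z
        proof -
          have zs: "z \<in> space M" using z by (simp add: visits_def)
          then obtain x where "x \<in> S0" "z \<in> nball x (2 * scale 0)" using S0(2) by blast
          moreover have "(T ^^ 1) z \<in> visits G (N - 1) b'"
          proof -
            let ?h = "\<lambda>i. i + 1"
            let ?B = "{i. i < N - 1 \<and> (T ^^ i) ((T ^^ 1) z) \<notin> G}"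
            have "insert 0 (?h ` ?B) \<subseteq> {i. i < N \<and> (T ^^ i) z \<notin> G}"
              using z False by (auto simp: funpow_swap1)
            then have "card (insert 0 (?h ` ?B)) \<le> card {i. i < N \<and> (T ^^ i) z \<notin> G}"
              by (intro card_mono) auto
            then have "card (insert 0 (?h ` ?B)) \<le> b"
              using z(1) by (simp only: visits_def mem_Collect_eq) linarith
            moreover have "card (insert 0 (?h ` ?B)) = Suc (card ?B)"
              by (subst card_insert_disjoint) (auto simp: card_image)
            ultimately show ?thesis using Suc zs Tn_space[of z 1] by (simp add: visits_def)
          qed
          ultimately show ?thesis by blast
        qed
        show ?thesis
        proof (rule coverable_mono[OF coverable_Un[OF blocks steps]])
          show "visits G N b \<subseteq> (\<Union>k\<in>{k0..k1}. \<Union>x\<in>S k. {z \<in> nball x (2 * scale k). (T ^^ k) z \<in> visits G (N - k) b})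
              \<union> (\<Union>x\<in>S0. {z \<in> nball x (2 * scale 0). (T ^^ 1) z \<in> visits G (N - 1) b'})"
          proof
            fix z assume "z \<in> visits G N b"
            then show "z \<in> (\<Union>k\<in>{k0..k1}. \<Union>x\<in>S k. {z \<in> nball x (2 * scale k). (T ^^ k) z \<in> visits G (N - k) b})
              \<union> (\<Union>x\<in>S0. {z \<in> nball x (2 * scale 0). (T ^^ 1) z \<in> visits G (N - 1) b'})"
              using good[of z] bad[of z] by (cases "z \<in> G") (simp_all only: Un_iff simp_thms)
          qed
          show "(\<Sum>k\<in>{k0..k1}. \<Sum>x\<in>S k. c (N - k) b) + (\<Sum>x\<in>S0. c (N - 1) b') \<le> c N b"
            using bcost scost by linarith
        qed
      qed
    qed
  qed
  then show ?thesis using that[OF W] by (simp add: G_def c_def)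
qed

text \<open>By expansion a Bowen set has diameter below \<open>D / 2 ^ N\<close>. If it contains a
  light point, it lies in the ball about that point, which has measure below \<open>t\<close>. The
  measurable set \<open>E\<close> stands in because nothing is assumed about measurability of
  \<open>Y\<close>.\<close>

lemma light_points_measure:
  assumes cov: "coverable N Y c"
    and D: "\<And>x y. x \<in> space M \<Longrightarrow> y \<in> space M \<Longrightarrow> dist (\<phi> x) (\<phi> y) < D"
    and t: "0 \<le> t"
  obtains E where "E \<in> sets M" "{z \<in> Y. measure M (nball z (D / 2 ^ N)) < t} \<subseteq> E" "measure M E \<le> c * t"
proof -
  obtain \<U> where \<U>: "finite \<U>" "real (card \<U>) \<le> c" "\<And>U. U \<in> \<U> \<Longrightarrow> bowen N U" "Y \<subseteq> \<Union>\<U>"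
    using cov unfolding coverable_def by auto
  define V where "V = {z. measure M (nball z (D / 2 ^ N)) < t}"
  define \<V> where "\<V> = {U \<in> \<U>. U \<inter> V \<noteq> {}}"
  define p where "p U = (SOME z. z \<in> U \<inter> V)" for U
  have p: "p U \<in> U \<inter> V" if "U \<in> \<V>" for U
  proof -
    have "\<exists>z. z \<in> U \<inter> V" using that by (auto simp: \<V>_def)
    then show ?thesis unfolding p_def by (rule someI_ex)
  qed
  have fin: "finite \<V>" using \<U>(1) by (simp add: \<V>_def)
  show ?thesis
  proof (rule that)
    show "(\<Union>U\<in>\<V>. nball (p U) (D / 2 ^ N)) \<in> sets M" using fin by auto
    show "{z \<in> Y. measure M (nball z (D / 2 ^ N)) < t} \<subseteq> (\<Union>U\<in>\<V>. nball (p U) (D / 2 ^ N))"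
    proof safe
      fix z assume z: "z \<in> Y" "measure M (nball z (D / 2 ^ N)) < t"
      then obtain U where U: "U \<in> \<U>" "z \<in> U" using \<U>(4) by auto
      then have UV: "U \<in> \<V>" using z by (auto simp: \<V>_def V_def)
      have sp: "p U \<in> space M" "z \<in> space M" using p[OF UV] \<U>(3)[OF U(1)] U by (auto simp: bowen_def)
      have "2 ^ N * dist (\<phi> (p U)) (\<phi> z) \<le> dist (\<phi> ((T ^^ N) (p U))) (\<phi> ((T ^^ N) z))"
        using bowen_dist[OF \<U>(3)[OF U(1)]] p[OF UV] U by auto
      also have "\<dots> < D" using D Tn_space sp by auto
      finally have "z \<in> nball (p U) (D / 2 ^ N)" using sp by (simp add: nball_def field_simps)
      then show "z \<in> (\<Union>U\<in>\<V>. nball (p U) (D / 2 ^ N))" using UV by blast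
    qed
    have "measure M (\<Union>U\<in>\<V>. nball (p U) (D / 2 ^ N)) \<le> (\<Sum>U\<in>\<V>. measure M (nball (p U) (D / 2 ^ N)))"
      by (rule finite_measure_subadditive_finite) (use fin in auto)
    also have "\<dots> \<le> real (card \<V>) * t"
      using p by (intro sum_bounded_above) (auto simp: V_def intro: less_imp_le)
    also have "real (card \<V>) \<le> c"
      using card_mono[OF \<U>(1), of \<V>] \<U>(2) by (auto simp: \<V>_def)
    finally show "measure M (\<Union>U\<in>\<V>. nball (p U) (D / 2 ^ N)) \<le> c * t"
      using t by (simp add: mult_right_mono)
  qed
qed

text \<open>Orbits of length \<open>N\<close> with at most \<open>\<eta> * N\<close> times outside
  \<open>G\<close> need of order \<open>exp (3 * e * N)\<close> Bowen sets. Points whose ball is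
  lighter than \<open>exp (- 4 * e * N)\<close> then have measure of order
  \<open>exp (- e * N)\<close>, summable over the lengths \<open>2 ^ j\<close>.\<close>

lemma AE_ball_lower_bound:
  assumes e: "0 < e"
    and heavy: "AE z in M. \<forall>k0. \<exists>k\<ge>k0. z \<in> heavy e k"
    and D: "\<And>x y. x \<in> space M \<Longrightarrow> y \<in> space M \<Longrightarrow> dist (\<phi> x) (\<phi> y) < D"
  shows "AE z in M. eventually (\<lambda>j. exp (- 4 * e * 2 ^ j) \<le> measure M (nball z (D / 2 ^ (2 ^ j)))) sequentially"
proof -
  obtain S0 where S0: "finite S0" "space M \<subseteq> (\<Union>x\<in>S0. nball x (2 * scale 0))"
    using space_net[of "2 * scale 0"] scale_pos[of 0] by auto
  define P where "P = real (card S0) + 1"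
  have P: "1 \<le> P" by (simp add: P_def)
  \<comment> \<open>Makes \<open>(2 * P)\<close> to the power \<open>\<eta> * N\<close> equal to
    \<open>exp (e * N)\<close>.\<close>
  define \<eta> where "\<eta> = e / ln (2 * P)"
  have lnP: "0 < ln (2 * P)" using P by simp
  have eta: "0 < \<eta>" using e lnP by (simp add: \<eta>_def)
  have "summable (\<lambda>k. exp (- e) ^ k)" using e by (intro summable_geometric) auto
  then have "summable (\<lambda>k. exp (- e * real k))" by (simp add: exp_of_nat_mult[symmetric] mult.commute)
  then obtain k0' where k0': "\<And>m n. m \<ge> k0' \<Longrightarrow> norm (\<Sum>k\<in>{m..<n}. exp (- e * real k)) < 1 / 2"
    unfolding summable_Cauchy by (meson half_gt_zero_iff zero_less_one)
  \<comment> \<open>Sums of the series beyond \<open>k0\<close> stay below 1/2. The successor makes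
    block lengths positive, so that each block advances along the orbit.\<close>
  define k0 where "k0 = Suc k0'"
  have half: "(\<Sum>k\<in>{k0..k1}. exp (- e * real k)) \<le> 1 / 2" for k1
  proof -
    have "(\<Sum>k\<in>{k0..k1}. exp (- e * real k)) = (\<Sum>k\<in>{k0..<Suc k1}. exp (- e * real k))"
      by (simp only: atLeastLessThanSuc_atLeastAtMost)
    also have "\<dots> \<le> 1 / 2" using k0'[of k0 "Suc k1"] by (simp add: k0_def)
    finally show ?thesis .
  qed
  \<comment> \<open>Almost every point is heavy for some \<open>k \<ge> k0\<close>, so finitely many
    block lengths already capture all but \<open>\<eta> / 2\<close> of the mass.\<close>
  have "(\<lambda>n. measure M (\<Union>k\<in>{k0..n}. heavy e k)) \<longlonglongrightarrow> measure M (\<Union>n. \<Union>k\<in>{k0..n}. heavy e k)"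
      proof (rule finite_Lim_measure_incseq)
    show "incseq (\<lambda>n. \<Union>k\<in>{k0..n}. heavy e k)"
      by (rule incseq_SucI, rule UN_mono) auto
  qed auto
  also have "measure M (\<Union>n. \<Union>k\<in>{k0..n}. heavy e k) = 1"
  proof (subst prob_eq_1)
    show "AE z in M. z \<in> (\<Union>n. \<Union>k\<in>{k0..n}. heavy e k)"
      using heavy by eventually_elim fastforce
  qed auto
  finally have "eventually (\<lambda>n. 1 - \<eta> / 2 < measure M (\<Union>k\<in>{k0..n}. heavy e k)) sequentially"
    using eta by (intro order_tendstoD) auto
  then obtain k1 where k1: "1 - \<eta> / 2 < measure M (\<Union>k\<in>{k0..k1}. heavy e k)"
    by (auto simp: eventually_sequentially)
  define G where "G = (\<Union>k\<in>{k0..k1}. heavy e k)"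
  have G [measurable]: "G \<in> sets M" by (auto simp: G_def)
  have freq: "AE z in M. eventually (\<lambda>k. real (card {i. i < 2 ^ k \<and> (T ^^ i) z \<notin> G}) \<le> \<eta> * 2 ^ k) sequentially"
  proof (rule AE_visit_frequency[OF G])
    show "\<exists>d>0. nball z d \<subseteq> G" if zG: "z \<in> G" for z
    proof -
      obtain k where k: "k \<in> {k0..k1}" "z \<in> heavy e k" using zG unfolding G_def by auto
      from heavy_open[OF k(2)] obtain d where "d > 0" "nball z d \<subseteq> heavy e k" by blast
      moreover have "heavy e k \<subseteq> G" using k(1) unfolding G_def by (rule UN_upper)
      ultimately show ?thesis by blast
    qed
    show "measure M (space M - G) < \<eta> / 2" using k1 by (simp add: prob_compl G_def)
  qed
  have k01: "1 \<le> k0" by (simp add: k0_def)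
  obtain W where W1: "1 \<le> W" and W2: "\<And>N b. coverable N (visits (\<Union>k\<in>{k0..k1}. heavy e k) N b)
      (W * exp (2 * e * real N) * (2 * P) ^ b)"
    by (rule coverable_visits[OF e k01 half[of k1] S0 P_def]) (rule that; assumption)
  note W = W1 W2[folded G_def]
  define N :: "nat \<Rightarrow> nat" where "N j = 2 ^ j" for j
  define b where "b j = nat \<lfloor>\<eta> * 2 ^ j\<rfloor>" for j :: nat
  \<comment> \<open>The 4 is made up of 2 for the blocks, 1 for the single steps and 1 for
    summability.\<close>
  define t where "t j = exp (- 4 * e * 2 ^ j)" for j :: nat
  have "\<forall>j. \<exists>E. E \<in> sets M \<and> {z \<in> visits G (N j) (b j). measure M (nball z (D / 2 ^ N j)) < t j} \<subseteq> E \<and>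
      measure M E \<le> (W * exp (2 * e * real (N j)) * (2 * P) ^ b j) * t j"
  proof
    fix j
    show "\<exists>E. E \<in> sets M \<and> {z \<in> visits G (N j) (b j). measure M (nball z (D / 2 ^ N j)) < t j} \<subseteq> E \<and>
      measure M E \<le> (W * exp (2 * e * real (N j)) * (2 * P) ^ b j) * t j"
    proof (rule light_points_measure[OF W(2)[of "N j" "b j"], of D "t j"])
      show "0 \<le> t j" by (simp add: t_def)
      show "dist (\<phi> x) (\<phi> y) < D" if "x \<in> space M" "y \<in> space M" for x y
        using that by (rule D)
      fix E' assume "E' \<in> sets M" "{z \<in> visits G (N j) (b j). measure M (nball z (D / 2 ^ N j)) < t j} \<subseteq> E'"
        "measure M E' \<le> (W * exp (2 * e * real (N j)) * (2 * P) ^ b j) * t j"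
      then show ?thesis by blast
    qed
  qed
  from choice[OF this] obtain E where E: "\<And>j. E j \<in> sets M"
    "\<And>j. {z \<in> visits G (N j) (b j). measure M (nball z (D / 2 ^ N j)) < t j} \<subseteq> E j"
    "\<And>j. measure M (E j) \<le> (W * exp (2 * e * real (N j)) * (2 * P) ^ b j) * t j"
    by auto
  have bound: "measure M (E j) \<le> W * exp (- e) ^ j" for j
  proof -
    have "(2 * P) ^ b j = exp (real (b j) * ln (2 * P))"
      using P by (simp add: exp_of_nat_mult)
    also have "\<dots> \<le> exp (\<eta> * 2 ^ j * ln (2 * P))"
    proof -
      have "real (b j) \<le> \<eta> * 2 ^ j" using eta unfolding b_def by (intro of_nat_floor) auto
      then show ?thesis using lnP by (simp add: mult_right_mono)
    qed
    also have "\<eta> * 2 ^ j * ln (2 * P) = e * 2 ^ j" using lnP by (simp add: \<eta>_def)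
    finally have P2: "(2 * P) ^ b j \<le> exp (e * 2 ^ j)" .
    have "measure M (E j) \<le> (W * exp (2 * e * real (N j)) * (2 * P) ^ b j) * t j" by (rule E(3))
    also have "\<dots> \<le> (W * exp (2 * e * real (N j)) * exp (e * 2 ^ j)) * t j"
      using P2 W(1) by (intro mult_right_mono mult_left_mono) (auto simp: t_def)
    also have "\<dots> = W * (exp (2 * e * 2 ^ j) * exp (e * 2 ^ j) * exp (- 4 * e * 2 ^ j))"
      by (simp add: t_def N_def)
    also have "exp (2 * e * 2 ^ j) * exp (e * 2 ^ j) * exp (- 4 * e * 2 ^ j) = exp (- e * 2 ^ j)"
      by (simp only: exp_add[symmetric]) (simp add: algebra_simps)
    also have "exp (- e * 2 ^ j) \<le> exp (real j * (- e))"
    proof -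
      have "real j \<le> 2 ^ j" using of_nat_less_two_power[of j] by (simp add: less_imp_le)
      then show ?thesis using e by (simp add: mult.commute)
    qed
    also have "exp (real j * (- e)) = exp (- e) ^ j" by (rule exp_of_nat_mult)
    finally show ?thesis using W(1) by simp
  qed
  have "summable (\<lambda>j. W * exp (- e) ^ j)" using e by (intro summable_mult summable_geometric) auto
  then have "summable (\<lambda>j. measure M (E j))"
    by (rule summable_comparison_test'[of _ 0]) (use bound in auto)
  then have "AE z in M. eventually (\<lambda>j. z \<notin> E j) sequentially"
    by (intro AE_eventually_notin E)
  with freq AE_space show ?thesis
  proof eventually_elim
    case (elim z)
    from elim(1,3) show ?case
    proof eventually_elim
      case (elim j)
      have "card {i. i < N j \<and> (T ^^ i) z \<notin> G} \<le> b j"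
        using elim(1) by (simp add: N_def b_def le_nat_floor)
      then have "z \<in> visits G (N j) (b j)" using \<open>z \<in> space M\<close> by (simp add: visits_def)
      then have "\<not> measure M (nball z (D / 2 ^ N j)) < t j" using E(2)[of j] elim(2) by blast
      then show ?case by (simp add: N_def t_def)
    qed
  qed
qed

section \<open>From special scales to all radii, and the dichotomy\<close>

lemma phi_distance_bound:
  obtains D where "0 < D" "\<And>x y. x \<in> space M \<Longrightarrow> y \<in> space M \<Longrightarrow> dist (\<phi> x) (\<phi> y) < D"
proof -
  obtain B where B: "\<And>x y. x \<in> \<phi> ` space M \<Longrightarrow> y \<in> \<phi> ` space M \<Longrightarrow> dist x y \<le> B"
    using phi_bounded unfolding bounded_two_points by blast
  have "dist (\<phi> x) (\<phi> y) < max 0 B + 1" if "x \<in> space M" "y \<in> space M" for x y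
    using B[of "\<phi> x" "\<phi> y"] that by auto
  then show ?thesis by (intro that[of "max 0 B + 1"]) auto
qed

text \<open>At radius about \<open>L ^ k\<close> in the denominator, \<open>exp (- k / m)\<close> is
  a power of the radius with exponent \<open>1 / (m * ln L)\<close>. Half of that exponent is given
  away to absorb \<open>\<delta> / 4\<close> and the rounding between neighbouring scales.\<close>

lemma ball_bound_of_not_heavy:
  assumes m: "0 < m" and K: "\<And>k. k \<ge> K \<Longrightarrow> z \<notin> heavy (1 / real m) k" and z: "z \<in> space M"
  shows "\<exists>b>0. eventually (\<lambda>r. measure M (nball z r) \<le> r powr b) (at_right 0)"
proof -
  define b where "b = 1 / (2 * real m * ln L)"
  have lnL: "0 < ln L" using L_gt1 by simp
  have b: "0 < b" using m lnL by (simp add: b_def)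
  define q where "q = (\<delta> / 4) powr b"
  have q: "0 < q" using delta_pos by (simp add: q_def)
  have "filterlim (\<lambda>k. real k / (2 * real m) + ln q) at_top sequentially"
    using m by real_asymp
  then have "eventually (\<lambda>k. 1 / real m \<le> real k / (2 * real m) + ln q) sequentially"
    by (simp add: filterlim_at_top)
  then obtain K' where K': "\<And>k. k \<ge> K' \<Longrightarrow> 1 / real m \<le> real k / (2 * real m) + ln q"
    by (auto simp: eventually_sequentially)
  define K2 where "K2 = max (Suc K) K'"
  have "measure M (nball z r) \<le> r powr b" if r: "0 < r" "r < scale K2" for r
  proof -
    have "scale K2 \<le> \<delta> / 4" using L_gt1 delta_pos by (simp add: scale_def divide_le_eq one_le_power)
    then have "r \<le> \<delta> / 4" using r by simp
    from geometric_scale[OF r(1) this L_gt1] obtain k where k: "\<delta> / 4 / L ^ k \<le> r" "r < \<delta> / 4 * L / L ^ k"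
      by blast
    have "\<delta> / 4 / L ^ k < \<delta> / 4 / L ^ K2" using k r by (simp add: scale_def)
    then have "L ^ K2 < L ^ k" using delta_pos L_gt1 by (simp add: field_simps)
    then have kK: "K2 < k" using L_gt1 by simp
    then obtain j where j: "k = Suc j" by (cases k) auto
    have jK: "K \<le> j" "K' \<le> k" using kK j by (auto simp: K2_def)
    have "measure M (nball z r) \<le> measure M (nball z (scale j))"
      using k j L_gt1 by (intro finite_measure_mono nball_mono) (auto simp: scale_def)
    also have "\<dots> \<le> exp (- (1 / real m) * real j)"
      using K[OF jK(1)] z by (simp add: heavy_def)
    also have "\<dots> \<le> exp (ln q - real k / (2 * real m))"
    proof -
      have "real k / real m = real k / (2 * real m) + real k / (2 * real m)" using m by (simp add: field_simps)
      moreover have "real j / real m = real k / real m - 1 / real m" using j by (simp add: diff_divide_distrib[symmetric])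
      ultimately have "- (real j / real m) \<le> ln q - real k / (2 * real m)" using K'[OF jK(2)] by linarith
      then show ?thesis by simp
    qed
    also have "\<dots> = (\<delta> / 4 / L ^ k) powr b"
    proof -
      have "(\<delta> / 4 / L ^ k) powr b = q / (L ^ k) powr b"
        using delta_pos L_gt1 by (simp add: q_def powr_divide powr_mult)
      also have "(L ^ k) powr b = exp (real k / (2 * real m))"
        using L_gt1 lnL by (simp add: powr_def ln_realpow b_def)
      finally show ?thesis using q by (simp add: exp_diff)
    qed
    also have "\<dots> \<le> r powr b" using k b delta_pos L_gt1 by (intro powr_mono2) auto
    finally show ?thesis .
  qed
  then have "eventually (\<lambda>r. measure M (nball z r) \<le> r powr b) (at_right 0)"
    using scale_pos[of K2] unfolding eventually_at_right_field by blast
  with b show ?thesis by blast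
qed

text \<open>The exponents \<open>2 ^ j\<close> are sparse, but the least one above \<open>N\<close>
  is at most \<open>2 * N\<close>. Rounding the radius therefore only doubles the rate, which is
  harmless because \<open>m\<close> is arbitrary.\<close>

lemma ball_bound_of_lower_bound:
  assumes D: "0 < D" and m: "\<And>m. 0 < m \<Longrightarrow>
      eventually (\<lambda>j. exp (- 4 * (1 / real m) * 2 ^ j) \<le> measure M (nball z (D / 2 ^ (2 ^ j)))) sequentially"
    and e: "0 < e"
  shows "eventually (\<lambda>r. r powr e \<le> measure M (nball z r)) (at_right 0)"
proof -
  \<comment> \<open>After rounding the rate is \<open>8 / m\<close>; it is to use at most half of
    \<open>e * ln 2\<close>, the other half absorbs the constant \<open>q\<close>.\<close>
  obtain m :: nat where m': "16 / (e * ln 2) < real m" using reals_Archimedean2 by blast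
  moreover have "0 \<le> 16 / (e * ln 2)" using e by simp
  ultimately have "0 < real m" by linarith
  then have m0: "0 < m" by simp
  have m8: "8 / real m \<le> e * ln 2 / 2" using m' e m0 by (simp add: field_simps)
  obtain J where J: "\<And>j. j \<ge> J \<Longrightarrow> exp (- 4 * (1 / real m) * 2 ^ j) \<le> measure M (nball z (D / 2 ^ (2 ^ j)))"
    using m[OF m0] by (auto simp: eventually_sequentially)
  define q where "q = ln (2 * D) * e"
  have "filterlim (\<lambda>N. real N * (e * ln 2 / 2)) at_top sequentially"
    using e by real_asymp
  then have "eventually (\<lambda>N. q \<le> real N * (e * ln 2 / 2)) sequentially"
    by (simp add: filterlim_at_top)
  then obtain K where K: "\<And>N. N \<ge> K \<Longrightarrow> q \<le> real N * (e * ln 2 / 2)"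
    by (auto simp: eventually_sequentially)
  \<comment> \<open>The bound \<open>2 ^ J\<close> forces the rounded index \<open>j\<close> to be
    at least \<open>J\<close>; \<open>K\<close> makes \<open>N\<close> large enough to absorb
    \<open>q\<close>.\<close>
  define K2 where "K2 = max 1 (max K (2 ^ J))"
  have "r powr e \<le> measure M (nball z r)" if r: "0 < r" "r < D / 2 ^ K2" for r
  proof -
    have "D / 2 ^ K2 \<le> D" using D by (simp add: divide_le_eq)
    then have "r \<le> D" using r by simp
    from geometric_scale[OF r(1) this, of 2] obtain N where N: "D / 2 ^ N \<le> r" "r < D * 2 / 2 ^ N"
      by auto
    have "D / 2 ^ N < D / 2 ^ K2" using N r by simp
    then have "(2::real) ^ K2 < 2 ^ N" using D by (simp add: field_simps)
    then have NK: "K2 < N" by simp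
    define P where "P j \<longleftrightarrow> N \<le> 2 ^ j" for j :: nat
    have "P N" by (simp add: P_def less_imp_le)
    define j where "j = (LEAST j. P j)"
    have Pj: "P j" unfolding j_def using \<open>P N\<close> by (rule LeastI)
    have "J \<le> j"
    proof (rule ccontr)
      assume "\<not> J \<le> j"
      then have "(2::nat) ^ j \<le> 2 ^ J" by (intro power_increasing) auto
      moreover have "2 ^ J < N" using NK by (simp add: K2_def)
      ultimately show False using Pj unfolding P_def by linarith
    qed
    have j2: "2 ^ j \<le> 2 * real N"
    proof (cases j)
      case 0
      then show ?thesis using NK by (simp add: K2_def)
    next
      case (Suc i)
      then have "\<not> P i" unfolding j_def using not_less_Least by (metis lessI)
      then have "2 ^ i < N" by (simp add: P_def)
      then have "real (2 ^ i) < real N" by (simp only: of_nat_less_iff)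
      then show ?thesis using Suc by simp
    qed
    have "r powr e \<le> (2 * D / 2 ^ N) powr e"
      using N r e by (intro powr_mono2) (auto simp: mult.commute)
    also have "\<dots> = exp (q - real N * (e * ln 2))"
      using D by (simp add: powr_def q_def ln_div ln_realpow algebra_simps)
    also have "\<dots> \<le> exp (- 4 * (1 / real m) * 2 ^ j)"
    proof -
      have "4 / real m * 2 ^ j \<le> 4 / real m * (2 * real N)" using j2 by (intro mult_left_mono) auto
      also have "\<dots> = real N * (8 / real m)" by simp
      also have "\<dots> \<le> real N * (e * ln 2 / 2)" using m8 by (intro mult_left_mono) auto
      finally have "4 / real m * 2 ^ j \<le> real N * (e * ln 2 / 2)" .
      moreover have "q \<le> real N * (e * ln 2 / 2)" using K[of N] NK by (simp add: K2_def)
      moreover have "real N * (e * ln 2) = real N * (e * ln 2 / 2) + real N * (e * ln 2 / 2)" by simp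
      ultimately have "q - real N * (e * ln 2) \<le> - (4 / real m * 2 ^ j)" by linarith
      then show ?thesis by simp
    qed
    also have "\<dots> \<le> measure M (nball z (D / 2 ^ (2 ^ j)))" by (rule J[OF \<open>J \<le> j\<close>])
    also have "\<dots> \<le> measure M (nball z r)"
    proof (intro finite_measure_mono nball_mono)
      have "(2::real) ^ N \<le> 2 ^ (2 ^ j)" using Pj by (intro power_increasing) (auto simp: P_def)
      then have "D / 2 ^ (2 ^ j) \<le> D / 2 ^ N" using D by (intro divide_left_mono) auto
      then show "D / 2 ^ (2 ^ j) \<le> r" using N by linarith
    qed auto
    finally show ?thesis .
  qed
  moreover have "0 < D / 2 ^ K2" using D by simp
  ultimately show ?thesis unfolding eventually_at_right_field by blast
qed

text \<open>A discrete form of vanishing lower local dimension: only dynamical scales and rates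
  \<open>1 / m\<close> are tested, which keeps all quantifiers countable.\<close>

definition recurrent_heavy :: "'a set" where
  "recurrent_heavy = {z \<in> space M. \<forall>m>0. \<forall>k0. \<exists>k\<ge>k0. z \<in> heavy (1 / real m) k}"

text \<open>\<open>T\<close> maps the ball of radius \<open>scale (k + 1)\<close> about \<open>z\<close> into the ball of radius \<open>scale k\<close> about
  \<open>T z\<close>, so invariance of the measure makes heaviness survive up to a factor 2 in the exponent.\<close>

lemma recurrent_heavy_invariant:
  assumes z: "z \<in> recurrent_heavy"
  shows "T z \<in> recurrent_heavy"
proof -
  have zs: "z \<in> space M" using z by (simp add: recurrent_heavy_def)
  have Tz: "T z \<in> space M" using zs T_meas measurable_space by metis
  have "\<exists>k\<ge>k0. T z \<in> heavy (1 / real m) k" if m: "0 < m" for m k0 :: nat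
  proof -
    have "0 < 2 * m" using m by simp
    then obtain k where k: "k \<ge> k0 + 2" "z \<in> heavy (1 / real (2 * m)) k"
      using z unfolding recurrent_heavy_def by blast
    \<comment> \<open>From \<open>j \<ge> 1\<close> follows \<open>k \<le> 2 * j\<close>; passing
      from \<open>2 * m\<close> to \<open>m\<close> pays for this.\<close>
    then obtain j where j: "k = Suc j" "j \<ge> k0" "j \<ge> 1" by (cases k) auto
    have "exp (- (1 / real m) * real j) \<le> exp (- (1 / real (2 * m)) * real k)"
      using m j by (simp add: field_simps)
    also have "\<dots> < measure M (nball z (scale k))" using k by (simp add: heavy_def)
    also have "\<dots> \<le> measure M (T -` nball (T z) (scale j) \<inter> space M)"
    proof (rule finite_measure_mono)
      show "nball z (scale k) \<subseteq> T -` nball (T z) (scale j) \<inter> space M"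
      proof
        fix w assume w: "w \<in> nball z (scale k)"
        then have ws: "w \<in> space M" by (simp add: nball_def)
        have "dist (\<phi> (T z)) (\<phi> (T w)) \<le> L * dist (\<phi> z) (\<phi> w)" by (rule T_Lipschitz[OF zs ws])
        also have "\<dots> < L * scale k" using w L_gt1 by (intro mult_strict_left_mono) (auto simp: nball_def)
        also have "\<dots> = scale j" using L_gt1 by (simp add: scale_def j)
        finally show "w \<in> T -` nball (T z) (scale j) \<inter> space M"
          using ws measurable_space[OF T_meas ws] by (simp add: nball_def)
      qed
    qed measurable
    also have "\<dots> = measure M (nball (T z) (scale j))"
      using measure_distr[OF T_meas, of "nball (T z) (scale j)"] by (simp add: T_inv)
    finally show ?thesis using j Tz by (auto simp: heavy_def)
  qed
  then show ?thesis using Tz by (auto simp: recurrent_heavy_def)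
qed

text \<open>Heaviness depends on \<open>z\<close> only through the ball about
  \<open>\<phi> z\<close> for the image measure, so it is a Borel condition on
  \<open>\<phi> z\<close>, as the zero-one law demands.\<close>

lemma recurrent_heavy_vimage:
  obtains A' where "A' \<in> sets borel" "recurrent_heavy = \<phi> -` A' \<inter> space M"
proof -
  define N where "N = distr M borel \<phi>"
  interpret N: prob_space N unfolding N_def by (rule prob_space_distr) simp
  have sN [measurable_cong]: "sets N = sets borel" by (simp add: N_def)
  have meas [measurable]: "(\<lambda>y. measure N (ball y r)) \<in> borel_measurable borel" for r
  proof -
    have "{p \<in> space (borel \<Otimes>\<^sub>M N). dist (fst p) (snd p) < r} \<in> sets (borel \<Otimes>\<^sub>M N)"
      by measurable
    from N.measurable_emeasure_Pair[OF this]
    have "(\<lambda>y. enn2real (emeasure N (Pair y -` {p \<in> space (borel \<Otimes>\<^sub>M N). dist (fst p) (snd p) < r}))) \<in> borel_measurable borel"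
      by measurable
    then show ?thesis
      by (rule measurable_cong[THEN iffD1, rotated])
        (auto simp: ball_def measure_def space_pair_measure N_def intro!: arg_cong[where f="\<lambda>A. enn2real (emeasure _ A)"])
  qed
  have eq: "measure M (nball z r) = measure N (ball (\<phi> z) r)" for z r
    by (auto simp: N_def measure_distr nball_def intro!: arg_cong[where f="measure M"])
  define A' where "A' = {y. \<forall>m>0. \<forall>k0. \<exists>k\<ge>k0. exp (- (1 / real m) * real k) < measure N (ball y (scale k))}"
  have "A' = {y \<in> space borel. \<forall>m>0. \<forall>k0. \<exists>k\<ge>k0. exp (- (1 / real m) * real k) < measure N (ball y (scale k))}"
    by (simp add: A'_def)
  also have "\<dots> \<in> sets borel" by measurable
  finally have "A' \<in> sets borel" .
  moreover have "recurrent_heavy = \<phi> -` A' \<inter> space M"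
    by (auto simp: recurrent_heavy_def heavy_def A'_def eq)
  ultimately show ?thesis using that by blast
qed

theorem ball_measure_dichotomy:
  "(AE z in M. \<exists>b>0. eventually (\<lambda>r. measure M (nball z r) \<le> r powr b) (at_right 0)) \<or>
   (AE z in M. \<forall>e>0. eventually (\<lambda>r. r powr e \<le> measure M (nball z r)) (at_right 0))"
proof -
  obtain A' where A': "A' \<in> sets borel" "recurrent_heavy = \<phi> -` A' \<inter> space M"
    by (rule recurrent_heavy_vimage)
  then have meas: "recurrent_heavy \<in> sets M" using phi_meas by (auto dest: measurable_sets)
  consider "measure M recurrent_heavy = 0" | "measure M recurrent_heavy = 1"
    using zero_one_law[OF A' recurrent_heavy_invariant] by blast
  then show ?thesis
  proof cases
    case 1
    have "AE z in M. z \<notin> recurrent_heavy"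
      using 1 meas by (simp add: prob_eq_0)
    with AE_space have "AE z in M. \<exists>b>0. eventually (\<lambda>r. measure M (nball z r) \<le> r powr b) (at_right 0)"
    proof eventually_elim
      case (elim z)
      then obtain m k0 where "0 < m" "\<And>k. k \<ge> k0 \<Longrightarrow> z \<notin> heavy (1 / real m) k"
        unfolding recurrent_heavy_def by blast
      then show ?case using ball_bound_of_not_heavy elim(1) by blast
    qed
    then show ?thesis ..
  next
    case 2
    have AE: "AE z in M. z \<in> recurrent_heavy" using 2 meas by (simp add: prob_eq_1)
    obtain D where D: "0 < D" "\<And>x y. x \<in> space M \<Longrightarrow> y \<in> space M \<Longrightarrow> dist (\<phi> x) (\<phi> y) < D"
      by (rule phi_distance_bound) (rule that; assumption)
    \<comment> \<open>The exceptional null set must not depend on the rate, hence the restriction to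
      the countably many rates \<open>1 / m\<close>.\<close>
    have "AE z in M. \<forall>m. 0 < m \<longrightarrow>
      eventually (\<lambda>j. exp (- 4 * (1 / real m) * 2 ^ j) \<le> measure M (nball z (D / 2 ^ (2 ^ j)))) sequentially"
      unfolding AE_all_countable
    proof (intro allI)
      fix m :: nat
      show "AE z in M. 0 < m \<longrightarrow>
        eventually (\<lambda>j. exp (- 4 * (1 / real m) * 2 ^ j) \<le> measure M (nball z (D / 2 ^ (2 ^ j)))) sequentially"
      proof (cases "0 < m")
        case True
        have "AE z in M. \<forall>k0. \<exists>k\<ge>k0. z \<in> heavy (1 / real m) k"
          using AE by eventually_elim (use True in \<open>auto simp: recurrent_heavy_def\<close>)
        from AE_ball_lower_bound[OF _ this D(2)] show ?thesis using True by auto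
      qed auto
    qed
    then have "AE z in M. \<forall>e>0. eventually (\<lambda>r. r powr e \<le> measure M (nball z r)) (at_right 0)"
      by eventually_elim (use ball_bound_of_lower_bound[OF D(1)] in blast)
    then show ?thesis ..
  qed
qed

end

section \<open>Recurrence rates and local dimensions\<close>

text \<open>Used on a supposed gap between a rate and a dimension. Rational endpoints let a
  countable family of almost-everywhere statements serve all points, and three of them leave strict
  room on every side.\<close>

lemma ereal_between_rats:
  fixes x y :: ereal
  assumes "x < y" "0 \<le> x"
  obtains a b c :: rat where "0 < a" "x < ereal (of_rat a)" "a < b" "b < c" "ereal (of_rat c) < y"
proof -
  obtain c :: rat where c: "x < ereal (of_rat c)" "ereal (of_rat c) < y"
    using ereal_dense3[OF assms(1)] by auto
  obtain b :: rat where b: "x < ereal (of_rat b)" "ereal (of_rat b) < ereal (of_rat c)"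
    using ereal_dense3[OF c(1)] by auto
  obtain a :: rat where a: "x < ereal (of_rat a)" "ereal (of_rat a) < ereal (of_rat b)"
    using ereal_dense3[OF b(1)] by auto
  have "0 < ereal (of_rat a)" using assms(2) a(1) by (rule le_less_trans)
  then have "0 < a" by simp
  with a b c that show ?thesis by (simp add: of_rat_less)
qed

lemma eventually_at_right_unit: "eventually (\<lambda>r::real. 0 < r \<and> r < 1) (at_right 0)"
  unfolding eventually_at_right_field by (intro exI[of _ 1]) auto

context mixing_system
begin

section \<open>Exponents at a fixed radius\<close>

definition ball_exponent :: "'a \<Rightarrow> real \<Rightarrow> ereal" where
  "ball_exponent z r = ereal_log (ereal (measure M (nball z r))) / ereal (ln r)"

definition return_time :: "real \<Rightarrow> 'a \<Rightarrow> enat" where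
  "return_time r z = Inf {enat n | n. n \<ge> 1 \<and> (T ^^ n) z \<in> nball z r}"

definition return_exponent :: "'a \<Rightarrow> real \<Rightarrow> ereal" where
  "return_exponent z r = ereal_log (ereal_of_enat (return_time r z)) / ereal (- ln r)"

lemma ball_exponent_eq:
  assumes "measure M (nball z r) > 0" "ln r \<noteq> 0"
  shows "ball_exponent z r = ereal (ln (measure M (nball z r)) / ln r)"
  using assms by (auto simp: ball_exponent_def ereal_log_def)

lemma measure_le_of_ball_exponent:
  assumes r: "0 < r" "r < 1" and b: "ereal b < ball_exponent z r"
  shows "measure M (nball z r) \<le> r powr b"
proof (cases "measure M (nball z r) > 0")
  case True
  have lnr: "ln r < 0" using r by simp
  have "b < ln (measure M (nball z r)) / ln r" using b lnr by (simp add: ball_exponent_eq[OF True])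
  then have "ln (measure M (nball z r)) < b * ln r" using lnr by (simp add: less_divide_eq)
  then have "exp (ln (measure M (nball z r))) \<le> exp (b * ln r)" by simp
  then show ?thesis using True r by (simp add: powr_def)
next
  case False
  then have "measure M (nball z r) = 0" using measure_nonneg[of M "nball z r"] by linarith
  then show ?thesis by simp
qed

lemma ball_exponent_le:
  assumes r: "0 < r" "r < 1" and b: "r powr b \<le> measure M (nball z r)"
  shows "ball_exponent z r \<le> ereal b"
proof -
  have "0 < r powr b" using r by simp
  then have pos: "measure M (nball z r) > 0" using b by linarith
  have lnr: "ln r < 0" using r by simp
  have "ln (r powr b) \<le> ln (measure M (nball z r))" by (rule ln_mono[OF b \<open>0 < r powr b\<close>])
  moreover have "ln (r powr b) = b * ln r" using r by (simp add: ln_powr)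
  ultimately have "b * ln r \<le> ln (measure M (nball z r))" by linarith
  then have "ln (measure M (nball z r)) / ln r \<le> b" using lnr by (simp add: divide_le_eq)
  then show ?thesis using lnr by (simp add: ball_exponent_eq[OF pos])
qed

text \<open>An infinite return time has exponent \<open>\<infinity>\<close>, so only finite values
  need a hypothesis. The condition \<open>0 < n\<close> keeps \<open>ereal_log\<close> away from its
  value at 0.\<close>

lemma return_exponent_ge:
  assumes r: "0 < r" "r < 1" and n: "\<And>n. enat n = return_time r z \<Longrightarrow> r powr (- a) \<le> real n \<and> 0 < n"
  shows "ereal a \<le> return_exponent z r"
proof (cases "return_time r z")
  case (enat n)
  have lnr: "ln r < 0" using r by simp
  have n': "r powr (- a) \<le> real n" "0 < n" using n enat by auto
  have "ln (r powr (- a)) \<le> ln (real n)" by (rule ln_mono[OF n'(1)]) (use r in simp)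
  moreover have "ln (r powr (- a)) = - a * ln r" using r by (simp add: ln_powr)
  ultimately have "- a * ln r \<le> ln (real n)" by linarith
  then have "a \<le> ln (real n) / (- ln r)" using lnr by (simp add: le_divide_eq field_simps)
  moreover have "return_exponent z r = ereal (ln (real n) / (- ln r))"
    using n' lnr enat by (simp add: return_exponent_def ereal_log_def)
  ultimately show ?thesis by simp
next
  case infinity
  have "0 < - ln r" using r by simp
  then show ?thesis using infinity by (simp add: return_exponent_def ereal_log_def divide_ereal_def)
qed

lemma return_time_enat:
  assumes "enat n = return_time r z"
  shows "1 \<le> n" "(T ^^ n) z \<in> nball z r"
proof -
  let ?S = "{enat n | n. n \<ge> 1 \<and> (T ^^ n) z \<in> nball z r}"
  have "?S \<noteq> {}"
  proof
    assume "?S = {}"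
    then have "return_time r z = Inf {}" unfolding return_time_def by (rule arg_cong)
    then show False using assms by (simp add: Inf_enat_def)
  qed
  then obtain k where "k \<in> ?S" by blast
  then have "(LEAST x. x \<in> ?S) \<in> ?S" by (rule LeastI)
  then have "Inf ?S \<in> ?S" unfolding Inf_enat_def using \<open>?S \<noteq> {}\<close> by (simp only: if_False)
  then show "1 \<le> n" "(T ^^ n) z \<in> nball z r" using assms by (auto simp: return_time_def)
qed

text \<open>Return times are at least 1. This makes the lower end of a gap nonnegative, so that the
  exponents chosen inside it are positive.\<close>

lemma return_exponent_nonneg:
  assumes "0 < r" "r < 1"
  shows "0 \<le> return_exponent z r"
proof -
  have "ereal 0 \<le> return_exponent z r"
  proof (rule return_exponent_ge[OF assms])
    fix n assume "enat n = return_time r z"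
    from return_time_enat(1)[OF this] show "r powr (- 0) \<le> real n \<and> 0 < n" using assms by simp
  qed
  then show ?thesis by (simp add: zero_ereal_def)
qed

end

context superpoly_mixing_system
begin

lemma slow_return_exponent:
  assumes "0 < r" "r < 1" "slow_return a z r"
  shows "ereal a \<le> return_exponent z r"
proof (rule return_exponent_ge[OF assms(1,2)])
  fix n assume n: "enat n = return_time r z"
  note rt = return_time_enat[OF n]
  have "\<not> real n \<le> r powr (- a)"
    using rt assms(3) by (auto simp: slow_return_def nball_def dist_commute)
  then show "r powr (- a) \<le> real n \<and> 0 < n" using rt by simp
qed

lemma AE_slow_return_rat:
  "AE z in M. \<forall>a b :: rat. 0 < a \<longrightarrow> a < b \<longrightarrow>
    eventually (small_balls (of_rat b) z) (at_right 0) \<longrightarrow> eventually (slow_return (of_rat a) z) (at_right 0)"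
  unfolding AE_all_countable
proof (intro allI)
  fix a b :: rat
  show "AE z in M. 0 < a \<longrightarrow> a < b \<longrightarrow>
    eventually (small_balls (of_rat b) z) (at_right 0) \<longrightarrow> eventually (slow_return (of_rat a) z) (at_right 0)"
    using AE_slow_return[of "of_rat a" "of_rat b"] by (cases "0 < a \<and> a < b") (auto simp: of_rat_less)
qed

theorem AE_lower_rate_ge_lower_dim:
  "AE z in M. Liminf (at_right 0) (ball_exponent z) \<le> Liminf (at_right 0) (return_exponent z)"
  using AE_slow_return_rat
proof eventually_elim
  case (elim z)
  show ?case
  proof (rule ccontr)
    assume "\<not> ?thesis"
    then have less: "Liminf (at_right 0) (return_exponent z) < Liminf (at_right 0) (ball_exponent z)" by simp
    have "0 \<le> Liminf (at_right 0) (return_exponent z)"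
      by (rule Liminf_bounded) (use eventually_at_right_unit in \<open>auto elim!: eventually_mono intro: return_exponent_nonneg\<close>)
    from ereal_between_rats[OF less this] obtain a b c :: rat
      where ab: "0 < a" "Liminf (at_right 0) (return_exponent z) < ereal (of_rat a)" "a < b" "b < c"
        "ereal (of_rat c) < Liminf (at_right 0) (ball_exponent z)" by metis
    have "eventually (\<lambda>r. ereal (of_rat c) < ball_exponent z r) (at_right 0)"
      by (rule less_LiminfD[OF ab(5)])
    with eventually_at_right_unit have "eventually (small_balls (of_rat c) z) (at_right 0)"
      by eventually_elim (auto simp: small_balls_def intro: measure_le_of_ball_exponent)
    then have "eventually (slow_return (of_rat a) z) (at_right 0)" using elim ab(1) less_trans[OF ab(3,4)] by blast
    with eventually_at_right_unit have "eventually (\<lambda>r. ereal (of_rat a) \<le> return_exponent z r) (at_right 0)"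
      by eventually_elim (auto intro: slow_return_exponent)
    then have "ereal (of_rat a) \<le> Liminf (at_right 0) (return_exponent z)" by (rule Liminf_bounded)
    then show False using ab(2) by simp
  qed
qed

text \<open>Two unrelated exponents are at work: \<open>a1\<close>, possibly tiny and dependent on
  the point, excludes early returns; \<open>b'\<close> and \<open>c\<close> lie in the supposed gap,
  and small balls of exponent \<open>c\<close> at arbitrarily small radii give slow returns of
  exponent \<open>b'\<close> there.\<close>

lemma AE_upper_rate_ge_upper_dim_if_small_balls:
  assumes small: "AE z in M. \<exists>b>0. eventually (\<lambda>r. measure M (nball z r) \<le> r powr b) (at_right 0)"
  shows "AE z in M. Limsup (at_right 0) (ball_exponent z) \<le> Limsup (at_right 0) (return_exponent z)"
proof -
  have B: "AE z in M. \<forall>a b' b :: rat. 0 < a \<longrightarrow> 0 < b' \<longrightarrow> b' < b \<longrightarrow>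
    eventually (slow_return (of_rat a) z) (at_right 0) \<longrightarrow>
    frequently (small_balls (of_rat b) z) (at_right 0) \<longrightarrow> frequently (slow_return (of_rat b') z) (at_right 0)"
    unfolding AE_all_countable
  proof (intro allI)
    fix a b' b :: rat
    show "AE z in M. 0 < a \<longrightarrow> 0 < b' \<longrightarrow> b' < b \<longrightarrow>
      eventually (slow_return (of_rat a) z) (at_right 0) \<longrightarrow>
      frequently (small_balls (of_rat b) z) (at_right 0) \<longrightarrow> frequently (slow_return (of_rat b') z) (at_right 0)"
      using AE_frequently_slow_return[of "of_rat a" "of_rat b'" "of_rat b"]
      by (cases "0 < a \<and> 0 < b' \<and> b' < b") (auto simp: of_rat_less)
  qed
  from small AE_slow_return_rat B show ?thesis
  proof eventually_elim
    case (elim z)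
    show ?case
    proof (rule ccontr)
      assume "\<not> ?thesis"
      then have less: "Limsup (at_right 0) (return_exponent z) < Limsup (at_right 0) (ball_exponent z)" by simp
      have "0 \<le> Liminf (at_right 0) (return_exponent z)"
        by (rule Liminf_bounded) (use eventually_at_right_unit in \<open>auto elim!: eventually_mono intro: return_exponent_nonneg\<close>)
      also have "\<dots> \<le> Limsup (at_right 0) (return_exponent z)"
        by (rule Liminf_le_Limsup) simp
      finally have nn: "0 \<le> Limsup (at_right 0) (return_exponent z)" .
      from ereal_between_rats[OF less nn] obtain b' b c :: rat
        where ab: "0 < b'" "Limsup (at_right 0) (return_exponent z) < ereal (of_rat b')" "b' < b" "b < c"
          "ereal (of_rat c) < Limsup (at_right 0) (ball_exponent z)" by metis
      obtain \<beta> :: real where \<beta>: "0 < \<beta>" "eventually (\<lambda>r. measure M (nball z r) \<le> r powr \<beta>) (at_right 0)"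
        using elim(1) by blast
      obtain a2 :: rat where a2: "0 < real_of_rat a2" "real_of_rat a2 < \<beta>" using of_rat_dense[OF \<beta>(1)] by blast
      obtain a1 :: rat where a1: "0 < a1" "a1 < a2" using dense[of 0 a2] a2 by auto
      from \<beta>(2) eventually_at_right_unit have "eventually (small_balls (of_rat a2) z) (at_right 0)"
      proof eventually_elim
        case (elim r)
        have "r powr \<beta> \<le> r powr of_rat a2" using elim a2 by (intro powr_mono') auto
        then show ?case using elim by (simp add: small_balls_def)
      qed
      then have slow: "eventually (slow_return (of_rat a1) z) (at_right 0)" using elim(2) a1 by blast
      have "frequently (small_balls (of_rat c) z) (at_right 0)"
      proof (rule ccontr)
        assume "\<not> ?thesis"
        then have "eventually (\<lambda>r. \<not> small_balls (of_rat c) z r) (at_right 0)"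
          by (simp add: frequently_def)
        with eventually_at_right_unit have "eventually (\<lambda>r. ball_exponent z r \<le> ereal (of_rat c)) (at_right 0)"
        proof eventually_elim
          case (elim r)
          then show ?case using measure_le_of_ball_exponent[of r "of_rat c" z] by (auto simp: small_balls_def not_less[symmetric])
        qed
        then have "Limsup (at_right 0) (ball_exponent z) \<le> ereal (of_rat c)" by (rule Limsup_bounded)
        then show False using ab(5) by simp
      qed
      then have freq: "frequently (slow_return (of_rat b') z) (at_right 0)"
        using elim(3) a1 ab slow by (meson less_trans)
      have "eventually (\<lambda>r. return_exponent z r < ereal (of_rat b')) (at_right 0)"
        by (rule Limsup_lessD[OF ab(2)])
      with eventually_at_right_unit have "eventually (\<lambda>r. \<not> slow_return (of_rat b') z r) (at_right 0)"
        by eventually_elim (use slow_return_exponent in \<open>force simp: not_less\<close>)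
      with freq show False by (simp add: frequently_def)
    qed
  qed
qed

text \<open>The upper local dimension is at most 0, while recurrence rates are at least 0.\<close>

lemma upper_dim_le_upper_rate_if_large_balls:
  assumes "\<And>e. 0 < e \<Longrightarrow> eventually (\<lambda>r. r powr e \<le> measure M (nball z r)) (at_right 0)"
  shows "Limsup (at_right 0) (ball_exponent z) \<le> Limsup (at_right 0) (return_exponent z)"
proof -
  have "Limsup (at_right 0) (ball_exponent z) \<le> 0 + ereal e" if e: "0 < e" for e
  proof (rule Limsup_bounded)
    show "eventually (\<lambda>r. ball_exponent z r \<le> 0 + ereal e) (at_right 0)"
      using assms[OF e] eventually_at_right_unit
      by eventually_elim (use ball_exponent_le in auto)
  qed
  then have "Limsup (at_right 0) (ball_exponent z) \<le> 0"
    by (rule ereal_le_epsilon2)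
  also have "0 \<le> Liminf (at_right 0) (return_exponent z)"
    by (rule Liminf_bounded) (use eventually_at_right_unit in \<open>auto elim!: eventually_mono intro: return_exponent_nonneg\<close>)
  also have "\<dots> \<le> Limsup (at_right 0) (return_exponent z)"
    by (rule Liminf_le_Limsup) simp
  finally show ?thesis .
qed

text \<open>Recurrence is studied for \<open>T\<close>, the dichotomy for the expanding iterate. The
  two fit together because the dichotomy speaks of measures of balls alone and the iterate preserves
  the same measure; its covariances decay like \<open>\<theta> (m * n)\<close>.\<close>

theorem AE_rates_ge_dims:
  assumes m: "1 \<le> m" and L: "1 < L" and d: "0 < \<delta>"
    and lip: "\<And>x y. x \<in> space M \<Longrightarrow> y \<in> space M \<Longrightarrow> dist (\<phi> ((T ^^ m) x)) (\<phi> ((T ^^ m) y)) \<le> L * dist (\<phi> x) (\<phi> y)"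
    and exp: "\<And>x y. x \<in> space M \<Longrightarrow> y \<in> space M \<Longrightarrow> dist (\<phi> x) (\<phi> y) < \<delta> \<Longrightarrow>
      2 * dist (\<phi> x) (\<phi> y) \<le> dist (\<phi> ((T ^^ m) x)) (\<phi> ((T ^^ m) y))"
  shows "AE z in M. Liminf (at_right 0) (ball_exponent z) \<le> Liminf (at_right 0) (return_exponent z) \<and>
    Limsup (at_right 0) (ball_exponent z) \<le> Limsup (at_right 0) (return_exponent z)"
proof -
  interpret F: expanding_mixing_system M "T ^^ m" \<phi> "\<lambda>n. \<theta> (m * n)" L \<delta>
  proof
    show "summable (\<lambda>n. \<theta> (m * n))"
    proof -
      obtain C where C: "0 \<le> C" "\<And>n. n \<ge> 1 \<Longrightarrow> \<theta> n \<le> C * real n powr (- 2)"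
        by (rule theta_bound[OF zero_less_numeral[of "Num.Bit0 Num.One"]]) (rule that; assumption)
      have bound: "norm (\<theta> (m * n)) \<le> C * real n powr (- 2)" if "n \<ge> 1" for n
      proof -
        have "1 \<le> m * n" using m that by simp
        then have "\<theta> (m * n) \<le> C * real (m * n) powr (- 2)" by (rule C(2))
        also have "\<dots> \<le> C * real n powr (- 2)"
        proof (intro mult_left_mono C(1) powr_mono2')
          have "n \<le> m * n" using m by simp
          then show "real n \<le> real (m * n)" by (simp only: of_nat_le_iff)
        qed (use that in auto)
        finally show ?thesis using theta_nonneg by simp
      qed
      have "summable (\<lambda>n. C * real n powr (- 2))"
        by (intro summable_mult) (simp add: summable_real_powr_iff)
      then show ?thesis using bound by (rule summable_comparison_test')
    qed
    fix K K' :: real and n :: nat and f g :: "'a \<Rightarrow> real"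
    assume "0 \<le> K" "0 \<le> K'" "1 \<le> n"
      "\<And>x y. x \<in> space M \<Longrightarrow> y \<in> space M \<Longrightarrow> \<bar>f x - f y\<bar> \<le> K * dist (\<phi> x) (\<phi> y)"
      "\<And>x y. x \<in> space M \<Longrightarrow> y \<in> space M \<Longrightarrow> \<bar>g x - g y\<bar> \<le> K' * dist (\<phi> x) (\<phi> y)"
    then show "\<bar>(\<integral>x. f (((T ^^ m) ^^ n) x) * g x \<partial>M) - (\<integral>x. f x \<partial>M) * (\<integral>x. g x \<partial>M)\<bar> \<le> K * K' * \<theta> (m * n)"
      using decay[of K K' "m * n" f g] m by (simp add: funpow_mult)
  qed (use phi_inj phi_bounded Tn_inv theta_nonneg L d lip exp in auto)
  from F.ball_measure_dichotomy
  have "AE z in M. Limsup (at_right 0) (ball_exponent z) \<le> Limsup (at_right 0) (return_exponent z)"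
  proof
    assume "AE z in M. \<exists>b>0. eventually (\<lambda>r. measure M (nball z r) \<le> r powr b) (at_right 0)"
    then show ?thesis by (rule AE_upper_rate_ge_upper_dim_if_small_balls)
  next
    assume "AE z in M. \<forall>e>0. eventually (\<lambda>r. r powr e \<le> measure M (nball z r)) (at_right 0)"
    then show ?thesis by eventually_elim (use upper_dim_le_upper_rate_if_large_balls in blast)
  qed
  with AE_lower_rate_ge_lower_dim show ?thesis by eventually_elim simp
qed

end

section \<open>Strict metric derivatives\<close>

text \<open>Two-point version of the scaling factor of a map, so that it also controls distances between
  points near \<open>x\<close> both of which differ from \<open>x\<close>.\<close>

definition metric_deriv :: "('a::metric_space \<Rightarrow> 'b::metric_space) \<Rightarrow> 'a \<Rightarrow> real \<Rightarrow> bool" where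
  "metric_deriv F x c \<longleftrightarrow>
     (\<forall>e>0. \<exists>d>0. \<forall>y\<in>ball x d. \<forall>z\<in>ball x d. \<bar>dist (F y) (F z) - c * dist y z\<bar> \<le> e * dist y z)"

lemma metric_derivD:
  assumes "metric_deriv F x c" "0 < e"
  obtains d where "0 < d" "\<And>y z. y \<in> ball x d \<Longrightarrow> z \<in> ball x d \<Longrightarrow> \<bar>dist (F y) (F z) - c * dist y z\<bar> \<le> e * dist y z"
  using assms unfolding metric_deriv_def by blast

lemma metric_deriv_local_Lipschitz:
  assumes "metric_deriv F x c"
  obtains d where "0 < d" "\<And>y z. y \<in> ball x d \<Longrightarrow> z \<in> ball x d \<Longrightarrow> dist (F y) (F z) \<le> (\<bar>c\<bar> + 1) * dist y z"
proof -
  obtain d where d: "0 < d" "\<And>y z. y \<in> ball x d \<Longrightarrow> z \<in> ball x d \<Longrightarrow> \<bar>dist (F y) (F z) - c * dist y z\<bar> \<le> 1 * dist y z"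
    by (rule metric_derivD[OF assms zero_less_one]) (rule that; assumption)
  have "dist (F y) (F z) \<le> (\<bar>c\<bar> + 1) * dist y z" if "y \<in> ball x d" "z \<in> ball x d" for y z
  proof -
    have "c * dist y z \<le> \<bar>c\<bar> * dist y z" by (intro mult_right_mono) auto
    then show ?thesis using d(2)[OF that] by (simp add: distrib_right)
  qed
  with d(1) that show ?thesis by blast
qed

lemma metric_deriv_isCont:
  assumes "metric_deriv F x c"
  shows "isCont F x"
proof -
  obtain d where d: "0 < d" "\<And>y z. y \<in> ball x d \<Longrightarrow> z \<in> ball x d \<Longrightarrow> dist (F y) (F z) \<le> (\<bar>c\<bar> + 1) * dist y z"
    by (rule metric_deriv_local_Lipschitz[OF assms]) (rule that; assumption)
  show ?thesis
    unfolding continuous_at_eps_delta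
  proof (intro allI impI)
    fix e :: real assume e: "0 < e"
    have "dist (F y) (F x) < e" if "dist y x < min d (e / (\<bar>c\<bar> + 1))" for y
    proof -
      have "dist (F y) (F x) \<le> (\<bar>c\<bar> + 1) * dist y x" using d that by (auto simp: dist_commute)
      also have "\<dots> < (\<bar>c\<bar> + 1) * (e / (\<bar>c\<bar> + 1))" using that by (intro mult_strict_left_mono) auto
      also have "\<dots> = e" by simp
      finally show ?thesis .
    qed
    then show "\<exists>d>0. \<forall>y. dist y x < d \<longrightarrow> dist (F y) (F x) < e"
      using e d(1) by (intro exI[of _ "min d (e / (\<bar>c\<bar> + 1))"]) auto
  qed
qed

lemma metric_deriv_transform:
  assumes F: "metric_deriv F x c" and ev: "eventually (\<lambda>y. G y = F y) (nhds x)"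
  shows "metric_deriv G x c"
  unfolding metric_deriv_def
proof (intro allI impI)
  fix e :: real assume e: "0 < e"
  obtain d where d: "0 < d" "\<And>y z. y \<in> ball x d \<Longrightarrow> z \<in> ball x d \<Longrightarrow> \<bar>dist (F y) (F z) - c * dist y z\<bar> \<le> e * dist y z"
    by (rule metric_derivD[OF F e]) (rule that; assumption)
  obtain d' where d': "0 < d'" "\<And>y. dist y x < d' \<Longrightarrow> G y = F y"
    using ev unfolding eventually_nhds_metric by blast
  show "\<exists>d>0. \<forall>y\<in>ball x d. \<forall>z\<in>ball x d. \<bar>dist (G y) (G z) - c * dist y z\<bar> \<le> e * dist y z"
    by (rule exI[of _ "min d d'"]) (use d d' in \<open>auto simp: dist_commute\<close>)
qed

lemma metric_deriv_compose:
  assumes F: "metric_deriv F x c" and G: "metric_deriv G (F x) c'"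
  shows "metric_deriv (\<lambda>y. G (F y)) x (c' * c)"
  unfolding metric_deriv_def
proof (intro allI impI)
  fix e :: real assume e: "0 < e"
  define K where "K = \<bar>c\<bar> + 1"
  have K: "0 < K" by (simp add: K_def)
  obtain d0 where d0: "0 < d0" "\<And>y z. y \<in> ball x d0 \<Longrightarrow> z \<in> ball x d0 \<Longrightarrow> dist (F y) (F z) \<le> K * dist y z"
    by (rule metric_deriv_local_Lipschitz[OF F], fold K_def) (rule that; assumption)
  have e1: "0 < e / (2 * K)" using e K by simp
  have e2: "0 < e / (2 * (\<bar>c'\<bar> + 1))" using e by simp
  obtain d1 where d1: "0 < d1" "\<And>y z. y \<in> ball (F x) d1 \<Longrightarrow> z \<in> ball (F x) d1 \<Longrightarrow>
      \<bar>dist (G y) (G z) - c' * dist y z\<bar> \<le> e / (2 * K) * dist y z"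
    by (rule metric_derivD[OF G e1]) (rule that; assumption)
  obtain d2 where d2: "0 < d2" "\<And>y z. y \<in> ball x d2 \<Longrightarrow> z \<in> ball x d2 \<Longrightarrow>
      \<bar>dist (F y) (F z) - c * dist y z\<bar> \<le> e / (2 * (\<bar>c'\<bar> + 1)) * dist y z"
    by (rule metric_derivD[OF F e2]) (rule that; assumption)
  define d where "d = min (min d0 d2) (d1 / K)"
  have "\<bar>dist (G (F y)) (G (F z)) - c' * c * dist y z\<bar> \<le> e * dist y z"
    if y: "y \<in> ball x d" and z: "z \<in> ball x d" for y z
  proof -
    have in1: "F w \<in> ball (F x) d1" if "w \<in> ball x d" for w
    proof -
      have "dist (F x) (F w) \<le> K * dist x w" using d0 that by (auto simp: d_def)
      also have "\<dots> < K * (d1 / K)" using that K by (intro mult_strict_left_mono) (auto simp: d_def)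
      finally show ?thesis using K by simp
    qed
    have "\<bar>dist (G (F y)) (G (F z)) - c' * dist (F y) (F z)\<bar> \<le> e / (2 * K) * dist (F y) (F z)"
      using d1(2) in1 y z by blast
    also have "\<dots> \<le> e / (2 * K) * (K * dist y z)"
      using d0(2)[of y z] y z e1 by (intro mult_left_mono) (auto simp: d_def)
    also have "\<dots> = e / 2 * dist y z" using K by simp
    finally have A: "\<bar>dist (G (F y)) (G (F z)) - c' * dist (F y) (F z)\<bar> \<le> e / 2 * dist y z" .
    have "\<bar>c' * dist (F y) (F z) - c' * c * dist y z\<bar> = \<bar>c'\<bar> * \<bar>dist (F y) (F z) - c * dist y z\<bar>"
      by (simp add: abs_mult[symmetric] algebra_simps)
    also have "\<dots> \<le> (\<bar>c'\<bar> + 1) * (e / (2 * (\<bar>c'\<bar> + 1)) * dist y z)"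
      using d2(2)[of y z] y z by (intro mult_mono) (auto simp: d_def)
    also have "\<dots> = e / 2 * dist y z"
    proof -
      have "\<bar>c'\<bar> + 1 \<noteq> 0" by (metis abs_ge_zero add_nonneg_pos less_irrefl zero_less_one)
      then show ?thesis by (simp add: divide_simps)
    qed
    finally have B: "\<bar>c' * dist (F y) (F z) - c' * c * dist y z\<bar> \<le> e / 2 * dist y z" .
    have "e * dist y z = e / 2 * dist y z + e / 2 * dist y z" by simp
    with A B show ?thesis by linarith
  qed
  moreover have "0 < d" using d0 d1 d2 K by (simp add: d_def)
  ultimately show "\<exists>d>0. \<forall>y\<in>ball x d. \<forall>z\<in>ball x d. \<bar>dist (G (F y)) (G (F z)) - c' * c * dist y z\<bar> \<le> e * dist y z"
    by blast
qed

text \<open>The lower half of the two-point estimate for \<open>F\<close> bounds distances of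
  \<open>G\<close>-values by \<open>2 / c\<close> times distances of arguments; fed back into the
  estimate, this controls the error.\<close>

lemma metric_deriv_inverse:
  assumes F: "metric_deriv F (G u) c" and c: "0 < c" and cont: "isCont G u"
    and inv: "eventually (\<lambda>v. F (G v) = v) (nhds u)"
  shows "metric_deriv G u (1 / c)"
  unfolding metric_deriv_def
proof (intro allI impI)
  fix e :: real assume e: "0 < e"
  \<comment> \<open>The bound \<open>c / 2\<close> yields the factor \<open>2 / c\<close>, and
    \<open>e * c\<^sup>2 / 2\<close> is tuned to it: multiplied by \<open>2 / c\<close> and divided
    by \<open>c\<close> it becomes \<open>e\<close>.\<close>
  define e1 where "e1 = min (c / 2) (e * c\<^sup>2 / 2)"
  have e1: "0 < e1" using e c by (simp add: e1_def)
  obtain d where d: "0 < d" "\<And>y z. y \<in> ball (G u) d \<Longrightarrow> z \<in> ball (G u) d \<Longrightarrow>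
      \<bar>dist (F y) (F z) - c * dist y z\<bar> \<le> e1 * dist y z"
    by (rule metric_derivD[OF F e1]) (rule that; assumption)
  obtain d1 where d1: "0 < d1" "\<And>v. dist v u < d1 \<Longrightarrow> dist (G v) (G u) < d"
    using cont d(1) unfolding continuous_at_eps_delta by blast
  obtain d2 where d2: "0 < d2" "\<And>v. dist v u < d2 \<Longrightarrow> F (G v) = v"
    using inv unfolding eventually_nhds_metric by blast
  have "\<bar>dist (G y) (G z) - 1 / c * dist y z\<bar> \<le> e * dist y z"
    if y: "y \<in> ball u (min d1 d2)" and z: "z \<in> ball u (min d1 d2)" for y z
  proof -
    let ?D = "dist (G y) (G z)"
    have main: "\<bar>dist y z - c * ?D\<bar> \<le> e1 * ?D"
      using d(2)[of "G y" "G z"] d1(2)[of y] d1(2)[of z] d2(2)[of y] d2(2)[of z] y z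
      by (auto simp: dist_commute)
    have "e1 * ?D \<le> c / 2 * ?D" by (intro mult_right_mono) (auto simp: e1_def)
    then have "c / 2 * ?D \<le> dist y z" using main by linarith
    then have D: "?D \<le> 2 / c * dist y z" using c by (simp add: field_simps)
    have "\<bar>?D - 1 / c * dist y z\<bar> = \<bar>dist y z - c * ?D\<bar> / c"
    proof -
      have "?D - 1 / c * dist y z = - ((dist y z - c * ?D) / c)" using c by (simp add: field_simps)
      then show ?thesis using c by simp
    qed
    also have "\<dots> \<le> (e * c\<^sup>2 / 2) * ?D / c"
    proof -
      have "e1 * ?D \<le> (e * c\<^sup>2 / 2) * ?D" by (intro mult_right_mono) (auto simp: e1_def)
      then show ?thesis using main c by (intro divide_right_mono) linarith+
    qed
    also have "\<dots> \<le> (e * c\<^sup>2 / 2) * (2 / c * dist y z) / c"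
      using D e c by (intro divide_right_mono mult_left_mono) auto
    also have "\<dots> = e * dist y z" using c by (simp add: power2_eq_square)
    finally show ?thesis .
  qed
  then show "\<exists>d>0. \<forall>y\<in>ball u d. \<forall>z\<in>ball u d. \<bar>dist (G y) (G z) - 1 / c * dist y z\<bar> \<le> e * dist y z"
    using d1(1) d2(1) by (intro exI[of _ "min d1 d2"]) auto
qed

lemma metric_deriv_tendsto:
  assumes "metric_deriv F x c"
  shows "((\<lambda>w. dist (F w) (F x) / dist w x) \<longlongrightarrow> c) (at x)"
proof (rule tendstoI)
  fix e :: real assume e: "0 < e"
  then have e2: "0 < e / 2" by simp
  obtain d where d: "0 < d" "\<And>y z. y \<in> ball x d \<Longrightarrow> z \<in> ball x d \<Longrightarrow> \<bar>dist (F y) (F z) - c * dist y z\<bar> \<le> e / 2 * dist y z"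
    by (rule metric_derivD[OF assms e2]) (rule that; assumption)
  have "dist (dist (F w) (F x) / dist w x) c < e" if w: "w \<noteq> x" "dist w x < d" for w
  proof -
    have D: "0 < dist w x" using w by simp
    have "\<bar>dist (F w) (F x) / dist w x - c\<bar> = \<bar>dist (F w) (F x) - c * dist w x\<bar> / dist w x"
    proof -
      have "dist (F w) (F x) / dist w x - c = (dist (F w) (F x) - c * dist w x) / dist w x"
        using D by (simp add: field_simps)
      then show ?thesis using D by simp
    qed
    also have "\<dots> \<le> (e / 2 * dist w x) / dist w x"
      using d w by (intro divide_right_mono) (auto simp: dist_commute)
    also have "\<dots> = e / 2" using D by simp
    finally show ?thesis using e by (simp add: dist_real_def)
  qed
  then show "eventually (\<lambda>w. dist (dist (F w) (F x) / dist w x) c < e) (at x)"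
    using d(1) unfolding eventually_at by blast
qed

lemma metric_deriv_isometry:
  assumes "\<And>y z. dist (F y) (F z) = dist y z"
  shows "metric_deriv F x 1"
  unfolding metric_deriv_def using assms by (auto intro: exI[of _ 1])

text \<open>The mean value inequality for \<open>g w - g' z * w\<close> on a small disc. Continuity
  of the derivative, not just its existence at \<open>z\<close>, is what permits two moving
  points.\<close>

lemma metric_deriv_field:
  fixes g :: "'a::real_normed_field \<Rightarrow> 'a"
  assumes ev: "eventually (\<lambda>w. (g has_field_derivative g' w) (at w)) (nhds z)" and cont: "isCont g' z"
  shows "metric_deriv g z (norm (g' z))"
  unfolding metric_deriv_def
proof (intro allI impI)
  fix e :: real assume e: "0 < e"
  obtain d1 where d1: "0 < d1" "\<And>w. dist w z < d1 \<Longrightarrow> (g has_field_derivative g' w) (at w)"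
    using ev unfolding eventually_nhds_metric by blast
  obtain d2 where d2: "0 < d2" "\<And>w. dist w z < d2 \<Longrightarrow> dist (g' w) (g' z) < e"
    using cont e unfolding continuous_at_eps_delta by blast
  have "\<bar>dist (g x) (g y) - norm (g' z) * dist x y\<bar> \<le> e * dist x y"
    if x: "x \<in> ball z (min d1 d2)" and y: "y \<in> ball z (min d1 d2)" for x y
  proof -
    have "norm ((g x - g' z * x) - (g y - g' z * y)) \<le> e * norm (x - y)"
    proof (rule field_differentiable_bound[where S="ball z (min d1 d2)" and f'="\<lambda>w. g' w - g' z"])
      fix w assume w: "w \<in> ball z (min d1 d2)"
      then have gw: "(g has_field_derivative g' w) (at w)" using d1 by (simp add: dist_commute)
      show "((\<lambda>w. g w - g' z * w) has_field_derivative (g' w - g' z)) (at w within ball z (min d1 d2))"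
        by (rule has_field_derivative_at_within) (auto intro!: derivative_eq_intros gw)
      show "norm (g' w - g' z) \<le> e" using d2(2)[of w] w by (simp add: dist_commute dist_norm less_imp_le)
    qed (use x y in auto)
    then have "norm ((g x - g y) - g' z * (x - y)) \<le> e * dist x y"
      by (simp add: dist_norm algebra_simps)
    moreover have "\<bar>norm (g x - g y) - norm (g' z * (x - y))\<bar> \<le> norm ((g x - g y) - g' z * (x - y))"
      by (rule norm_triangle_ineq3)
    ultimately show ?thesis by (simp add: dist_norm norm_mult)
  qed
  then show "\<exists>d>0. \<forall>x\<in>ball z d. \<forall>y\<in>ball z d. \<bar>dist (g x) (g y) - norm (g' z) * dist x y\<bar> \<le> e * dist x y"
    using d1(1) d2(1) by (intro exI[of _ "min d1 d2"]) auto
qed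

lemma metric_deriv_funpow:
  fixes T :: "'a::metric_space \<Rightarrow> 'a"
  assumes "\<And>x. \<exists>c. metric_deriv T x c"
  shows "\<exists>c. metric_deriv (T ^^ n) x c"
proof (induction n)
  case 0
  have "metric_deriv id x 1" by (rule metric_deriv_isometry) simp
  moreover have "T ^^ 0 = id" by (simp add: fun_eq_iff)
  ultimately show ?case by metis
next
  case (Suc n)
  then obtain c where "metric_deriv (T ^^ n) x c" by blast
  moreover obtain c' where "metric_deriv T ((T ^^ n) x) c'" using assms by blast
  ultimately have "metric_deriv (\<lambda>y. T ((T ^^ n) y)) x (c' * c)" by (rule metric_deriv_compose)
  then show ?case by (auto simp: comp_def)
qed

text \<open>Pairs closer than a Lebesgue number of the cover share a ball with a local Lipschitz
  constant; for the others the diameter of the image divided by that number serves as the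
  constant.\<close>

lemma compact_Lipschitz:
  assumes K: "compact K" and F: "\<And>x. x \<in> K \<Longrightarrow> \<exists>c. metric_deriv F x c"
  obtains L where "1 < L" "\<And>x y. x \<in> K \<Longrightarrow> y \<in> K \<Longrightarrow> dist (F x) (F y) \<le> L * dist x y"
proof -
  have "\<forall>x\<in>K. \<exists>d L. 0 < d \<and> 0 \<le> L \<and> (\<forall>y\<in>ball x d. \<forall>z\<in>ball x d. dist (F y) (F z) \<le> L * dist y z)"
  proof
    fix x assume "x \<in> K"
    then obtain c where c: "metric_deriv F x c" using F by blast
    show "\<exists>d L. 0 < d \<and> 0 \<le> L \<and> (\<forall>y\<in>ball x d. \<forall>z\<in>ball x d. dist (F y) (F z) \<le> L * dist y z)"
    proof (rule metric_deriv_local_Lipschitz[OF c])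
      fix d assume "0 < d"
        "\<And>y z. y \<in> ball x d \<Longrightarrow> z \<in> ball x d \<Longrightarrow> dist (F y) (F z) \<le> (\<bar>c\<bar> + 1) * dist y z"
      then show ?thesis by (intro exI[of _ d] exI[of _ "\<bar>c\<bar> + 1"]) auto
    qed
  qed
  then obtain d L where dL: "\<And>x. x \<in> K \<Longrightarrow> 0 < d x" "\<And>x. x \<in> K \<Longrightarrow> 0 \<le> L x"
    "\<And>x y z. x \<in> K \<Longrightarrow> y \<in> ball x (d x) \<Longrightarrow> z \<in> ball x (d x) \<Longrightarrow> dist (F y) (F z) \<le> L x * dist y z"
    by metis
  have "K \<subseteq> (\<Union>x\<in>K. ball x (d x))" using dL(1) by force
  then obtain C where C: "C \<subseteq> K" "finite C" "K \<subseteq> (\<Union>x\<in>C. ball x (d x))"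
    using compactE_image[OF K, of K "\<lambda>x. ball x (d x)"] by auto
  obtain \<epsilon> where \<epsilon>: "0 < \<epsilon>" "\<And>x. x \<in> K \<Longrightarrow> \<exists>G\<in>(\<lambda>x. ball x (d x)) ` C. ball x \<epsilon> \<subseteq> G"
    by (rule Heine_Borel_lemma[OF K C(3)]) (auto intro: that)
  have "continuous_on K F"
    using F metric_deriv_isCont by (meson continuous_at_imp_continuous_on)
  then have "bounded (F ` K)" using K by (intro compact_imp_bounded compact_continuous_image)
  then obtain B where B: "\<And>x y. x \<in> K \<Longrightarrow> y \<in> K \<Longrightarrow> dist (F x) (F y) \<le> B"
    unfolding bounded_two_points by blast
  define L' where "L' = (\<Sum>x\<in>C. L x) + \<bar>B\<bar> / \<epsilon> + 2"
  have SL: "0 \<le> (\<Sum>x\<in>C. L x)" using dL(2) C by (intro sum_nonneg) auto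
  have "dist (F x) (F y) \<le> L' * dist x y" if xy: "x \<in> K" "y \<in> K" for x y
  proof (cases "dist x y < \<epsilon>")
    case True
    obtain a where a: "a \<in> C" "ball x \<epsilon> \<subseteq> ball a (d a)" using \<epsilon>(2)[OF xy(1)] by auto
    have "x \<in> ball x \<epsilon>" "y \<in> ball x \<epsilon>" using True \<epsilon>(1) by auto
    then have "x \<in> ball a (d a)" "y \<in> ball a (d a)" using a(2) by blast+
    then have "dist (F x) (F y) \<le> L a * dist x y" using dL(3) a C by blast
    also have "L a \<le> L'"
    proof -
      have "L a \<le> (\<Sum>x\<in>C. L x)" using a C dL(2) by (intro member_le_sum) auto
      then show ?thesis using \<epsilon>(1) by (simp add: L'_def add_increasing2)
    qed
    finally show ?thesis by (simp add: mult_right_mono)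
  next
    case False
    have "dist (F x) (F y) \<le> \<bar>B\<bar> / \<epsilon> * \<epsilon>" using B[OF xy] \<epsilon>(1) by simp
    also have "\<dots> \<le> L' * dist x y"
      using False \<epsilon>(1) SL by (intro mult_mono) (auto simp: L'_def)
    finally show ?thesis .
  qed
  moreover have "1 < L'"
  proof -
    have "0 \<le> \<bar>B\<bar> / \<epsilon>" using \<epsilon>(1) by simp
    then show ?thesis using SL by (simp add: L'_def)
  qed
  ultimately show ?thesis using that by blast
qed

text \<open>Scaling factor 3 with error 1 leaves a factor 2 for all nearby pairs, and a Lebesgue
  number makes the neighbourhoods uniform.\<close>

lemma compact_locally_expanding:
  assumes K: "compact K" and F: "\<And>x. x \<in> K \<Longrightarrow> \<exists>c\<ge>3. metric_deriv F x c"
  obtains \<delta> where "0 < \<delta>" "\<And>x y. x \<in> K \<Longrightarrow> y \<in> K \<Longrightarrow> dist x y < \<delta> \<Longrightarrow> 2 * dist x y \<le> dist (F x) (F y)"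
proof -
  have "\<forall>x\<in>K. \<exists>d>0. \<forall>y\<in>ball x d. \<forall>z\<in>ball x d. 2 * dist y z \<le> dist (F y) (F z)"
  proof
    fix x assume "x \<in> K"
    then obtain c where c: "3 \<le> c" "metric_deriv F x c" using F by blast
    obtain e where e: "0 < e" "\<And>y z. y \<in> ball x e \<Longrightarrow> z \<in> ball x e \<Longrightarrow> \<bar>dist (F y) (F z) - c * dist y z\<bar> \<le> 1 * dist y z"
      by (rule metric_derivD[OF c(2) zero_less_one]) (rule that; assumption)
    have "2 * dist y z \<le> dist (F y) (F z)" if "y \<in> ball x e" "z \<in> ball x e" for y z
    proof -
      have "3 * dist y z \<le> c * dist y z" using c by (intro mult_right_mono) auto
      then show ?thesis using e(2)[OF that] by linarith
    qed
    with e(1) show "\<exists>d>0. \<forall>y\<in>ball x d. \<forall>z\<in>ball x d. 2 * dist y z \<le> dist (F y) (F z)" by blast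
  qed
  then obtain d where d: "\<And>x. x \<in> K \<Longrightarrow> 0 < d x"
    "\<And>x y z. x \<in> K \<Longrightarrow> y \<in> ball x (d x) \<Longrightarrow> z \<in> ball x (d x) \<Longrightarrow> 2 * dist y z \<le> dist (F y) (F z)"
    by metis
  have cov: "K \<subseteq> \<Union>((\<lambda>x. ball x (d x)) ` K)" using d(1) by force
  obtain \<epsilon> where \<epsilon>: "0 < \<epsilon>" "\<And>x. x \<in> K \<Longrightarrow> \<exists>G\<in>(\<lambda>x. ball x (d x)) ` K. ball x \<epsilon> \<subseteq> G"
    by (rule Heine_Borel_lemma[OF K cov]) (auto intro: that)
  show ?thesis
  proof (rule that[OF \<epsilon>(1)])
    fix x y assume xy: "x \<in> K" "y \<in> K" "dist x y < \<epsilon>"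
    obtain a where a: "a \<in> K" "ball x \<epsilon> \<subseteq> ball a (d a)" using \<epsilon>(2)[OF xy(1)] by auto
    have "x \<in> ball x \<epsilon>" "y \<in> ball x \<epsilon>" using xy(3) \<epsilon>(1) by auto
    then have "x \<in> ball a (d a)" "y \<in> ball a (d a)" using a(2) by blast+
    then show "2 * dist x y \<le> dist (F x) (F y)" using d(2) a by blast
  qed
qed

section \<open>Rational maps on the sphere\<close>

lemma dist_stereo: "dist (stereo u) (stereo v) = dist u v"
  by (simp add: dist_rsphere_def chordal_eq_dist_stereo)

lemma inj_stereo: "inj stereo"
  by (rule injI) (metis dist_eq_0_iff dist_stereo)

lemma continuous_stereo: "isCont stereo u"
  by (rule metric_deriv_isCont, rule metric_deriv_isometry) (rule dist_stereo)

lemma one_plus_cmod_sq_pos: "0 < 1 + (cmod z)\<^sup>2"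
  by (intro add_pos_nonneg) auto

lemma dist_Fin: "dist (Fin z) (Fin w) = 2 / sqrt (1 + (cmod z)\<^sup>2) * (1 / sqrt (1 + (cmod w)\<^sup>2)) * dist z w"
  by (simp add: dist_rsphere_def dist_norm)

text \<open>The conformal factor of the spherical metric. The chordal distance is
  \<open>2 * s x * s y * dist x y\<close> with \<open>s\<close> continuous and at most 1, so the
  factor varies little near \<open>z\<close>.\<close>

lemma metric_deriv_Fin: "metric_deriv Fin z (2 / (1 + (cmod z)\<^sup>2))"
  unfolding metric_deriv_def
proof (intro allI impI)
  fix e :: real assume e: "0 < e"
  define s where "s w = 1 / sqrt (1 + (cmod w)\<^sup>2)" for w
  have s01: "0 \<le> s w" "s w \<le> 1" for w
    using one_plus_cmod_sq_pos[of w] by (auto simp: s_def divide_le_eq)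
  have "isCont s z" unfolding s_def
    by (intro continuous_intros) (use one_plus_cmod_sq_pos[of z] in auto)
  moreover have "0 < e / 4" using e by simp
  ultimately obtain d where d: "0 < d" "\<And>w. dist w z < d \<Longrightarrow> dist (s w) (s z) < e / 4"
    unfolding continuous_at_eps_delta by blast
  have szz: "2 / (1 + (cmod z)\<^sup>2) = 2 * s z * s z"
    using one_plus_cmod_sq_pos[of z] by (simp add: s_def)
  have "\<bar>dist (Fin x) (Fin y) - 2 / (1 + (cmod z)\<^sup>2) * dist x y\<bar> \<le> e * dist x y"
    if x: "x \<in> ball z d" and y: "y \<in> ball z d" for x y
  proof -
    have sx: "\<bar>s x - s z\<bar> \<le> e / 4" and sy: "\<bar>s y - s z\<bar> \<le> e / 4"
      using d(2)[of x] d(2)[of y] x y by (auto simp: dist_commute dist_real_def)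
    have eq: "dist (Fin x) (Fin y) - 2 / (1 + (cmod z)\<^sup>2) * dist x y = (2 * s x * s y - 2 * s z * s z) * dist x y"
      unfolding dist_Fin szz by (simp add: s_def algebra_simps)
    have "2 * s x * s y - 2 * s z * s z = 2 * ((s x - s z) * s y + s z * (s y - s z))"
      by (simp add: algebra_simps)
    moreover have "\<bar>(s x - s z) * s y + s z * (s y - s z)\<bar> \<le> e / 4 * 1 + 1 * (e / 4)"
    proof (intro order_trans[OF abs_triangle_ineq] add_mono)
      show "\<bar>(s x - s z) * s y\<bar> \<le> e / 4 * 1"
        unfolding abs_mult using sx e s01[of y] by (intro mult_mono) auto
      show "\<bar>s z * (s y - s z)\<bar> \<le> 1 * (e / 4)"
        unfolding abs_mult using sy e s01[of z] by (intro mult_mono) auto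
    qed
    moreover have "\<bar>2 * t\<bar> \<le> e" if "\<bar>t\<bar> \<le> e / 4 * 1 + 1 * (e / 4)" for t :: real
      using that by linarith
    ultimately have "\<bar>2 * s x * s y - 2 * s z * s z\<bar> \<le> e" by presburger
    then show ?thesis unfolding eq abs_mult by (simp add: mult_right_mono)
  qed
  with d(1) show "\<exists>d>0. \<forall>x\<in>ball z d. \<forall>y\<in>ball z d.
      \<bar>dist (Fin x) (Fin y) - 2 / (1 + (cmod z)\<^sup>2) * dist x y\<bar> \<le> e * dist x y" by blast
qed

text \<open>Stereographic projection from the north pole, used for continuity. At
  \<open>Infty\<close> the division by zero returns 0, in agreement with
  \<open>to_complex Infty = 0\<close>.\<close>

lemma to_complex_stereo: "to_complex u = fst (stereo u) /\<^sub>R (1 - snd (stereo u))"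
proof (cases u)
  case (Fin z)
  have ne: "1 + (cmod z)\<^sup>2 \<noteq> 0" using one_plus_cmod_sq_pos[of z] by simp
  then have "1 - ((cmod z)\<^sup>2 - 1) / (1 + (cmod z)\<^sup>2) = 2 / (1 + (cmod z)\<^sup>2)"
    by (simp add: field_simps)
  then have "inverse (1 - snd (stereo u)) = (1 + (cmod z)\<^sup>2) / 2" using Fin by simp
  then show ?thesis using ne by (simp add: Fin)
qed simp

lemma isCont_to_complex: "isCont to_complex (Fin z)"
proof -
  have "1 - snd (stereo (Fin z)) \<noteq> 0"
    using one_plus_cmod_sq_pos[of z] by (simp add: field_simps)
  then have "isCont (\<lambda>u. fst (stereo u) /\<^sub>R (1 - snd (stereo u))) (Fin z)"
    by (intro continuous_intros continuous_stereo) 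
  then show ?thesis by (simp add: to_complex_stereo[abs_def])
qed

lemma eventually_finite: "eventually (\<lambda>u. u \<noteq> Infty) (nhds (Fin z))"
  using t1_space_nhds[of "Fin z" Infty] by simp

lemma Fin_to_complex: "u \<noteq> Infty \<Longrightarrow> Fin (to_complex u) = u"
  by (cases u) auto

lemma metric_deriv_to_complex: "metric_deriv to_complex (Fin z) ((1 + (cmod z)\<^sup>2) / 2)"
proof -
  have "metric_deriv to_complex (Fin z) (1 / (2 / (1 + (cmod z)\<^sup>2)))"
  proof (rule metric_deriv_inverse)
    show "metric_deriv Fin (to_complex (Fin z)) (2 / (1 + (cmod z)\<^sup>2))" by (simp add: metric_deriv_Fin)
    show "0 < 2 / (1 + (cmod z)\<^sup>2)" using one_plus_cmod_sq_pos by simp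
    show "eventually (\<lambda>v. Fin (to_complex v) = v) (nhds (Fin z))"
      using eventually_finite[of z] by eventually_elim (rule Fin_to_complex)
  qed (rule isCont_to_complex)
  then show ?thesis by simp
qed

text \<open>On the unit sphere \<open>z \<mapsto> 1/z\<close> is the half-turn about the real axis.
  Hence \<open>sphere_inv\<close> is an isometry, and estimates in the finite chart carry over to
  \<open>Infty\<close>.\<close>

lemma stereo_sphere_inv: "stereo (sphere_inv u) = (cnj (fst (stereo u)), - snd (stereo u))"
proof (cases u)
  case (Fin z)
  show ?thesis
  proof (cases "z = 0")
    case False
    have n: "1 + (cmod z)\<^sup>2 \<noteq> 0" "cmod z \<noteq> 0" using one_plus_cmod_sq_pos[of z] False by auto
    have a: "2 / (1 + (cmod (1 / z))\<^sup>2) = 2 * (cmod z)\<^sup>2 / (1 + (cmod z)\<^sup>2)"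
      using n by (simp add: norm_divide power_divide field_simps)
    have b: "((cmod (1 / z))\<^sup>2 - 1) / (1 + (cmod (1 / z))\<^sup>2) = - (((cmod z)\<^sup>2 - 1) / (1 + (cmod z)\<^sup>2))"
      using n by (simp add: norm_divide power_divide divide_simps)
    have "complex_of_real ((cmod z)\<^sup>2) = z * cnj z" by (rule complex_norm_square)
    then have c: "(2 * (cmod z)\<^sup>2 / (1 + (cmod z)\<^sup>2)) *\<^sub>R (1 / z) = (2 / (1 + (cmod z)\<^sup>2)) *\<^sub>R cnj z"
      using False by (simp add: scaleR_conv_of_real)
    show ?thesis using False Fin a b c by (simp add: sphere_inv_def)
  qed (use Fin in \<open>simp add: sphere_inv_def\<close>)
qed (simp add: sphere_inv_def)

lemma dist_sphere_inv: "dist (sphere_inv u) (sphere_inv v) = dist u v"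
proof -
  have "dist (sphere_inv u) (sphere_inv v) = dist (stereo (sphere_inv u)) (stereo (sphere_inv v))"
    by (simp only: dist_stereo)
  also have "\<dots> = dist (stereo u) (stereo v)"
    unfolding stereo_sphere_inv
    by (simp add: dist_prod_def dist_norm real_norm_def power2_commute flip: complex_cnj_diff)
  finally show ?thesis by (simp only: dist_stereo)
qed

lemma sphere_inv_sphere_inv: "sphere_inv (sphere_inv u) = u"
  by (cases u) (auto simp: sphere_inv_def)

text \<open>A rational map with a chart on the source only. Values stay on the sphere, so poles are
  ordinary points.\<close>

definition quotient_chart :: "complex poly \<Rightarrow> complex poly \<Rightarrow> complex \<Rightarrow> rsphere" where
  "quotient_chart p q w = (if poly q w = 0 then Infty else Fin (poly p w / poly q w))"

lemma eventually_poly_nonzero: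
  fixes q :: "complex poly"
  assumes "poly q z \<noteq> 0"
  shows "eventually (\<lambda>w. poly q w \<noteq> 0) (nhds z)"
proof -
  have "isCont (poly q) z" by simp
  then have "((poly q) \<longlongrightarrow> poly q z) (nhds z)" by (simp add: isCont_def tendsto_at_iff_tendsto_nhds)
  then show ?thesis using assms by (rule tendsto_imp_eventually_ne)
qed

lemma metric_deriv_poly_quotient:
  fixes p q :: "complex poly"
  assumes "poly q z \<noteq> 0"
  shows "\<exists>c. metric_deriv (\<lambda>w. poly p w / poly q w) z c"
proof -
  define g' where "g' w = (poly (pderiv p) w * poly q w - poly p w * poly (pderiv q) w) / (poly q w * poly q w)" for w
  have "metric_deriv (\<lambda>w. poly p w / poly q w) z (norm (g' z))"
  proof (rule metric_deriv_field)
    have "eventually (\<lambda>w. poly q w \<noteq> 0) (nhds z)" by (rule eventually_poly_nonzero[OF assms])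
    then show "eventually (\<lambda>w. ((\<lambda>w. poly p w / poly q w) has_field_derivative g' w) (at w)) (nhds z)"
      by eventually_elim (auto intro!: derivative_eq_intros simp: g'_def)
    show "isCont g' z" unfolding g'_def using assms by (intro continuous_intros) auto
  qed
  then show ?thesis by blast
qed

text \<open>At a pole \<open>p / q\<close> is the inversion of \<open>q / p\<close>, which is finite
  there, and inversion is an isometry.\<close>

lemma metric_deriv_quotient_chart:
  assumes "poly p z \<noteq> 0 \<or> poly q z \<noteq> 0"
  shows "\<exists>c. metric_deriv (quotient_chart p q) z c"
proof (cases "poly q z = 0")
  case False
  obtain c where c: "metric_deriv (\<lambda>w. poly p w / poly q w) z c"
    using metric_deriv_poly_quotient[OF False] by blast
  have "metric_deriv (quotient_chart p q) z (2 / (1 + (cmod (poly p z / poly q z))\<^sup>2) * c)"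
    by (rule metric_deriv_transform[OF metric_deriv_compose[OF c metric_deriv_Fin]])
      (use eventually_poly_nonzero[OF False] in \<open>auto elim!: eventually_mono simp: quotient_chart_def\<close>)
  then show ?thesis by blast
next
  case True
  then have p: "poly p z \<noteq> 0" using assms by simp
  obtain c where c: "metric_deriv (\<lambda>w. poly q w / poly p w) z c"
    using metric_deriv_poly_quotient[OF p] by blast
  have "metric_deriv (quotient_chart p q) z (1 * (2 / (1 + (cmod (poly q z / poly p z))\<^sup>2) * c))"
    by (rule metric_deriv_transform[OF metric_deriv_compose[OF metric_deriv_compose[OF c metric_deriv_Fin]
          metric_deriv_isometry[OF dist_sphere_inv]]])
      (use eventually_poly_nonzero[OF p] in \<open>auto elim!: eventually_mono simp: quotient_chart_def sphere_inv_def\<close>)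
  then show ?thesis by blast
qed

text \<open>The polynomial \<open>w ^ n * p (1 / w)\<close>. Padding to a common \<open>n\<close>
  keeps the quotient of two reversed polynomials equal to the quotient of the originals at
  \<open>1 / w\<close>.\<close>

definition reversed_poly :: "nat \<Rightarrow> complex poly \<Rightarrow> complex poly" where
  "reversed_poly n p = monom 1 (n - degree p) * reflect_poly p"

lemma poly_reversed_poly_nz:
  assumes "degree p \<le> n" "w \<noteq> 0"
  shows "poly (reversed_poly n p) w = w ^ n * poly p (1 / w)"
  using assms by (simp add: reversed_poly_def poly_monom poly_reflect_poly_nz inverse_eq_divide
      mult.assoc[symmetric] power_add[symmetric])

lemma poly_reversed_poly_0:
  assumes "degree p \<le> n"
  shows "poly (reversed_poly n p) 0 = coeff p n"
proof (cases "degree p = n")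
  case False
  then have "degree p < n" using assms by simp
  then show ?thesis by (simp add: reversed_poly_def poly_monom coeff_eq_0 power_0_left)
qed (simp add: reversed_poly_def poly_monom)

lemma rat_map_sphere_inv:
  assumes "n = max (degree p) (degree q)"
  shows "rat_map p q (sphere_inv (Fin w)) = quotient_chart (reversed_poly n p) (reversed_poly n q) w"
proof (cases "w = 0")
  case True
  then show ?thesis using assms
    by (simp add: sphere_inv_def rat_map_def quotient_chart_def poly_reversed_poly_0 Let_def)
next
  case False
  then show ?thesis using assms
    by (simp add: sphere_inv_def rat_map_def quotient_chart_def poly_reversed_poly_nz)
qed

lemma metric_deriv_rat_map:
  assumes "q \<noteq> 0" "coprime p q"
  shows "\<exists>c. metric_deriv (rat_map p q) x c"
proof (cases x)
  case (Fin z)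
  \<comment> \<open>A common zero would give a common linear factor, against coprimality.\<close>
  have "poly p z \<noteq> 0 \<or> poly q z \<noteq> 0"
  proof (rule ccontr)
    assume "\<not> ?thesis"
    then have "[:- z, 1:] dvd p" "[:- z, 1:] dvd q" by (auto simp: poly_eq_0_iff_dvd)
    then have "is_unit [:- z, 1:]" using assms(2) coprime_common_divisor by blast
    then show False by (simp add: is_unit_iff_degree)
  qed
  then obtain c where "metric_deriv (quotient_chart p q) z c" using metric_deriv_quotient_chart by blast
  then have c: "metric_deriv (quotient_chart p q) (to_complex (Fin z)) c" by simp
  show ?thesis
  proof (rule exI, unfold Fin, rule metric_deriv_transform[OF metric_deriv_compose[OF metric_deriv_to_complex c]])
    show "eventually (\<lambda>u. rat_map p q u = quotient_chart p q (to_complex u)) (nhds (Fin z))"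
      using eventually_finite[of z]
      by eventually_elim (auto simp: rat_map_def quotient_chart_def split: rsphere.splits)
  qed
next
  case Infty
  define n where "n = max (degree p) (degree q)"
  let ?P = "reversed_poly n p" and ?Q = "reversed_poly n q"
  \<comment> \<open>The value at 0 is the coefficient of degree \<open>n\<close>, and one of the two
    polynomials has degree exactly \<open>n\<close>.\<close>
  have "poly ?P 0 \<noteq> 0 \<or> poly ?Q 0 \<noteq> 0"
  proof (cases "degree p \<le> degree q")
    case True
    then show ?thesis using assms(1) by (simp add: n_def poly_reversed_poly_0)
  next
    case False
    then have "p \<noteq> 0" by auto
    then show ?thesis using False by (simp add: n_def poly_reversed_poly_0)
  qed
  then obtain c where "metric_deriv (quotient_chart ?P ?Q) 0 c" using metric_deriv_quotient_chart by blast
  then have c: "metric_deriv (quotient_chart ?P ?Q) (to_complex (Fin 0)) c" by simp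
  have inv: "metric_deriv sphere_inv Infty 1" by (rule metric_deriv_isometry[OF dist_sphere_inv])
  have si: "sphere_inv Infty = Fin 0" by (simp add: sphere_inv_def)
  have "metric_deriv (\<lambda>u. quotient_chart ?P ?Q (to_complex u)) (sphere_inv Infty) (c * ((1 + (cmod 0)\<^sup>2) / 2))"
    unfolding si by (rule metric_deriv_compose[OF metric_deriv_to_complex c])
  note comp = metric_deriv_compose[OF inv this]
  show ?thesis
  proof (rule exI, unfold Infty, rule metric_deriv_transform[OF comp])
    have "eventually (\<lambda>u. u \<noteq> Fin 0) (nhds Infty)" using t1_space_nhds[of Infty "Fin 0"] by simp
    then show "eventually (\<lambda>u. rat_map p q u = quotient_chart ?P ?Q (to_complex (sphere_inv u))) (nhds Infty)"
    proof eventually_elim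
      case (elim u)
      then have "sphere_inv u \<noteq> Infty" by (cases u) (auto simp: sphere_inv_def)
      then obtain w where w: "sphere_inv u = Fin w" by (cases "sphere_inv u") auto
      then have "u = sphere_inv (Fin w)" using sphere_inv_sphere_inv[of u] by simp
      then show ?case using rat_map_sphere_inv[OF n_def, of w] w by simp
    qed
  qed
qed

section \<open>Topology of the sphere\<close>

lemma compact_UNIV_rsphere: "compact (UNIV :: rsphere set)"
proof -
  have FinC: "continuous_on S Fin" for S
    by (rule continuous_at_imp_continuous_on) (use metric_deriv_isCont[OF metric_deriv_Fin] in blast)
  have invC: "continuous_on S sphere_inv" for S
    by (rule continuous_at_imp_continuous_on)
      (use metric_deriv_isCont[OF metric_deriv_isometry[OF dist_sphere_inv]] in blast)
  have "compact (Fin ` cball 0 1)" by (intro compact_continuous_image FinC compact_cball)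
  moreover have "compact (sphere_inv ` Fin ` cball 0 1)"
    by (intro compact_continuous_image FinC invC compact_cball)
  moreover have "UNIV = Fin ` cball 0 1 \<union> sphere_inv ` Fin ` cball 0 1"
  proof -
    have "u \<in> Fin ` cball 0 1 \<union> sphere_inv ` Fin ` cball 0 1" for u
    proof (cases u)
      case (Fin z)
      show ?thesis
      proof (cases "cmod z \<le> 1")
        case False
        then have "u = sphere_inv (Fin (1 / z))" "1 / z \<in> cball 0 1"
          using Fin by (auto simp: sphere_inv_def norm_divide divide_simps)
        then show ?thesis by blast
      qed (use Fin in auto)
    next
      case Infty
      then have "u = sphere_inv (Fin 0)" by (simp add: sphere_inv_def)
      then show ?thesis by auto
    qed
    then show ?thesis by blast
  qed
  ultimately show ?thesis using compact_Un by metis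
qed

text \<open>The limit that defines \<open>chordal_deriv\<close> is determined only at points that
  are not isolated.\<close>

lemma rsphere_at_neq_bot: "at (u::rsphere) \<noteq> bot"
proof -
  have fin: "\<not> open {Fin z}" for z
  proof
    assume "open {Fin z}"
    moreover have "continuous_on UNIV Fin"
      by (rule continuous_at_imp_continuous_on) (use metric_deriv_isCont[OF metric_deriv_Fin] in blast)
    ultimately have "open (Fin -` {Fin z})" by (rule open_vimage)
    moreover have "Fin -` {Fin z} = {z}" by auto
    ultimately show False using not_open_singleton[of z] by simp
  qed
  have "\<not> open {Infty}"
  proof
    assume "open {Infty}"
    moreover have "continuous_on UNIV sphere_inv"
      by (rule continuous_at_imp_continuous_on)
        (use metric_deriv_isCont[OF metric_deriv_isometry[OF dist_sphere_inv]] in blast)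
    ultimately have "open (sphere_inv -` {Infty})" by (rule open_vimage)
    moreover have "sphere_inv -` {Infty} = {Fin 0}"
      using sphere_inv_sphere_inv by (auto simp: sphere_inv_def split: rsphere.splits if_splits)
    ultimately show False using fin[of 0] by simp
  qed
  with fin show ?thesis by (cases u) (auto simp: at_eq_bot_iff)
qed

lemma chordal_deriv_eq:
  assumes "metric_deriv F u c"
  shows "chordal_deriv F u = c"
  unfolding chordal_deriv_def
  by (rule tendsto_Lim[OF rsphere_at_neq_bot metric_deriv_tendsto[OF assms]])

section \<open>Hyperbolic rational maps\<close>

text \<open>A one-point space would itself be an atom. Two points are needed so that the set of
  difference quotients in \<open>lip_seminorm\<close> is nonempty.\<close>

lemma non_atomic_two_points:
  assumes "prob_space M" "non_atomic M"
  obtains a b where "a \<in> space M" "b \<in> space M" "a \<noteq> b"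
proof -
  interpret prob_space M by (rule assms(1))
  have "\<exists>a\<in>space M. \<exists>b\<in>space M. a \<noteq> b"
  proof (rule ccontr)
    assume "\<not> ?thesis"
    then have eq: "a = b" if "a \<in> space M" "b \<in> space M" for a b using that by metis
    have "emeasure M B = 0 \<or> emeasure M B = emeasure M (space M)" if "B \<in> sets M" "B \<subseteq> space M" for B
    proof (cases "B = {}")
      case False
      then obtain x where x: "x \<in> B" by auto
      have "y \<in> B" if "y \<in> space M" for y
      proof -
        have "x \<in> space M" using x \<open>B \<subseteq> space M\<close> by (rule rev_subsetD)
        then show ?thesis using eq[OF that] x by simp
      qed
      then have "B = space M" using \<open>B \<subseteq> space M\<close> by auto
      then show ?thesis by simp
    qed simp
    moreover have "emeasure M (space M) > 0" by (simp add: emeasure_space_1)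
    ultimately have "\<exists>A\<in>sets M. emeasure M A > 0 \<and>
        (\<forall>B\<in>sets M. B \<subseteq> A \<longrightarrow> emeasure M B = 0 \<or> emeasure M B = emeasure M A)"
      by (intro bexI[of _ "space M"]) auto
    with assms(2) show False unfolding non_atomic_def by (rule notE)
  qed
  then show ?thesis using that by blast
qed

text \<open>Replaces the seminorm in the covariance bound by an arbitrary Lipschitz constant. The
  supremum is meaningful because the set is bounded by \<open>K\<close> and, thanks to
  \<open>a\<close> and \<open>b\<close>, nonempty.\<close>

lemma lip_seminorm_bounds:
  assumes K: "0 \<le> K"
    and lip: "\<And>z w. z \<in> julia T \<Longrightarrow> w \<in> julia T \<Longrightarrow> \<bar>f z - f w\<bar> \<le> K * jdist T z w"
    and pos: "\<And>z w. z \<in> julia T \<Longrightarrow> w \<in> julia T \<Longrightarrow> z \<noteq> w \<Longrightarrow> 0 < jdist T z w"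
    and ab: "a \<in> julia T" "b \<in> julia T" "a \<noteq> b"
  shows "0 \<le> lip_seminorm T f" "lip_seminorm T f \<le> K"
proof -
  let ?S = "{\<bar>f z - f w\<bar> / jdist T z w | z w. z \<in> julia T \<and> w \<in> julia T \<and> z \<noteq> w}"
  have ub: "s \<le> K" if "s \<in> ?S" for s
  proof -
    obtain z w where zw: "s = \<bar>f z - f w\<bar> / jdist T z w" "z \<in> julia T" "w \<in> julia T" "z \<noteq> w"
      using \<open>s \<in> ?S\<close> by blast
    show ?thesis using lip[OF zw(2,3)] pos[OF zw(2-4)] by (simp add: zw(1) divide_le_eq)
  qed
  have mem: "\<bar>f a - f b\<bar> / jdist T a b \<in> ?S" using ab by blast
  then show "lip_seminorm T f \<le> K"
    unfolding lip_seminorm_def by (intro cSup_least ub) auto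
  have "0 \<le> \<bar>f a - f b\<bar> / jdist T a b" using pos[OF ab] by simp
  also have "\<dots> \<le> Sup ?S" using ub by (intro cSup_upper[OF mem]) (auto simp: bdd_above_def)
  finally show "0 \<le> lip_seminorm T f" by (simp only: lip_seminorm_def)
qed

text \<open>Treats both metrics at once: \<open>\<phi>\<close> will be \<open>stereo\<close> for the
  chordal and \<open>to_complex\<close> for the Euclidean one. Distances agree only on the Julia
  set, hence the restriction to its points throughout.\<close>

lemma AE_rates_of_embedding:
  fixes \<phi> :: "rsphere \<Rightarrow> 'b::euclidean_space"
  assumes prob: "prob_space \<mu>" and sp: "space \<mu> = julia T"
    and inv: "invariant_measure T \<mu>" and na: "non_atomic \<mu>" and decay: "superpoly_covariance_decay T \<mu>"
    and meas: "\<phi> \<in> borel_measurable \<mu>" and inj: "inj_on \<phi> (julia T)" and bdd: "bounded (\<phi> ` julia T)"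
    and jd: "\<And>z w. z \<in> julia T \<Longrightarrow> w \<in> julia T \<Longrightarrow> jdist T z w = dist (\<phi> z) (\<phi> w)"
    and m: "1 \<le> m" and L: "1 < L" and d: "0 < \<delta>"
    and lip: "\<And>x y. x \<in> julia T \<Longrightarrow> y \<in> julia T \<Longrightarrow> dist (\<phi> ((T ^^ m) x)) (\<phi> ((T ^^ m) y)) \<le> L * dist (\<phi> x) (\<phi> y)"
    and exp: "\<And>x y. x \<in> julia T \<Longrightarrow> y \<in> julia T \<Longrightarrow> dist (\<phi> x) (\<phi> y) < \<delta> \<Longrightarrow>
      2 * dist (\<phi> x) (\<phi> y) \<le> dist (\<phi> ((T ^^ m) x)) (\<phi> ((T ^^ m) y))"
  shows "AE z in \<mu>. lower_recurrence_rate T z \<ge> lower_local_dim T \<mu> z \<and>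
                    upper_recurrence_rate T z \<ge> upper_local_dim T \<mu> z"
proof -
  interpret prob_space \<mu> by (rule prob)
  obtain a b where ab: "a \<in> julia T" "b \<in> julia T" "a \<noteq> b"
    using non_atomic_two_points[OF prob na] sp by metis
  have pos: "0 < jdist T z w" if "z \<in> julia T" "w \<in> julia T" "z \<noteq> w" for z w
    using that jd inj by (auto dest: inj_onD)
  from decay obtain \<theta> where th0: "\<forall>n. 0 \<le> \<theta> n" "\<forall>p::real. p > 0 \<longrightarrow> (\<lambda>n. real n powr p * \<theta> n) \<longlonglongrightarrow> 0"
    "\<forall>f g. jlipschitz T f \<longrightarrow> jlipschitz T g \<longrightarrow>
      (\<forall>n\<ge>1. \<bar>(LINT z|\<mu>. f ((T ^^ n) z) * g z) - (LINT z|\<mu>. f z) * (LINT z|\<mu>. g z)\<bar>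
        \<le> lip_seminorm T f * lip_seminorm T g * \<theta> n)"
    unfolding superpoly_covariance_decay_def by (elim exE conjE) (rule that; assumption)
  have th: "\<And>n. 0 \<le> \<theta> n" "\<And>p. p > 0 \<Longrightarrow> (\<lambda>n. real n powr p * \<theta> n) \<longlonglongrightarrow> 0"
    "\<And>f g n. jlipschitz T f \<Longrightarrow> jlipschitz T g \<Longrightarrow> n \<ge> 1 \<Longrightarrow>
      \<bar>(LINT z|\<mu>. f ((T ^^ n) z) * g z) - (LINT z|\<mu>. f z) * (LINT z|\<mu>. g z)\<bar>
        \<le> lip_seminorm T f * lip_seminorm T g * \<theta> n"
    using th0 by blast+
  interpret superpoly_mixing_system \<mu> T \<phi> \<theta>
  proof
    fix K K' :: real and n :: nat and f g :: "rsphere \<Rightarrow> real"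
    assume K: "0 \<le> K" "0 \<le> K'" and n: "1 \<le> n"
      and f: "\<And>x y. x \<in> space \<mu> \<Longrightarrow> y \<in> space \<mu> \<Longrightarrow> \<bar>f x - f y\<bar> \<le> K * dist (\<phi> x) (\<phi> y)"
      and g: "\<And>x y. x \<in> space \<mu> \<Longrightarrow> y \<in> space \<mu> \<Longrightarrow> \<bar>g x - g y\<bar> \<le> K' * dist (\<phi> x) (\<phi> y)"
    have f': "\<bar>f x - f y\<bar> \<le> K * jdist T x y" and g': "\<bar>g x - g y\<bar> \<le> K' * jdist T x y"
      if "x \<in> julia T" "y \<in> julia T" for x y
      using f g that jd by (simp_all add: sp)
    have "jlipschitz T f" "jlipschitz T g" unfolding jlipschitz_def using f' g' by blast+
    then have "\<bar>(\<integral>x. f ((T ^^ n) x) * g x \<partial>\<mu>) - (\<integral>x. f x \<partial>\<mu>) * (\<integral>x. g x \<partial>\<mu>)\<bar>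
        \<le> lip_seminorm T f * lip_seminorm T g * \<theta> n"
      using n by (rule th(3))
    also have "\<dots> \<le> K * K' * \<theta> n"
      using lip_seminorm_bounds[OF K(1) f' pos ab] lip_seminorm_bounds[OF K(2) g' pos ab] K th(1)
      by (intro mult_right_mono mult_mono) auto
    finally show "\<bar>(\<integral>x. f ((T ^^ n) x) * g x \<partial>\<mu>) - (\<integral>x. f x \<partial>\<mu>) * (\<integral>x. g x \<partial>\<mu>)\<bar> \<le> K * K' * \<theta> n" .
  qed (use inv meas inj bdd th in \<open>auto simp: invariant_measure_def sp\<close>)
  have nb: "jball T z r = nball z r" if "z \<in> julia T" for z r
    using jd that by (auto simp: jball_def nball_def sp)
  have "AE z in \<mu>. Liminf (at_right 0) (ball_exponent z) \<le> Liminf (at_right 0) (return_exponent z) \<and>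
    Limsup (at_right 0) (ball_exponent z) \<le> Limsup (at_right 0) (return_exponent z)"
    by (rule AE_rates_ge_dims[OF m L d]) (use lip exp in \<open>auto simp: sp\<close>)
  with AE_space show ?thesis
  proof eventually_elim
    case (elim z)
    then have z: "z \<in> julia T" by (simp add: sp)
    have "lower_local_dim T \<mu> z = Liminf (at_right 0) (ball_exponent z)"
      "upper_local_dim T \<mu> z = Limsup (at_right 0) (ball_exponent z)"
      by (simp_all add: lower_local_dim_def upper_local_dim_def ball_exponent_def[abs_def] nb[OF z])
    moreover have "lower_recurrence_rate T z = Liminf (at_right 0) (return_exponent z)"
      "upper_recurrence_rate T z = Limsup (at_right 0) (return_exponent z)"
      by (simp_all add: lower_recurrence_rate_def upper_recurrence_rate_def return_exponent_def[abs_def]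
          return_time_def recurrence_time_def nb[OF z])
    ultimately show ?case using elim(2) by simp
  qed
qed

section \<open>From derivatives to expansion on the Julia set\<close>

lemma compact_julia: "compact (julia T)"
  using compact_Int_closed[OF compact_UNIV_rsphere, of "julia T"] by (simp add: julia_def)

lemma to_complex_rat_map: "to_complex (rat_map p q (Fin v)) = poly p v / poly q v"
  by (simp add: rat_map_def)

text \<open>\<open>deriv\<close> has no content where no derivative exists, so existence has to be
  secured before hyperbolicity can be used. Orbits in \<open>J\<close> avoid \<open>Infty\<close>,
  and by continuity on the sphere so do the first iterates of nearby points; there the next iterate
  is an honest quotient of polynomials and the chain rule applies.\<close>

lemma affine_iterate_differentiable:
  assumes T: "T = rat_map p q" and q: "q \<noteq> 0" "coprime p q"
    and inv: "\<And>x. x \<in> J \<Longrightarrow> T x \<in> J" and inf: "Infty \<notin> J" and z: "Fin z \<in> J"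
  shows "\<exists>D. ((\<lambda>w. to_complex ((T ^^ n) (Fin w))) has_field_derivative D) (at z)"
proof (induction n)
  case 0
  show ?case by (auto intro!: exI[of _ 1] derivative_eq_intros)
next
  case (Suc n)
  define G where "G w = to_complex ((T ^^ n) (Fin w))" for w
  obtain D where D: "(G has_field_derivative D) (at z)" using Suc unfolding G_def by blast
  have inJ: "(T ^^ k) (Fin z) \<in> J" for k by (induction k) (use z inv in auto)
  then have fin: "(T ^^ k) (Fin z) \<noteq> Infty" for k using inf by metis
  have Gz: "Fin (G z) = (T ^^ n) (Fin z)" using Fin_to_complex[OF fin] by (simp add: G_def)
  have "poly q (G z) \<noteq> 0"
  proof
    assume "poly q (G z) = 0"
    then have "T (Fin (G z)) = Infty" by (simp add: T rat_map_def)
    then have "(T ^^ Suc n) (Fin z) = Infty" by (simp add: Gz)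
    then show False using fin by blast
  qed
  then have "\<exists>D'. ((\<lambda>v. poly p v / poly q v) has_field_derivative D') (at (G z))"
    by (intro exI) (auto intro!: derivative_eq_intros)
  then obtain D' where D': "((\<lambda>v. poly p v / poly q v) has_field_derivative D') (at (G z))" by blast
  have chain: "((\<lambda>w. poly p (G w) / poly q (G w)) has_field_derivative (D' * D)) (at z)"
    using DERIV_chain[OF D' D] by (simp add: comp_def)
  obtain c where c: "metric_deriv (T ^^ n) (Fin z) c"
    using metric_deriv_funpow[of T n] metric_deriv_rat_map[OF q] T by blast
  have "isCont (\<lambda>w. (T ^^ n) (Fin w)) z"
    by (rule metric_deriv_isCont[OF metric_deriv_compose[OF metric_deriv_Fin c]])
  then have "((\<lambda>w. (T ^^ n) (Fin w)) \<longlongrightarrow> (T ^^ n) (Fin z)) (nhds z)"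
    using tendsto_at_iff_tendsto_nhds[of "\<lambda>w. (T ^^ n) (Fin w)" z] by (simp add: isCont_def)
  then have "eventually (\<lambda>w. (T ^^ n) (Fin w) \<noteq> Infty) (nhds z)"
    using fin by (rule tendsto_imp_eventually_ne)
  then have "eventually (\<lambda>w. to_complex ((T ^^ Suc n) (Fin w)) = poly p (G w) / poly q (G w)) (nhds z)"
  proof eventually_elim
    case (elim w)
    then have "(T ^^ n) (Fin w) = Fin (G w)" using Fin_to_complex by (simp add: G_def)
    then show ?case by (simp add: T to_complex_rat_map)
  qed
  then have "((\<lambda>w. to_complex ((T ^^ Suc n) (Fin w))) has_field_derivative (D' * D)) (at z)"
    using chain by (subst DERIV_cong_ev[OF refl _ refl])
  then show ?case by blast
qed

lemma metric_deriv_eq_norm_deriv: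
  fixes G :: "complex \<Rightarrow> complex"
  assumes "metric_deriv G z c" "(G has_field_derivative D) (at z)"
  shows "c = cmod (deriv G z)"
proof -
  have "((\<lambda>w. (G w - G z) / (w - z)) \<longlongrightarrow> D) (at z)"
    using assms(2) by (simp add: has_field_derivative_iff)
  then have "((\<lambda>w. cmod ((G w - G z) / (w - z))) \<longlongrightarrow> cmod D) (at z)" by (rule tendsto_norm)
  then have "((\<lambda>w. dist (G w) (G z) / dist w z) \<longlongrightarrow> cmod D) (at z)"
    by (simp add: norm_divide dist_norm)
  with metric_deriv_tendsto[OF assms(1)] have "c = cmod D"
    by (intro tendsto_unique[of "at z"]) auto
  then show ?thesis using DERIV_imp_deriv[OF assms(2)] by simp
qed

theorem theorem2:
  fixes T :: "rsphere \<Rightarrow> rsphere" and d :: nat and \<mu> :: "rsphere measure"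
  assumes "rational_map T d" and "d \<ge> 2"
    and "hyperbolic T"
    and "prob_space \<mu>"
    and "sets \<mu> = sets (restrict_space borel (julia T))"
    and "invariant_measure T \<mu>"
    and "non_atomic \<mu>"
    and "superpoly_covariance_decay T \<mu>"
  shows "AE z in \<mu>. lower_recurrence_rate T z \<ge> lower_local_dim T \<mu> z \<and>
                    upper_recurrence_rate T z \<ge> upper_local_dim T \<mu> z"
proof -
  define J where "J = julia T"
  have sp: "space \<mu> = J"
    using sets_eq_imp_space_eq[OF assms(5)] by (simp add: J_def space_restrict_space)
  obtain p q where pq: "q \<noteq> 0" "coprime p q" "T = rat_map p q"
    using assms(1) unfolding rational_map_def by blast
  \<comment> \<open>Forward invariance is read off from measurability of \<open>T\<close> on
    \<open>\<mu>\<close>, whose space is the Julia set.\<close>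
  have TJ: "T x \<in> J" if "x \<in> J" for x
    using measurable_space[of T \<mu> \<mu> x] assms(6) that sp by (auto simp: invariant_measure_def)
  have TnJ: "(T ^^ n) x \<in> J" if "x \<in> J" for n x
    by (induction n) (use that TJ in auto)
  have mT: "\<exists>c. metric_deriv (T ^^ n) x c" for n x
    using metric_deriv_funpow[of T n x] metric_deriv_rat_map[OF pq(1,2)] pq(3) by blast
  have cJ: "compact J" unfolding J_def by (rule compact_julia)
  obtain C l where Cl: "0 < C" "1 < l" "\<And>z n. z \<in> J \<Longrightarrow> n \<ge> 1 \<Longrightarrow> C * l ^ n \<le> jderiv T n z"
    using assms(3) unfolding hyperbolic_def J_def by blast
  \<comment> \<open>An iterate with derivative at least 3 leaves room for local expansion by 2; the
    successor in the exponent ensures \<open>m \<ge> 1\<close>.\<close>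
  obtain m where m: "1 \<le> m" "3 \<le> C * l ^ m"
  proof -
    obtain k where "3 / C < l ^ k" using real_arch_pow[OF Cl(2)] by blast
    also have "l ^ k \<le> l ^ Suc k" using Cl(2) by (intro power_increasing) auto
    finally have "3 \<le> C * l ^ Suc k" using Cl(1) by (simp add: field_simps)
    then show ?thesis using that[of "Suc k"] by simp
  qed
  have large: "3 \<le> jderiv T m z" if "z \<in> J" for z
    using Cl(3)[OF that m(1)] m(2) by linarith
  have meas_eq: "borel_measurable \<mu> = borel_measurable (restrict_space borel J)"
    using assms(5) by (intro measurable_cong_sets) (simp_all add: J_def)
  show ?thesis
  proof (cases "Infty \<in> J")
    case True
    have cont: "continuous_on S stereo" for S
      by (rule continuous_at_imp_continuous_on) (use continuous_stereo in blast)
    obtain L where L: "1 < L" "\<And>x y. x \<in> J \<Longrightarrow> y \<in> J \<Longrightarrow> dist ((T ^^ m) x) ((T ^^ m) y) \<le> L * dist x y"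
      by (rule compact_Lipschitz[OF cJ mT[of m]]) (rule that; assumption)
    \<comment> \<open>In the chordal case the scaling factor on the sphere is by uniqueness of
      limits the derivative in the hyperbolicity condition.\<close>
    have three: "\<exists>c\<ge>3. metric_deriv (T ^^ m) x c" if x: "x \<in> J" for x
    proof -
      obtain c where c: "metric_deriv (T ^^ m) x c" using mT by blast
      then have "jderiv T m x = c" using True chordal_deriv_eq by (simp add: jderiv_def J_def)
      then show ?thesis using c large[OF x] by auto
    qed
    obtain \<delta> where \<delta>: "0 < \<delta>" "\<And>x y. x \<in> J \<Longrightarrow> y \<in> J \<Longrightarrow> dist x y < \<delta> \<Longrightarrow>
        2 * dist x y \<le> dist ((T ^^ m) x) ((T ^^ m) y)"
      by (rule compact_locally_expanding[OF cJ three]) (assumption | rule that)+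
    show ?thesis
    proof (rule AE_rates_of_embedding[where \<phi>=stereo and m=m and L=L and \<delta>=\<delta>])
      show "stereo \<in> borel_measurable \<mu>"
        unfolding meas_eq by (rule borel_measurable_continuous_on_restrict[OF cont])
      show "bounded (stereo ` julia T)"
        using cJ unfolding J_def by (intro compact_imp_bounded compact_continuous_image cont)
      show "inj_on stereo (julia T)" using inj_stereo inj_on_subset by blast
    qed (use assms sp True L \<delta> m in \<open>auto simp: J_def dist_stereo jdist_def\<close>)
  next
    case False
    define K where "K = to_complex ` J"
    have FinJ: "Fin (to_complex x) = x" if "x \<in> J" for x
      using that False Fin_to_complex by metis
    have FinK: "Fin z \<in> J" if "z \<in> K" for z using that FinJ by (auto simp: K_def)
    have cont: "continuous_on J to_complex"
      by (rule continuous_at_imp_continuous_on) (use FinJ isCont_to_complex in metis)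
    have cK: "compact K" unfolding K_def by (rule compact_continuous_image[OF cont cJ])
    define G where "G w = to_complex ((T ^^ m) (Fin w))" for w
    \<comment> \<open>In the Euclidean case the scaling factor comes from composing
      \<open>Fin\<close>, the iterate and \<open>to_complex\<close>; complex differentiability then
      identifies it with the modulus of the derivative.\<close>
    have mG: "\<exists>c\<ge>3. metric_deriv G z c" if z: "z \<in> K" for z
    proof -
      obtain c1 where c1: "metric_deriv (T ^^ m) (Fin z) c1" using mT by blast
      have "(T ^^ m) (Fin z) = Fin (G z)"
        using FinJ[OF TnJ[OF FinK[OF z]]] by (simp add: G_def)
      then have c2: "metric_deriv to_complex ((T ^^ m) (Fin z)) ((1 + (cmod (G z))\<^sup>2) / 2)"
        using metric_deriv_to_complex by simp
      obtain c where c: "metric_deriv G z c"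
        using metric_deriv_compose[OF metric_deriv_compose[OF metric_deriv_Fin c1] c2]
        unfolding G_def by blast
      obtain D where "(G has_field_derivative D) (at z)"
        using affine_iterate_differentiable[OF pq(3,1,2) TJ False FinK[OF z], of m]
        unfolding G_def by blast
      with c have "c = cmod (deriv G z)" by (rule metric_deriv_eq_norm_deriv)
      also have "\<dots> = jderiv T m (Fin z)"
        using False by (simp add: jderiv_def J_def affine_deriv_def G_def[abs_def])
      finally show ?thesis using c large[OF FinK[OF z]] by auto
    qed
    have mG': "\<exists>c. metric_deriv G z c" if "z \<in> K" for z using mG[OF that] by blast
    obtain L where L: "1 < L" "\<And>x y. x \<in> K \<Longrightarrow> y \<in> K \<Longrightarrow> dist (G x) (G y) \<le> L * dist x y"
      by (rule compact_Lipschitz[OF cK mG']) (assumption | rule that)+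
    obtain \<delta> where \<delta>: "0 < \<delta>" "\<And>x y. x \<in> K \<Longrightarrow> y \<in> K \<Longrightarrow> dist x y < \<delta> \<Longrightarrow>
        2 * dist x y \<le> dist (G x) (G y)"
      by (rule compact_locally_expanding[OF cK mG]) (assumption | rule that)+
    have GJ: "to_complex ((T ^^ m) x) = G (to_complex x)" if "x \<in> J" for x
      by (simp add: G_def FinJ[OF that])
    have inK: "to_complex x \<in> K" if "x \<in> J" for x using that by (simp add: K_def)
    show ?thesis
    proof (rule AE_rates_of_embedding[where \<phi>=to_complex and m=m and L=L and \<delta>=\<delta>])
      show "to_complex \<in> borel_measurable \<mu>"
        unfolding meas_eq by (rule borel_measurable_continuous_on_restrict[OF cont])
      show "bounded (to_complex ` julia T)"
        using cK unfolding K_def J_def by (rule compact_imp_bounded)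
      show "inj_on to_complex (julia T)"
        using FinJ unfolding J_def by (metis inj_onI)
      show "dist (to_complex ((T ^^ m) x)) (to_complex ((T ^^ m) y)) \<le> L * dist (to_complex x) (to_complex y)"
        if "x \<in> julia T" "y \<in> julia T" for x y
        using that L(2) GJ inK by (simp add: J_def)
      show "2 * dist (to_complex x) (to_complex y) \<le> dist (to_complex ((T ^^ m) x)) (to_complex ((T ^^ m) y))"
        if "x \<in> julia T" "y \<in> julia T" "dist (to_complex x) (to_complex y) < \<delta>" for x y
        using that \<delta>(2) GJ inK by (simp add: J_def)
    qed (use assms sp False L(1) \<delta>(1) m in \<open>auto simp: J_def jdist_def dist_norm\<close>)
  qed
qed

end
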